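(* Let $X$ be a separable and piecewise quasiconvex metric space (with constant $c\ge1$) and let $T\in\mathbf M_1(X)$. Then for any $\varepsilon>0$ there exist $C\in\mathbf M_1(X)$ and $R\in\mathcal R_1(X)$ such that 1. $\partial C=0$; 2. $T=C+R$; 3. $\mathbf M(C)\le\mathbf M(T)+c\|\partial T\|_{\mathrm{KR}}+\varepsilon$; 4. $\mathbf M(R)\le c\|\partial T\|_{\mathrm{KR}}+\varepsilon$.
   Context: Let $(X,d)$ be a metric space (not assumed complete). $\mathrm{Lip}(X)$ is the space of real-valued Lipschitz functions on $X$, $\mathrm{Lip}(f)$ the Lipschitz constant, $\mathrm{Lip}_b(X)$ the bounded ones, $\mathrm{Lip}_1(X)$ those with Lipschitz constant at most $1$. A metric $1$-current on $X$ (element of $\mathbf M_1(X)$) is a bilinear functional $T:\mathrm{Lip}_b(X)\times \mathrm{Lip}(X)\to\mathbb R$ such that: (i) (finite mass) there is a finite Borel measure $\mu$ on $X$ with $|T(f,\pi)|\le \mathrm{Lip}(\pi)\int_X |f|\,d\mu$ for all $(f,\pi)$; the minimal such measure is the mass measure $\|T\|$, and $\mathbf M(T):=\|T\|(X)$; (ii) (continuity) if $\pi_j\to\pi$ pointwise and $\sup_j\mathrm{Lip}(\pi_j)<\infty$, then $T(f,\pi_j)\to T(f,\pi)$; (iii) (locality) $T(f,\pi)=0$ whenever $\pi$ is constant on a neighborhood of $\operatorname{spt}f$. The boundary is $\partial T(f):=T(1,f)$, $f\in\mathrm{Lip}(X)$, and $\|\partial T\|_{\mathrm{KR}}:=\sup\{\partial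 T(f):f\in\mathrm{Lip}_1(X)\}$. $\mathcal R_1(X)$ (rectifiable $1$-currents) is the set of $R\in\mathbf M_1(X)$ such that $\|R\|$ is concentrated on a countable union of Lipschitz images of bounded subsets of $\mathbb R$ and $\|R\|\ll\mathcal H^1$ (Hausdorff measure). For a Lipschitz curve $\theta:[0,1]\to X$, $\ell(\theta):=\int_0^1|\dot\theta|(t)\,dt$ with $|\dot\theta|(t)=\limsup_{h\to0^+}d(\theta(t+h),\theta(t))/h$. $X$ is piecewise quasiconvex with constant $c\ge1$ if for all $x,y\in X$ and $\eta>0$ there exist finitely many pairs $(x_1,y_1),\dots,(x_m,y_m)\in X^2$ with $d(x,x_1)+d(y_m,y)+\sum_{i=1}^{m-1}d(x_{i+1},y_i)<\eta$ and Lipschitz curves $\theta_1,\dots,\theta_m:[0,1]\to X$ with $\theta_i(0)=x_i$, $\theta_i(1)=y_i$ and $\sum_{i=1}^m\ell(\theta_i)\le c\,d(x,y)$. *)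

theory Defs
  imports "HOL-Analysis.Analysis"
begin

section \<open>Lipschitz functions\<close>

definition Lip :: "('a::metric_space \<Rightarrow> real) set" where
  "Lip = {f. \<exists>L. L-lipschitz_on UNIV f}"

definition lip_const :: "('a::metric_space \<Rightarrow> real) \<Rightarrow> real" where
  "lip_const f = Inf {L. L-lipschitz_on UNIV f}"

definition Lip_b :: "('a::metric_space \<Rightarrow> real) set" where
  "Lip_b = {f \<in> Lip. bounded (range f)}"

definition Lip_1 :: "('a::metric_space \<Rightarrow> real) set" where
  "Lip_1 = {f \<in> Lip. lip_const f \<le> 1}"


section \<open>Metric 1-currents\<close>

text \<open>
  A functional on \<open>Lip_b \<times> Lip\<close> is represented by a total function of two arguments whose values
  outside \<open>Lip_b \<times> Lip\<close> are irrelevant: every notion below, including equality of functionals,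
  only looks at arguments in that domain.
\<close>

type_synonym 'a functional = "('a \<Rightarrow> real) \<Rightarrow> ('a \<Rightarrow> real) \<Rightarrow> real"

definition bilinear_functional :: "'a::metric_space functional \<Rightarrow> bool" where
  "bilinear_functional T \<longleftrightarrow>
     (\<forall>f\<in>Lip_b. \<forall>g\<in>Lip_b. \<forall>p\<in>Lip. \<forall>a b.
        T (\<lambda>x. a * f x + b * g x) p = a * T f p + b * T g p) \<and>
     (\<forall>f\<in>Lip_b. \<forall>p\<in>Lip. \<forall>q\<in>Lip. \<forall>a b.
        T f (\<lambda>x. a * p x + b * q x) = a * T f p + b * T f q)"

definition finite_borel_measure :: "'a::metric_space measure \<Rightarrow> bool" where
  "finite_borel_measure \<mu> \<longleftrightarrow> sets \<mu> = sets borel \<and> finite_measure \<mu>"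

definition mass_bound :: "'a::metric_space functional \<Rightarrow> 'a measure \<Rightarrow> bool" where
  "mass_bound T \<mu> \<longleftrightarrow> finite_borel_measure \<mu> \<and>
     (\<forall>f\<in>Lip_b. \<forall>p\<in>Lip. \<bar>T f p\<bar> \<le> lip_const p * (LINT x|\<mu>. \<bar>f x\<bar>))"

text \<open>The support of \<open>f\<close> is \<open>closure {x. f x \<noteq> 0}\<close>.\<close>

definition metric_1_currents :: "'a::metric_space functional set" where
  "metric_1_currents = {T. bilinear_functional T \<and>
     (\<exists>\<mu>. mass_bound T \<mu>) \<and>
     (\<forall>f\<in>Lip_b. \<forall>p\<in>Lip. \<forall>q. (\<forall>j. q j \<in> Lip) \<longrightarrow> (\<forall>x. (\<lambda>j. q j x) \<longlonglongrightarrow> p x) \<longrightarrow>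
        bdd_above (range (\<lambda>j::nat. lip_const (q j))) \<longrightarrow> (\<lambda>j. T f (q j)) \<longlonglongrightarrow> T f p) \<and>
     (\<forall>f\<in>Lip_b. \<forall>p\<in>Lip.
        (\<exists>U. open U \<and> closure {x. f x \<noteq> 0} \<subseteq> U \<and> p constant_on U) \<longrightarrow> T f p = 0)}"

text \<open>The mass measure is the setwise smallest measure satisfying the mass bound.\<close>

definition mass_measure :: "'a::metric_space functional \<Rightarrow> 'a measure" where
  "mass_measure T = (THE \<mu>. mass_bound T \<mu> \<and>
     (\<forall>\<nu>. mass_bound T \<nu> \<longrightarrow> (\<forall>A\<in>sets borel. emeasure \<mu> A \<le> emeasure \<nu> A)))"

definition mass :: "'a::metric_space functional \<Rightarrow> real" where
  "mass T = measure (mass_measure T) UNIV"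

definition boundary :: "'a::metric_space functional \<Rightarrow> ('a \<Rightarrow> real) \<Rightarrow> real" where
  "boundary T f = T (\<lambda>_. 1) f"

text \<open>
  For a current \<open>T\<close> the supremum is over a nonempty set of reals that is bounded above,
  by the total mass of any measure \<open>\<mu>\<close> with \<open>mass_bound T \<mu>\<close>.
\<close>

definition KR_norm :: "(('a::metric_space \<Rightarrow> real) \<Rightarrow> real) \<Rightarrow> real" where
  "KR_norm B = (SUP f\<in>Lip_1. B f)"


section \<open>Rectifiable 1-currents\<close>

text \<open>
  The one-dimensional Hausdorff (outer) measure, defined on all subsets. The library's
  \<open>diameter\<close> is only meaningful on bounded sets, hence the boundedness condition on the covers.
\<close>

definition hausdorff1_pre :: "real \<Rightarrow> 'a::metric_space set \<Rightarrow> ennreal" where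
  "hausdorff1_pre \<delta> A =
     (INF U \<in> {U :: nat \<Rightarrow> 'a set. A \<subseteq> (\<Union>i. U i) \<and> (\<forall>i. bounded (U i) \<and> diameter (U i) \<le> \<delta>)}.
        \<Sum>i. ennreal (diameter (U i)))"

definition hausdorff1 :: "'a::metric_space set \<Rightarrow> ennreal" where
  "hausdorff1 A = (SUP \<delta>\<in>{0<..}. hausdorff1_pre \<delta> A)"

text \<open>
  A countable union of Lipschitz images of bounded sets need not be Borel, so being concentrated
  on it is expressed by \<open>AE\<close>: its complement is contained in a Borel null set.
\<close>

definition rectifiable_1_currents :: "'a::metric_space functional set" where
  "rectifiable_1_currents = {R \<in> metric_1_currents.
     (\<exists>(B :: nat \<Rightarrow> real set) (\<gamma> :: nat \<Rightarrow> real \<Rightarrow> 'a).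
        (\<forall>n. bounded (B n) \<and> (\<exists>L. L-lipschitz_on (B n) (\<gamma> n))) \<and>
        (AE x in mass_measure R. x \<in> (\<Union>n. \<gamma> n ` B n))) \<and>
     (\<forall>A\<in>sets borel. hausdorff1 A = 0 \<longrightarrow> emeasure (mass_measure R) A = 0)}"


section \<open>Piecewise quasiconvexity\<close>

definition metric_speed :: "(real \<Rightarrow> 'a::metric_space) \<Rightarrow> real \<Rightarrow> ennreal" where
  "metric_speed \<theta> t = Limsup (at_right 0) (\<lambda>h. ennreal (dist (\<theta> (t + h)) (\<theta> t) / h))"

text \<open>
  For a curve parametrised by \<open>{0..1}\<close>, the speed at \<open>t < 1\<close> depends only on the values of the
  curve on \<open>{0..1}\<close>; the end point \<open>t = 1\<close> does not affect the integral.
\<close>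

definition curve_length :: "(real \<Rightarrow> 'a::metric_space) \<Rightarrow> ennreal" where
  "curve_length \<theta> = (\<integral>\<^sup>+t\<in>{0..1}. metric_speed \<theta> t \<partial>lborel)"

definition piecewise_quasiconvex :: "real \<Rightarrow> 'a::metric_space set \<Rightarrow> bool" where
  "piecewise_quasiconvex c X \<longleftrightarrow> c \<ge> 1 \<and>
     (\<forall>x\<in>X. \<forall>y\<in>X. \<forall>\<eta>>0. \<exists>(m::nat) p q (\<theta> :: nat \<Rightarrow> real \<Rightarrow> 'a).
        m \<ge> 1 \<and> p ` {1..m} \<subseteq> X \<and> q ` {1..m} \<subseteq> X \<and>
        dist x (p 1) + dist (q m) y + (\<Sum>i\<in>{1..<m}. dist (p (i + 1)) (q i)) < \<eta> \<and>
        (\<forall>i\<in>{1..m}. (\<exists>L. L-lipschitz_on {0..1} (\<theta> i)) \<and> \<theta> i ` {0..1} \<subseteq> X \<and>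
           \<theta> i 0 = p i \<and> \<theta> i 1 = q i) \<and>
        (\<Sum>i\<in>{1..m}. curve_length (\<theta> i)) \<le> ennreal (c * dist x y))"

end

theory Submission
  imports Defs
begin

text \<open>
  The functional \<open>\<partial>T\<close> on \<open>Lip\<close> is continuous under pointwise convergence with bounded Lipschitz
  constants. Since the space is separable, \<open>\<partial>T\<close> is therefore small on the 1-Lipschitz functions that
  vanish on a suitable finite set \<open>F\<close>. McShane extension from \<open>F\<close> bounds \<open>\<partial>T\<close>, up to a small multiple of
  the Lipschitz constant, by \<open>\<parallel>\<partial>T\<parallel>\<close> times the maximum of the molecules \<open>(f y - f x) / d(x, y)\<close> over
  pairs from \<open>F\<close>, and a minimax argument replaces the maximum by a convex combination. Quasiconvexity
  turns each molecule into a finite sum of curves, up to a small error, so \<open>\<partial>T\<close> agrees with the boundary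
  of a rectifiable current of mass about \<open>c \<parallel>\<partial>T\<parallel>\<close> up to a small error. Repeating this with the
  remainder and summing gives \<open>R\<close>, and \<open>C = T - R\<close>.

  A curve carries its current as a Riemann-Stieltjes integral, so that no differentiability theorem is
  needed: a weight \<open>g\<close> on the parameter interval gives a mass bound as soon as
  \<open>d(\<theta> s, \<theta> t) \<le> \<integral>\<^sub>s\<^sup>t g\<close>. The weight given by the metric speed bounds the mass by the length, and the
  weight \<open>L\<close> off \<open>\<theta> -` A\<close> shows that the mass measure vanishes on a set \<open>A\<close> with \<open>hausdorff1 A = 0\<close>.
\<close>

section \<open>Lipschitz functions and finite Borel measures\<close>

text \<open>Since the space need not be complete, curves cannot be passed to a limit. Only finite
  families of curves are built; each leaves a boundary defect, and a series converging in mass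
  removes the defects. A remainder of size \<open>e k\<close> left by one step costs
  \<open>c * e k\<close> in mass at the next, on top of that step's own tolerance, so tolerances
  with sum \<open>\<epsilon> / (1 + c)\<close> cost \<open>\<epsilon>\<close> altogether.

  The error \<open>e * lip_const f\<close> left by restricting to a finite set is not linear in
  \<open>f\<close>. For this reason the minimax step is formulated for sublinear functionals on all
  of \<open>Lip\<close>, and the convex weights, having sum 1, leave the error term unchanged.

  A further obstacle lies in the notion of mass: \<open>mass_measure\<close> is a definite
  description, so nothing can be said about it before a setwise least mass bound is known to exist.
  A setwise infimum of measures is not a measure in general; it is one here because mass bounds can
  be glued along Borel sets.\<close>

lemma Lip_I: "L-lipschitz_on UNIV f \<Longrightarrow> f \<in> Lip"
  unfolding Lip_def by blast

lemma lip_const_le: "L-lipschitz_on UNIV f \<Longrightarrow> lip_const f \<le> L"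
  unfolding lip_const_def by (rule cInf_lower) (auto intro!: bdd_belowI[of _ 0] dest: lipschitz_on_nonneg)

lemma lip_const_nonneg:
  assumes "f \<in> Lip" shows "0 \<le> lip_const f"
  using assms unfolding lip_const_def Lip_def
  by (intro cInf_greatest) (auto dest: lipschitz_on_nonneg)

text \<open>For \<open>x \<noteq> y\<close> every admissible constant bounds the difference
  quotient, hence so does their infimum: the infimum in \<open>lip_const\<close> is itself a
  Lipschitz constant.\<close>

lemma lip_const_dist:
  assumes "f \<in> Lip" shows "\<bar>f x - f y\<bar> \<le> lip_const f * dist x y"
proof (cases "x = y")
  case False
  have "\<bar>f x - f y\<bar> / dist x y \<le> lip_const f"
    unfolding lip_const_def
  proof (rule cInf_greatest)
    show "{L. L-lipschitz_on UNIV f} \<noteq> {}" using assms by (auto simp: Lip_def)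
    fix L assume "L \<in> {L. L-lipschitz_on UNIV f}"
    then have "\<bar>f x - f y\<bar> \<le> L * dist x y"
      using lipschitz_onD[of L UNIV f x y] by (simp add: dist_real_def)
    then show "\<bar>f x - f y\<bar> / dist x y \<le> L" using False by (simp add: field_simps)
  qed
  then show ?thesis using False by (simp add: field_simps)
qed simp

lemma lipschitz_on_lip_const:
  "f \<in> Lip \<Longrightarrow> (lip_const f)-lipschitz_on UNIV f"
  by (rule lipschitz_onI) (auto simp: dist_real_def lip_const_dist lip_const_nonneg)

lemma Lip_lincomb:
  assumes "f \<in> Lip" "g \<in> Lip"
  shows "(\<lambda>x. a * f x + b * g x) \<in> Lip"
    and "lip_const (\<lambda>x. a * f x + b * g x) \<le> \<bar>a\<bar> * lip_const f + \<bar>b\<bar> * lip_const g"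
proof -
  have "(\<bar>a\<bar> * lip_const f + \<bar>b\<bar> * lip_const g)-lipschitz_on UNIV (\<lambda>x. a * f x + b * g x)"
    by (intro lipschitz_intros lipschitz_on_lip_const assms)
  then show "(\<lambda>x. a * f x + b * g x) \<in> Lip"
    "lip_const (\<lambda>x. a * f x + b * g x) \<le> \<bar>a\<bar> * lip_const f + \<bar>b\<bar> * lip_const g"
    by (auto intro: Lip_I lip_const_le)
qed

lemma Lip_const: "(\<lambda>_. k) \<in> Lip" and lip_const_const: "lip_const (\<lambda>_. k) = 0"
  using lipschitz_on_constant[of UNIV k] Lip_I lip_const_le lip_const_nonneg
  by (blast, metis antisym)

lemma Lip_bD:
  assumes "f \<in> Lip_b" shows "f \<in> Lip" "\<exists>B>0. \<forall>x. \<bar>f x\<bar> \<le> B"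
  using assms by (auto simp: Lip_b_def bounded_pos)

lemma Lip_bI: "f \<in> Lip \<Longrightarrow> (\<And>x. \<bar>f x\<bar> \<le> B) \<Longrightarrow> f \<in> Lip_b"
  unfolding Lip_b_def by (auto simp: bounded_iff intro!: exI[of _ B])

lemma Lip_b_const: "(\<lambda>_. k) \<in> Lip_b"
  by (rule Lip_bI[OF Lip_const, of _ "\<bar>k\<bar>"]) simp

lemma Lip_b_lincomb:
  assumes "f \<in> Lip_b" "g \<in> Lip_b" shows "(\<lambda>x. a * f x + b * g x) \<in> Lip_b"
proof -
  obtain A B where A: "\<And>x. \<bar>f x\<bar> \<le> A" and B: "\<And>x. \<bar>g x\<bar> \<le> B"
    using assms[THEN Lip_bD(2)] by blast
  have "\<bar>a * f x + b * g x\<bar> \<le> \<bar>a\<bar> * A + \<bar>b\<bar> * B" for x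
    by (rule order_trans[OF abs_triangle_ineq])
       (auto simp: abs_mult intro!: add_mono mult_left_mono A B)
  then show ?thesis
    using Lip_lincomb(1)[OF assms[THEN Lip_bD(1)]] by (rule Lip_bI[rotated])
qed

lemma Lip_b_mult:
  assumes "f \<in> Lip_b" "g \<in> Lip_b" shows "(\<lambda>x. f x * g x) \<in> Lip_b"
proof -
  obtain A B where A: "\<And>x. \<bar>f x\<bar> \<le> A" "A > 0" and B: "\<And>x. \<bar>g x\<bar> \<le> B" "B > 0"
    using assms[THEN Lip_bD(2)] by blast
  have "\<bar>f x * g x - f y * g y\<bar> \<le> (A * lip_const g + B * lip_const f) * dist x y" for x y
  proof -
    have "f x * g x - f y * g y = f x * (g x - g y) + (f x - f y) * g y" by (simp add: algebra_simps)
    also have "\<bar>\<dots>\<bar> \<le> \<bar>f x\<bar> * \<bar>g x - g y\<bar> + \<bar>f x - f y\<bar> * \<bar>g y\<bar>"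
      by (metis abs_mult abs_triangle_ineq)
    also have "\<dots> \<le> A * (lip_const g * dist x y) + (lip_const f * dist x y) * B"
      using A B by (intro add_mono mult_mono lip_const_dist assms[THEN Lip_bD(1)])
        (auto simp: lip_const_nonneg assms[THEN Lip_bD(1)])
    finally show ?thesis by (simp add: algebra_simps)
  qed
  then have "(A * lip_const g + B * lip_const f)-lipschitz_on UNIV (\<lambda>x. f x * g x)"
    using A(2) B(2) assms[THEN Lip_bD(1), THEN lip_const_nonneg] by (intro lipschitz_onI) (auto simp: dist_real_def)
  moreover have "\<bar>f x * g x\<bar> \<le> A * B" for x
    using A B by (simp add: abs_mult mult_mono)
  ultimately show ?thesis by (blast intro: Lip_bI Lip_I)
qed

lemma Lip_continuous: "f \<in> Lip \<Longrightarrow> continuous_on UNIV f"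
  using lipschitz_on_lip_const lipschitz_on_continuous_on by blast

lemma finite_borel_measureD:
  assumes "finite_borel_measure \<mu>"
  shows "sets \<mu> = sets borel" "space \<mu> = UNIV" "finite_measure \<mu>"
  using assms sets_eq_imp_space_eq[of \<mu> borel] by (auto simp: finite_borel_measure_def)

lemma borel_measurable_sets_borel:
  assumes "f \<in> borel_measurable borel" "sets M = sets borel"
  shows "f \<in> borel_measurable M"
  using assms measurable_cong_sets[of M borel borel borel] by simp

lemma Lip_borel: "f \<in> Lip \<Longrightarrow> sets \<mu> = sets borel \<Longrightarrow> f \<in> borel_measurable \<mu>"
  using Lip_continuous borel_measurable_continuous_onI measurable_cong_sets by blast

lemma Lip_b_integrable:
  assumes "f \<in> Lip_b" "finite_borel_measure \<mu>"
  shows "integrable \<mu> f" "integrable \<mu> (\<lambda>x. \<bar>f x\<bar>)"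
proof -
  interpret finite_measure \<mu> using finite_borel_measureD[OF assms(2)] by simp
  obtain B where "\<And>x. \<bar>f x\<bar> \<le> B" using Lip_bD(2)[OF assms(1)] by blast
  then show "integrable \<mu> f"
    using Lip_borel[OF Lip_bD(1)[OF assms(1)]] finite_borel_measureD(1)[OF assms(2)]
    by (intro integrable_const_bound[of _ B]) auto
  then show "integrable \<mu> (\<lambda>x. \<bar>f x\<bar>)" by simp
qed

section \<open>Countable sums of measures\<close>

definition sum_measure :: "(nat \<Rightarrow> 'a::topological_space measure) \<Rightarrow> 'a measure" where
  "sum_measure M = measure_of UNIV (sets borel) (\<lambda>A. \<Sum>n. emeasure (M n) A)"

lemma sets_sum_measure [simp]: "sets (sum_measure M) = sets borel"
  unfolding sum_measure_def by (simp add: sigma_algebra.sets_measure_of_eq[OF sets.sigma_algebra_axioms[of borel, simplified]])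

lemma space_sum_measure [simp]: "space (sum_measure M) = UNIV"
  by (metis sets_eq_imp_space_eq sets_sum_measure space_borel)

lemma emeasure_sum_measure:
  assumes "\<And>n. sets (M n) = sets borel" "A \<in> sets borel"
  shows "emeasure (sum_measure M) A = (\<Sum>n. emeasure (M n) A)"
proof (rule emeasure_measure_of[OF sum_measure_def])
  show "A \<in> sets (sum_measure M)" using assms by simp
  show "positive (sets (sum_measure M)) (\<lambda>A. \<Sum>n. emeasure (M n) A)"
    by (simp add: positive_def)
  show "countably_additive (sets (sum_measure M)) (\<lambda>A. \<Sum>n. emeasure (M n) A)"
  proof (rule countably_additiveI)
    fix A :: "nat \<Rightarrow> 'a set"
    assume A: "range A \<subseteq> sets (sum_measure M)" "disjoint_family A"
    then have "(\<Sum>n. emeasure (M n) (\<Union> (range A))) = (\<Sum>n. \<Sum>i. emeasure (M n) (A i))"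
      by (simp add: assms(1) suminf_emeasure)
    \<comment> \<open>Two series of nonnegative terms are exchanged, read as Fubini for two counting
      measures.\<close>
    also have "\<dots> = (\<Sum>i. \<Sum>n. emeasure (M n) (A i))"
      by (simp flip: nn_integral_count_space_nat)
         (rule pair_sigma_finite.Fubini'[OF pair_sigma_finite.intro]; simp add: sigma_finite_measure_count_space)
    finally show "(\<Sum>i. \<Sum>n. emeasure (M n) (A i)) = (\<Sum>n. emeasure (M n) (\<Union> (range A)))" ..
  qed
qed auto

lemma nn_integral_sum_measure:
  assumes "\<And>n. sets (M n) = sets borel" "f \<in> borel_measurable borel"
  shows "(\<integral>\<^sup>+x. f x \<partial>sum_measure M) = (\<Sum>n. \<integral>\<^sup>+x. f x \<partial>M n)"
  using assms(2)
proof (induction rule: borel_measurable_induct)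
  case (cong f g)
  then show ?case by (metis (no_types, lifting) UNIV_I space_borel ext)
next
  case (set A)
  then show ?case
    by (simp add: nn_integral_indicator assms emeasure_sum_measure)
next
  case (mult u c)
  have "u \<in> borel_measurable (M n)" "u \<in> borel_measurable (sum_measure M)" for n
    using mult(2) assms(1) borel_measurable_sets_borel by (blast, simp add: borel_measurable_sets_borel)
  then show ?case by (simp add: nn_integral_cmult mult.IH)
next
  case (add u v)
  have "u \<in> borel_measurable (M n)" "u \<in> borel_measurable (sum_measure M)"
     "v \<in> borel_measurable (M n)" "v \<in> borel_measurable (sum_measure M)" for n
    using add(1,3) assms(1) by (simp_all add: borel_measurable_sets_borel)
  then show ?case using add by (simp add: nn_integral_add suminf_add)
next
  case (seq U)
  have m: "U i \<in> borel_measurable (M n)" "U i \<in> borel_measurable (sum_measure M)" for n i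
    using seq(1) assms(1) by (simp_all add: borel_measurable_sets_borel)
  have "(\<integral>\<^sup>+x. (SUP i. U i x) \<partial>sum_measure M) = (SUP i. \<Sum>n. \<integral>\<^sup>+x. U i x \<partial>M n)"
    using seq by (subst nn_integral_monotone_convergence_SUP) (auto simp: m)
  also have "\<dots> = (\<Sum>n. SUP i. \<integral>\<^sup>+x. U i x \<partial>M n)"
    using seq by (intro ennreal_suminf_SUP_eq[symmetric]) (auto simp: mono_def le_fun_def intro!: nn_integral_mono)
  also have "\<dots> = (\<Sum>n. \<integral>\<^sup>+x. (SUP i. U i x) \<partial>M n)"
    using seq by (subst nn_integral_monotone_convergence_SUP) (auto simp: m)
  finally show ?case by (simp add: image_image)
qed

section \<open>The mass measure\<close>

text \<open>A series padded with null measures, so that the facts on countable sums specialise;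
  \<open>suminf_case_nat2\<close> evaluates such a padded series.\<close>

definition add_measure :: "'a::topological_space measure \<Rightarrow> 'a measure \<Rightarrow> 'a measure" where
  "add_measure \<mu> \<nu> = sum_measure (case_nat \<mu> (case_nat \<nu> (\<lambda>_. null_measure borel)))"

lemma sets_add_measure [simp]: "sets (add_measure \<mu> \<nu>) = sets borel"
  by (simp add: add_measure_def)

lemma suminf_case_nat2:
  fixes g :: "'b \<Rightarrow> ennreal"
  assumes "g z = 0"
  shows "(\<Sum>n. g (case_nat a (case_nat b (\<lambda>_. z)) n)) = g a + g b"
proof -
  have "(\<Sum>n. g (case_nat a (case_nat b (\<lambda>_. z)) n)) = (\<Sum>n\<in>{0,1}. g (case_nat a (case_nat b (\<lambda>_. z)) n))"
    by (rule suminf_finite) (auto simp: assms split: nat.split)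
  then show ?thesis by simp
qed

lemma
  assumes "sets \<mu> = sets borel" "sets \<nu> = sets borel"
  shows emeasure_add_measure: "A \<in> sets borel \<Longrightarrow> emeasure (add_measure \<mu> \<nu>) A = emeasure \<mu> A + emeasure \<nu> A"
    and nn_integral_add_measure: "f \<in> borel_measurable borel \<Longrightarrow>
      (\<integral>\<^sup>+x. f x \<partial>add_measure \<mu> \<nu>) = (\<integral>\<^sup>+x. f x \<partial>\<mu>) + (\<integral>\<^sup>+x. f x \<partial>\<nu>)"
proof -
  have s: "sets (case_nat \<mu> (case_nat \<nu> (\<lambda>_. null_measure borel)) n) = sets borel" for n
    using assms by (simp split: nat.split)
  show "A \<in> sets borel \<Longrightarrow> emeasure (add_measure \<mu> \<nu>) A = emeasure \<mu> A + emeasure \<nu> A"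
    unfolding add_measure_def
    by (subst emeasure_sum_measure) (auto simp: s suminf_case_nat2[of "\<lambda>M. emeasure M A"])
  show "f \<in> borel_measurable borel \<Longrightarrow>
      (\<integral>\<^sup>+x. f x \<partial>add_measure \<mu> \<nu>) = (\<integral>\<^sup>+x. f x \<partial>\<mu>) + (\<integral>\<^sup>+x. f x \<partial>\<nu>)"
    unfolding add_measure_def
    by (subst nn_integral_sum_measure) (auto simp: s suminf_case_nat2[of "\<lambda>M. nn_integral M f"])
qed

lemma finite_borel_measureI:
  assumes "sets \<mu> = sets borel" "emeasure \<mu> UNIV < \<infinity>"
  shows "finite_borel_measure \<mu>"
  using assms sets_eq_imp_space_eq[of \<mu> borel]
  by (auto simp: finite_borel_measure_def intro!: finite_measureI)

lemma finite_borel_measure_less_top: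
  "finite_borel_measure \<mu> \<Longrightarrow> emeasure \<mu> A < \<infinity>"
  using finite_borel_measureD(3) finite_measure.emeasure_finite by (metis infinity_ennreal_def top.not_eq_extremum)

lemma finite_borel_measure_add:
  assumes "finite_borel_measure \<mu>" "finite_borel_measure \<nu>"
  shows "finite_borel_measure (add_measure \<mu> \<nu>)"
  using assms[THEN finite_borel_measureD(1)] assms[THEN finite_borel_measure_less_top]
  by (intro finite_borel_measureI) (auto simp: emeasure_add_measure)

text \<open>The sets with this property contain the closed sets and are stable under complements and
  countable disjoint unions. Closed sets form an intersection-stable generator of the Borel sets, so
  the pi-lambda induction applies.\<close>

lemma indicator_approx_Lip_b:
  fixes A :: "'a::metric_space set"
  assumes \<sigma>: "finite_borel_measure \<sigma>" and A: "A \<in> sets borel" and "e > 0"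
  shows "\<exists>h\<in>Lip_b. (\<forall>x. 0 \<le> h x \<and> h x \<le> 1) \<and> (LINT x|\<sigma>. \<bar>indicator A x - h x\<bar>) < e"
proof -
  interpret finite_measure \<sigma> using finite_borel_measureD[OF \<sigma>] by simp
  have sets [simp]: "sets \<sigma> = sets borel" and space [simp]: "space \<sigma> = UNIV"
    using finite_borel_measureD[OF \<sigma>] by auto
  define P where "P = (\<lambda>A::'a set. \<forall>e>0. \<exists>h\<in>Lip_b. (\<forall>x. 0 \<le> h x \<and> h x \<le> 1) \<and>
      (LINT x|\<sigma>. \<bar>indicator A x - h x\<bar>) < e)"
  have int: "integrable \<sigma> (\<lambda>x. \<bar>indicator A x - h x\<bar>)" if "A \<in> sets borel" "h \<in> Lip_b" for A h
  proof -
    have "integrable \<sigma> (indicator A :: _ \<Rightarrow> real)"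
      using that by (intro integrable_const_bound[of _ 1] borel_measurable_indicator) (auto simp: indicator_def)
    then show ?thesis using Lip_b_integrable(1)[OF that(2) \<sigma>] by (intro integrable_abs Bochner_Integration.integrable_diff)
  qed
  have Un: "P (A \<union> B)" if AB: "A \<in> sets borel" "B \<in> sets borel" "P A" "P B" for A B
    unfolding P_def
  proof (intro allI impI)
    fix e :: real assume "e > 0"
    then have "e/2 > 0" by simp
    then obtain h k where h: "h \<in> Lip_b" "\<And>x. 0 \<le> h x \<and> h x \<le> 1" "(LINT x|\<sigma>. \<bar>indicator A x - h x\<bar>) < e/2"
      and k: "k \<in> Lip_b" "\<And>x. 0 \<le> k x \<and> k x \<le> 1" "(LINT x|\<sigma>. \<bar>indicator B x - k x\<bar>) < e/2"
      using AB(3,4) unfolding P_def by meson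
    \<comment> \<open>This is \<open>h + k - h * k\<close>, that is
      \<open>1 - g = (1 - h) * (1 - k)\<close>: it mirrors the indicator of a union and keeps the
      values in the unit interval. The explicit coefficients match
      \<open>Lip_b_lincomb\<close>.\<close>
    define g where "g = (\<lambda>x. 1 * (1 * h x + 1 * k x) + (-1) * (h x * k x))"
    have g: "g \<in> Lip_b"
      unfolding g_def by (intro Lip_b_lincomb Lip_b_mult h k)
    have g1: "1 - g x = (1 - h x) * (1 - k x)" for x by (simp add: g_def algebra_simps)
    have prod: "\<bar>a * b - c * d\<bar> \<le> \<bar>a - c\<bar> + \<bar>b - d\<bar>" if "0 \<le> a" "a \<le> 1" "0 \<le> d" "d \<le> 1" for a b c d :: real
    proof -
      have "a * b - c * d = a * (b - d) + d * (a - c)" by (simp add: algebra_simps)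
      also have "\<bar>\<dots>\<bar> \<le> a * \<bar>b - d\<bar> + d * \<bar>a - c\<bar>" using that
        by (metis abs_mult abs_of_nonneg abs_triangle_ineq)
      also have "\<dots> \<le> 1 * \<bar>b - d\<bar> + 1 * \<bar>a - c\<bar>" using that by (intro add_mono mult_right_mono) auto
      finally show ?thesis by simp
    qed
    have "\<bar>indicator (A \<union> B) x - g x\<bar> \<le> \<bar>indicator A x - h x\<bar> + \<bar>indicator B x - k x\<bar>" for x
    proof -
      have "\<bar>indicator (A \<union> B) x - g x\<bar> = \<bar>(1 - indicator A x) * (1 - indicator B x) - (1 - h x) * (1 - k x)\<bar>"
        unfolding g1[symmetric] by (auto simp: indicator_def)
      also have "\<dots> \<le> \<bar>(1 - indicator A x) - (1 - h x)\<bar> + \<bar>(1 - indicator B x) - (1 - k x)\<bar>"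
        using h(2)[of x] k(2)[of x] by (intro prod) (auto simp: indicator_def)
      finally show ?thesis by (simp add: abs_minus_commute)
    qed
    then have "(LINT x|\<sigma>. \<bar>indicator (A \<union> B) x - g x\<bar>) \<le>
      (LINT x|\<sigma>. \<bar>indicator A x - h x\<bar> + \<bar>indicator B x - k x\<bar>)"
      using AB g h k by (intro integral_mono int Bochner_Integration.integrable_add) auto
    also have "\<dots> < e" using h k AB by (subst Bochner_Integration.integral_add) (auto intro: int)
    finally have "(LINT x|\<sigma>. \<bar>indicator (A \<union> B) x - g x\<bar>) < e" .
    moreover have "0 \<le> g x \<and> g x \<le> 1" for x
    proof -
      have "0 \<le> (1 - h x) * (1 - k x)" "(1 - h x) * (1 - k x) \<le> 1 * 1"
        using h(2)[of x] k(2)[of x] by (simp, intro mult_mono) auto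
      then show ?thesis using g1[of x] by linarith
    qed
    ultimately show "\<exists>h\<in>Lip_b. (\<forall>x. 0 \<le> h x \<and> h x \<le> 1) \<and> (LINT x|\<sigma>. \<bar>indicator (A \<union> B) x - h x\<bar>) < e"
      using g by blast
  qed
  have emp: "P {}" unfolding P_def using Lip_b_const[of 0] by (auto intro!: bexI[of _ "\<lambda>_. 0"])
  have "Int_stable (Collect closed :: 'a set set)" by (auto simp: Int_stable_def)
  moreover have "(Collect closed :: 'a set set) \<subseteq> Pow UNIV" by simp
  moreover have "A \<in> sigma_sets UNIV (Collect closed)"
    using A by (simp add: borel_eq_closed)
  ultimately have "P A"
  proof (induction rule: sigma_sets_induct_disjoint)
    case (basic F)
    then have F: "closed F" by simp
    show ?case
    proof (cases "F = {}")
      case False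
      \<comment> \<open>Cutoffs of slope \<open>n\<close> that converge pointwise to the indicator
        because \<open>F\<close> is closed. The empty set is separated because
        \<open>infdist\<close> to it is 0 by convention, which would make \<open>h n\<close>
        constantly 1.\<close>
      define h where "h = (\<lambda>n x. max 0 (1 - real n * infdist x F))"
      have "(real n)-lipschitz_on UNIV (h n)" for n
      proof (rule lipschitz_onI)
        fix x y
        have "\<bar>h n x - h n y\<bar> \<le> \<bar>real n * infdist x F - real n * infdist y F\<bar>"
          unfolding h_def by linarith
        also have "\<dots> = real n * \<bar>infdist x F - infdist y F\<bar>"
          by (simp add: abs_mult flip: right_diff_distrib)
        also have "\<dots> \<le> real n * dist x y"
          by (intro mult_left_mono infdist_triangle_abs) auto
        finally show "dist (h n x) (h n y) \<le> real n * dist x y" by (simp add: dist_real_def)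
      qed simp
      moreover have h01: "0 \<le> h n x \<and> h n x \<le> 1" for n x by (auto simp: h_def infdist_nonneg)
      ultimately have hL: "h n \<in> Lip_b" for n by (intro Lip_bI[of _ 1] Lip_I) auto
      have "(\<lambda>n. LINT x|\<sigma>. \<bar>indicator F x - h n x\<bar>) \<longlonglongrightarrow> (LINT x|\<sigma>. 0)"
      proof (rule integral_dominated_convergence[where w="\<lambda>_. 1"])
        show "(\<lambda>x. \<bar>indicator F x - h n x\<bar>) \<in> borel_measurable \<sigma>" for n
          using int[of F "h n"] F hL by auto
        show "AE x in \<sigma>. (\<lambda>n. \<bar>indicator F x - h n x\<bar>) \<longlonglongrightarrow> 0"
        proof (rule AE_I2)
          fix x
          show "(\<lambda>n. \<bar>indicator F x - h n x\<bar>) \<longlonglongrightarrow> 0"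
          proof (cases "x \<in> F")
            case True then show ?thesis by (simp add: h_def)
          next
            case False
            then have "infdist x F > 0" using F \<open>F \<noteq> {}\<close> infdist_pos_not_in_closed by blast
            then obtain N where N: "1 < real N * infdist x F" using reals_Archimedean3 by blast
            have "\<forall>\<^sub>F n in sequentially. h n x = 0"
              using eventually_ge_at_top[of N]
            proof eventually_elim
              case (elim n)
              then have "real N * infdist x F \<le> real n * infdist x F"
                by (intro mult_right_mono) (auto simp: infdist_nonneg)
              then show ?case using N by (simp add: h_def)
            qed
            then have "\<forall>\<^sub>F n in sequentially. 0 = \<bar>indicator F x - h n x\<bar>"
              by eventually_elim (use False in simp)
            then show ?thesis by (rule Lim_transform_eventually[rotated]) simp
          qed
        qed
        show "AE x in \<sigma>. norm \<bar>indicator F x - h n x\<bar> \<le> 1" for n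
          using h01 by (auto simp: indicator_def)
      qed auto
      then have "\<exists>n. (LINT x|\<sigma>. \<bar>indicator F x - h n x\<bar>) < e" if "e > 0" for e
        using that by (auto dest!: order_tendstoD(2)[of _ _ _ e] eventually_happens simp: trivial_limit_sequentially)
      then show ?thesis unfolding P_def using hL h01 by blast
    qed (use emp in simp)
  next
    case empty show ?case by (rule emp)
  next
    case (compl A)
    show ?case unfolding P_def
    proof (intro allI impI)
      fix e :: real assume "e > 0"
      then obtain h where h: "h \<in> Lip_b" "\<And>x. 0 \<le> h x \<and> h x \<le> 1" "(LINT x|\<sigma>. \<bar>indicator A x - h x\<bar>) < e"
        using compl(2) unfolding P_def by blast
      have "(\<lambda>x. 1 * 1 + (-1) * h x) \<in> Lip_b" by (intro Lip_b_lincomb Lip_b_const h)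
      moreover have "\<bar>indicator (UNIV - A) x - (1 * 1 + (-1) * h x)\<bar> = \<bar>indicator A x - h x\<bar>" for x
        by (auto simp: indicator_def)
      ultimately show "\<exists>h\<in>Lip_b. (\<forall>x. 0 \<le> h x \<and> h x \<le> 1) \<and> (LINT x|\<sigma>. \<bar>indicator (UNIV - A) x - h x\<bar>) < e"
        using h by (intro bexI[of _ "\<lambda>x. 1 * 1 + (-1) * h x"]) auto
    qed
  next
    case (union A)
    have Ab: "A i \<in> sets borel" for i using union(2) by (auto simp: borel_eq_closed)
    have fin: "P (\<Union>i<n. A i)" for n
    proof (induction n)
      case (Suc n)
      then show ?case using Ab union(3) by (subst lessThan_Suc, subst UN_insert, intro Un) auto
    qed (simp add: emp)
    have lim: "(\<lambda>n. measure \<sigma> (\<Union>i<n. A i)) \<longlonglongrightarrow> measure \<sigma> (\<Union>n. \<Union>i<n. A i)"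
      using Ab by (intro finite_Lim_measure_incseq) (force simp: incseq_def)+
    have UN: "(\<Union>n. \<Union>i<n. A i) = (\<Union>i. A i)" by auto
    show ?case unfolding P_def
    proof (intro allI impI)
      fix e :: real assume "e > 0"
      \<comment> \<open>Continuity from below: the first \<open>n\<close> sets miss less than
        \<open>e/2\<close> of the mass, and the other \<open>e/2\<close> is spent on approximating
        their finite union.\<close>
      then obtain n where n: "measure \<sigma> (\<Union>i. A i) < measure \<sigma> (\<Union>i<n. A i) + e/2"
        using order_tendstoD(1)[OF lim, of "measure \<sigma> (\<Union>i. A i) - e/2"] unfolding UN
        by (auto dest!: eventually_happens simp: algebra_simps)
      let ?U = "\<Union>i<n. A i"
      from \<open>e > 0\<close> have "e/2 > 0" by simp
      with fin[of n] obtain h where h: "h \<in> Lip_b" "\<And>x. 0 \<le> h x \<and> h x \<le> 1" "(LINT x|\<sigma>. \<bar>indicator ?U x - h x\<bar>) < e/2"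
        unfolding P_def by blast
      have U: "?U \<in> sets borel" "(\<Union>i. A i) \<in> sets borel" using Ab by auto
      have intU: "integrable \<sigma> (indicator ((\<Union>i. A i) - ?U) :: _ \<Rightarrow> real)"
        using U by (intro integrable_const_bound[of _ 1] borel_measurable_indicator) (auto simp: indicator_def)
      have "(LINT x|\<sigma>. \<bar>indicator (\<Union>i. A i) x - h x\<bar>) \<le>
         (LINT x|\<sigma>. indicator ((\<Union>i. A i) - ?U) x + \<bar>indicator ?U x - h x\<bar>)"
      proof (intro integral_mono int U h Bochner_Integration.integrable_add)
        show "integrable \<sigma> (indicator ((\<Union>i. A i) - ?U) :: _ \<Rightarrow> real)"
          by (rule intU)
        fix x
        show "\<bar>indicator (\<Union>i. A i) x - h x\<bar> \<le> indicator ((\<Union>i. A i) - ?U) x + \<bar>indicator ?U x - h x\<bar>"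
          using h(2)[of x] by (auto simp: indicator_def split: if_splits)
      qed
      also have "\<dots> = measure \<sigma> ((\<Union>i. A i) - ?U) + (LINT x|\<sigma>. \<bar>indicator ?U x - h x\<bar>)"
        using U h by (subst Bochner_Integration.integral_add)
          (auto intro!: int intU)
      also have "measure \<sigma> ((\<Union>i. A i) - ?U) = measure \<sigma> (\<Union>i. A i) - measure \<sigma> ?U"
        using U by (intro finite_measure_Diff) auto
      finally show "\<exists>h\<in>Lip_b. (\<forall>x. 0 \<le> h x \<and> h x \<le> 1) \<and> (LINT x|\<sigma>. \<bar>indicator (\<Union>i. A i) x - h x\<bar>) < e"
        using n h by (intro bexI[of _ h]) auto
    qed
  qed
  then show ?thesis using \<open>e > 0\<close> by (simp add: P_def)
qed

section \<open>Mass bounds and their restriction to Borel sets\<close>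

definition borel_restrict :: "'a::topological_space measure \<Rightarrow> 'a set \<Rightarrow> 'a measure" where
  "borel_restrict \<mu> A = density \<mu> (indicator A)"

lemma sets_borel_restrict [simp]: "sets (borel_restrict \<mu> A) = sets \<mu>"
  by (simp add: borel_restrict_def)

lemma emeasure_borel_restrict:
  "sets \<mu> = sets borel \<Longrightarrow> A \<in> sets borel \<Longrightarrow> B \<in> sets borel \<Longrightarrow>
    emeasure (borel_restrict \<mu> A) B = emeasure \<mu> (A \<inter> B)"
  unfolding borel_restrict_def
  by (subst emeasure_density) (auto simp: borel_measurable_sets_borel simp flip: indicator_inter_arith)

lemma nn_integral_borel_restrict:
  "sets \<mu> = sets borel \<Longrightarrow> A \<in> sets borel \<Longrightarrow> f \<in> borel_measurable borel \<Longrightarrow>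
    nn_integral (borel_restrict \<mu> A) f = (\<integral>\<^sup>+x. indicator A x * f x \<partial>\<mu>)"
  unfolding borel_restrict_def
  by (rule nn_integral_density) (auto simp: borel_measurable_sets_borel)

lemma finite_borel_measure_restrict:
  assumes "finite_borel_measure \<mu>" "A \<in> sets borel"
  shows "finite_borel_measure (borel_restrict \<mu> A)"
  using assms finite_borel_measureD[OF assms(1)] finite_borel_measure_less_top[OF assms(1)]
  by (intro finite_borel_measureI) (auto simp: emeasure_borel_restrict)

text \<open>In extended nonnegative integrals the bound is free of integrability conditions, which
  makes it easy to add, restrict and scale measures.\<close>

lemma mass_bound_iff:
  "mass_bound T \<mu> \<longleftrightarrow> finite_borel_measure \<mu> \<and>
     (\<forall>f\<in>Lip_b. \<forall>p\<in>Lip. ennreal \<bar>T f p\<bar> \<le> ennreal (lip_const p) * (\<integral>\<^sup>+x. ennreal \<bar>f x\<bar> \<partial>\<mu>))"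
proof -
  have "ennreal \<bar>T f p\<bar> \<le> ennreal (lip_const p) * (\<integral>\<^sup>+x. ennreal \<bar>f x\<bar> \<partial>\<mu>) \<longleftrightarrow>
      \<bar>T f p\<bar> \<le> lip_const p * (LINT x|\<mu>. \<bar>f x\<bar>)"
    if "finite_borel_measure \<mu>" "f \<in> Lip_b" "p \<in> Lip" for f p
    using Lip_b_integrable(2)[OF that(2,1)] lip_const_nonneg[OF that(3)]
    by (subst nn_integral_eq_integral) (auto simp: ennreal_mult[symmetric])
  then show ?thesis unfolding mass_bound_def by blast
qed

lemma mass_boundD:
  assumes "mass_bound T \<mu>"
  shows "finite_borel_measure \<mu>" "sets \<mu> = sets borel"
    "f \<in> Lip_b \<Longrightarrow> p \<in> Lip \<Longrightarrow> ennreal \<bar>T f p\<bar> \<le> ennreal (lip_const p) * (\<integral>\<^sup>+x. ennreal \<bar>f x\<bar> \<partial>\<mu>)"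
  using assms finite_borel_measureD unfolding mass_bound_iff by auto

lemma abs_Lip_b_borel: "f \<in> Lip_b \<Longrightarrow> (\<lambda>x. ennreal \<bar>f x\<bar>) \<in> borel_measurable borel"
  using Lip_borel[OF Lip_bD(1)] by measurable

lemma bilinear_functionalD:
  assumes "bilinear_functional T"
  shows "f \<in> Lip_b \<Longrightarrow> g \<in> Lip_b \<Longrightarrow> p \<in> Lip \<Longrightarrow> T (\<lambda>x. a * f x + b * g x) p = a * T f p + b * T g p"
    "f \<in> Lip_b \<Longrightarrow> p \<in> Lip \<Longrightarrow> q \<in> Lip \<Longrightarrow> T f (\<lambda>x. a * p x + b * q x) = a * T f p + b * T f q"
  using assms unfolding bilinear_functional_def by blast+

text \<open>
  Two mass bounds may be used on complementary Borel sets: multiply \<open>f\<close> by Lipschitz functions close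
  in \<open>L\<^sup>1\<close> to the indicator of \<open>A\<close>. This makes the setwise infimum of all mass bounds a measure,
  without any differentiation of measures.
\<close>

lemma mass_bound_splice:
  fixes T :: "'a::metric_space functional"
  assumes T: "bilinear_functional T" and \<mu>: "mass_bound T \<mu>" and \<nu>: "mass_bound T \<nu>"
    and A: "A \<in> sets borel"
  shows "mass_bound T (add_measure (borel_restrict \<mu> A) (borel_restrict \<nu> (- A)))"
  unfolding mass_bound_iff
proof (intro conjI ballI)
  note fin = mass_boundD(1)[OF \<mu>] mass_boundD(1)[OF \<nu>]
  note sets = mass_boundD(2)[OF \<mu>] mass_boundD(2)[OF \<nu>]
  have A': "- A \<in> sets borel" using A by simp
  show "finite_borel_measure (add_measure (borel_restrict \<mu> A) (borel_restrict \<nu> (- A)))"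
    using fin A by (intro finite_borel_measure_add finite_borel_measure_restrict) auto
  fix f p :: "'a \<Rightarrow> real" assume f: "f \<in> Lip_b" and p: "p \<in> Lip"
  obtain B where B: "B > 0" "\<And>x. \<bar>f x\<bar> \<le> B" using Lip_bD(2)[OF f] by blast
  define L where "L = lip_const p"
  have L: "L \<ge> 0" using p by (simp add: L_def lip_const_nonneg)
  define J where "J = (\<integral>\<^sup>+x. indicator A x * ennreal \<bar>f x\<bar> \<partial>\<mu>)"
  define K where "K = (\<integral>\<^sup>+x. indicator (-A) x * ennreal \<bar>f x\<bar> \<partial>\<nu>)"
  \<comment> \<open>One function \<open>h\<close> has to be close to the indicator of
    \<open>A\<close> in \<open>L^1\<close> of both measures, so it is chosen for their sum.\<close>
  define \<sigma> where "\<sigma> = add_measure \<mu> \<nu>"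
  have \<sigma>: "finite_borel_measure \<sigma>" unfolding \<sigma>_def using fin by (rule finite_borel_measure_add)
  have "ennreal \<bar>T f p\<bar> \<le> ennreal L * (J + K) + ennreal \<delta>" if "\<delta> > 0" for \<delta>
  proof -
    \<comment> \<open>The final error is \<open>L * B * e\<close>; the factor \<open>L + 1\<close>
      instead of \<open>L\<close> also covers \<open>L = 0\<close>.\<close>
    define e where "e = \<delta> / (B * (L + 1))"
    have e: "e > 0" using that B L by (simp add: e_def)
    obtain h where h: "h \<in> Lip_b" "\<And>x. 0 \<le> h x \<and> h x \<le> 1" and he: "(LINT x|\<sigma>. \<bar>indicator A x - h x\<bar>) < e"
      using indicator_approx_Lip_b[OF \<sigma> A e] by blast
    define I where "I = (\<lambda>M. \<integral>\<^sup>+x. ennreal \<bar>indicator A x - h x\<bar> \<partial>M)"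
    have hm: "h \<in> borel_measurable borel" using Lip_borel[OF Lip_bD(1)[OF h(1)]] by simp
    then have m: "(\<lambda>x. ennreal \<bar>indicator A x - h x\<bar>) \<in> borel_measurable borel" using A by measurable
    have fm: "(\<lambda>x. ennreal \<bar>f x\<bar>) \<in> borel_measurable borel" by (rule abs_Lip_b_borel[OF f])
    have "integrable \<sigma> (\<lambda>x. \<bar>indicator A x - h x\<bar>)"
    proof -
      interpret finite_measure \<sigma> using finite_borel_measureD[OF \<sigma>] by simp
      show ?thesis using h A finite_borel_measureD[OF \<sigma>] hm
        by (intro integrable_const_bound[of _ 1]) (auto simp: indicator_def intro!: borel_measurable_sets_borel AE_I2)
    qed
    then have "I \<sigma> = ennreal (LINT x|\<sigma>. \<bar>indicator A x - h x\<bar>)"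
      unfolding I_def by (intro nn_integral_eq_integral) auto
    then have I: "I \<mu> + I \<nu> \<le> ennreal e"
      using he nn_integral_add_measure[OF sets m] unfolding \<sigma>_def I_def by (simp add: ennreal_leI)
    \<comment> \<open>Used twice: for \<open>g = h\<close> with \<open>D = A\<close>, and for
      \<open>g = 1 - h\<close> with \<open>D = - A\<close>. Replacing the weight by the indicator
      costs at most the sup bound \<open>B\<close> times the \<open>L^1\<close> error.\<close>
    have bd: "(\<integral>\<^sup>+x. ennreal \<bar>g x * f x\<bar> \<partial>M) \<le> (\<integral>\<^sup>+x. indicator D x * ennreal \<bar>f x\<bar> \<partial>M) + ennreal B * I M"
      if M: "sets M = sets borel" and D: "D \<in> sets borel"
        and g: "\<And>x. 0 \<le> g x" "\<And>x. g x \<le> indicator D x + \<bar>indicator A x - h x\<bar>" for g M D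
    proof -
      have "(\<integral>\<^sup>+x. ennreal \<bar>g x * f x\<bar> \<partial>M) \<le>
          (\<integral>\<^sup>+x. indicator D x * ennreal \<bar>f x\<bar> + ennreal B * ennreal \<bar>indicator A x - h x\<bar> \<partial>M)"
      proof (rule nn_integral_mono)
        fix x
        have "\<bar>g x * f x\<bar> \<le> (indicator D x + \<bar>indicator A x - h x\<bar>) * \<bar>f x\<bar>"
          using g by (simp add: abs_mult mult_right_mono)
        also have "\<dots> \<le> indicator D x * \<bar>f x\<bar> + B * \<bar>indicator A x - h x\<bar>"
          using B(2)[of x] by (simp add: algebra_simps mult_right_mono)
        finally have "ennreal \<bar>g x * f x\<bar> \<le> ennreal (indicator D x * \<bar>f x\<bar> + B * \<bar>indicator A x - h x\<bar>)"
          by (rule ennreal_leI)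
        also have "\<dots> = indicator D x * ennreal \<bar>f x\<bar> + ennreal B * ennreal \<bar>indicator A x - h x\<bar>"
          using B by (simp add: ennreal_plus ennreal_mult ennreal_indicator)
        finally show "ennreal \<bar>g x * f x\<bar> \<le> indicator D x * ennreal \<bar>f x\<bar> + ennreal B * ennreal \<bar>indicator A x - h x\<bar>" .
      qed
      also have "\<dots> = (\<integral>\<^sup>+x. indicator D x * ennreal \<bar>f x\<bar> \<partial>M) + ennreal B * I M"
        unfolding I_def using m fm M D
        by (subst nn_integral_add) (auto simp: nn_integral_cmult borel_measurable_sets_borel intro!: borel_measurable_times_ennreal)
      finally show ?thesis .
    qed
    define h1 where "h1 = (\<lambda>x. h x * f x)"
    define h2 where "h2 = (\<lambda>x. (1 * 1 + (-1) * h x) * f x)"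
    have h1: "h1 \<in> Lip_b" and h2: "h2 \<in> Lip_b"
      unfolding h1_def h2_def by (intro Lip_b_mult Lip_b_lincomb Lip_b_const h f)+
    have "f = (\<lambda>x. 1 * h1 x + 1 * h2 x)" by (auto simp: h1_def h2_def algebra_simps)
    then have "T f p = T h1 p + T h2 p"
      using bilinear_functionalD(1)[OF T h1 h2 p, of 1 1] by simp
    then have "ennreal \<bar>T f p\<bar> \<le> ennreal \<bar>T h1 p\<bar> + ennreal \<bar>T h2 p\<bar>"
      by (simp add: ennreal_plus[symmetric] ennreal_leI del: ennreal_plus)
    also have "\<dots> \<le> ennreal L * (\<integral>\<^sup>+x. ennreal \<bar>h1 x\<bar> \<partial>\<mu>) + ennreal L * (\<integral>\<^sup>+x. ennreal \<bar>h2 x\<bar> \<partial>\<nu>)"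
      unfolding L_def by (intro add_mono mass_boundD(3)[OF \<mu>] mass_boundD(3)[OF \<nu>] h1 h2 p)
    also have "(\<integral>\<^sup>+x. ennreal \<bar>h1 x\<bar> \<partial>\<mu>) \<le> J + ennreal B * I \<mu>"
      unfolding h1_def J_def
    proof (rule bd[OF sets(1) A])
      show "0 \<le> h x" "h x \<le> indicator A x + \<bar>indicator A x - h x\<bar>" for x
        using h(2)[of x] by linarith+
    qed
    also have "(\<integral>\<^sup>+x. ennreal \<bar>h2 x\<bar> \<partial>\<nu>) \<le> K + ennreal B * I \<nu>"
      unfolding h2_def K_def
    proof (rule bd[OF sets(2) A'])
      show "0 \<le> 1 * 1 + - 1 * h x" "1 * 1 + - 1 * h x \<le> indicator (- A) x + \<bar>indicator A x - h x\<bar>" for x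
        using h(2)[of x] by (auto simp: indicator_def)
    qed
    also have "ennreal L * (J + ennreal B * I \<mu>) + ennreal L * (K + ennreal B * I \<nu>) = ennreal L * (J + K) + ennreal (L * B) * (I \<mu> + I \<nu>)"
      using L B by (simp add: algebra_simps ennreal_mult)
    also have "\<dots> \<le> ennreal L * (J + K) + ennreal (L * B) * ennreal e"
      by (intro add_left_mono mult_left_mono I) auto
    also have "ennreal (L * B) * ennreal e = ennreal (L * B * e)"
      using L B e by (simp add: ennreal_mult)
    also have "\<dots> \<le> ennreal \<delta>"
    proof (rule ennreal_leI)
      have "L * B * e = \<delta> * (L / (L + 1))" using B by (simp add: e_def)
      also have "\<dots> \<le> \<delta> * 1" using L that by (intro mult_left_mono) auto
      finally show "L * B * e \<le> \<delta>" by simp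
    qed
    finally show ?thesis by (simp add: add_left_mono mult_left_mono add_right_mono)
  qed
  then have "ennreal \<bar>T f p\<bar> \<le> ennreal L * (J + K)" by (rule ennreal_le_epsilon)
  also have "J + K = (\<integral>\<^sup>+x. ennreal \<bar>f x\<bar> \<partial>add_measure (borel_restrict \<mu> A) (borel_restrict \<nu> (- A)))"
    unfolding J_def K_def using sets A A' abs_Lip_b_borel[OF f]
    by (simp add: nn_integral_add_measure nn_integral_borel_restrict)
  finally show "ennreal \<bar>T f p\<bar> \<le> ennreal (lip_const p) *
      (\<integral>\<^sup>+x. ennreal \<bar>f x\<bar> \<partial>add_measure (borel_restrict \<mu> A) (borel_restrict \<nu> (- A)))"
    unfolding L_def .
qed

definition min_measure :: "'a::metric_space functional \<Rightarrow> 'a measure" where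
  "min_measure T = measure_of UNIV (sets borel) (\<lambda>A. INF \<mu>\<in>{\<mu>. mass_bound T \<mu>}. emeasure \<mu> A)"

text \<open>Nearly least total mass already forces nearly least mass on every Borel set: if some
  \<open>\<mu>\<close> were smaller than \<open>\<nu>\<close> on \<open>A\<close> by more than
  \<open>e\<close>, splicing \<open>\<mu>\<close> on \<open>A\<close> with \<open>\<nu>\<close> off
  \<open>A\<close> would push the total mass below the infimum.\<close>

lemma near_minimal_mass_bound:
  assumes T: "bilinear_functional T" and \<mu>0: "mass_bound T \<mu>0" and "0 < (e::real)"
  shows "\<exists>\<nu>. mass_bound T \<nu> \<and> (\<forall>A\<in>sets borel. \<forall>\<mu>. mass_bound T \<mu> \<longrightarrow> emeasure \<nu> A \<le> emeasure \<mu> A + ennreal e)"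
proof -
  let ?I = "INF \<mu>\<in>{\<mu>. mass_bound T \<mu>}. emeasure \<mu> UNIV"
  have "?I \<le> emeasure \<mu>0 UNIV" using \<mu>0 by (intro INF_lower) simp
  also have "\<dots> < \<infinity>" using \<mu>0 by (simp add: finite_borel_measure_less_top mass_boundD(1) flip: infinity_ennreal_def)
  finally have "?I < ?I + ennreal e" using \<open>0 < e\<close>
    by (metis add.right_neutral ennreal_add_left_cancel_less ennreal_less_zero_iff infinity_ennreal_def top.not_eq_extremum)
  then obtain \<nu> where \<nu>: "mass_bound T \<nu>" "emeasure \<nu> UNIV < ?I + ennreal e"
    by (auto simp: INF_less_iff)
  have "emeasure \<nu> A \<le> emeasure \<mu> A + ennreal e" if A: "A \<in> sets borel" and \<mu>: "mass_bound T \<mu>" for A \<mu>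
  proof -
    note sets = mass_boundD(2)[OF \<mu>] mass_boundD(2)[OF \<nu>(1)]
    have A': "- A \<in> sets borel" using A by simp
    have "emeasure \<nu> (- A) + emeasure \<nu> A = emeasure \<nu> UNIV"
      using A A' sets by (subst plus_emeasure) auto
    also have "\<dots> \<le> ?I + ennreal e" using \<nu>(2) by simp
    also have "?I \<le> emeasure (add_measure (borel_restrict \<mu> A) (borel_restrict \<nu> (- A))) UNIV"
      using mass_bound_splice[OF T \<mu> \<nu>(1) A] by (intro INF_lower) simp
    also have "\<dots> = emeasure \<mu> A + emeasure \<nu> (- A)"
      using sets A A' by (simp add: emeasure_add_measure emeasure_borel_restrict)
    finally have "emeasure \<nu> (- A) + emeasure \<nu> A \<le> emeasure \<nu> (- A) + (emeasure \<mu> A + ennreal e)"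
      by (simp add: ac_simps)
    moreover have "emeasure \<nu> (- A) \<noteq> \<infinity>"
      using finite_borel_measure_less_top[OF mass_boundD(1)[OF \<nu>(1)], of "- A"] by simp
    ultimately show ?thesis by (simp add: ennreal_add_left_cancel_le)
  qed
  then show ?thesis using \<nu>(1) by blast
qed

text \<open>Only subadditivity of the infimum is in doubt, and a single nearly minimal mass bound is
  nearly optimal on both pieces at once. Countable additivity is continuity at the empty set,
  inherited from the finite measure \<open>\<mu>0\<close> that dominates the infimum.\<close>

lemma
  fixes T :: "'a::metric_space functional"
  assumes T: "bilinear_functional T" and \<mu>0: "mass_bound T \<mu>0"
  shows sets_min_measure: "sets (min_measure T) = sets borel"
    and emeasure_min_measure: "A \<in> sets borel \<Longrightarrow>
      emeasure (min_measure T) A = (INF \<mu>\<in>{\<mu>. mass_bound T \<mu>}. emeasure \<mu> A)"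
proof -
  let ?\<rho> = "\<lambda>A. INF \<mu>\<in>{\<mu>. mass_bound T \<mu>}. emeasure \<mu> A"
  interpret borel: sigma_algebra UNIV "sets borel :: 'a set set"
    using sets.sigma_algebra_axioms[of "borel :: 'a measure"] by simp
  show sets: "sets (min_measure T) = sets borel"
    unfolding min_measure_def by (rule borel.sets_measure_of_eq)
  have le: "?\<rho> A \<le> emeasure \<mu> A" if "mass_bound T \<mu>" for A \<mu>
    using that by (intro INF_lower) simp
  have fin: "?\<rho> A \<noteq> \<infinity>" for A
    using le_less_trans[OF le[OF \<mu>0] finite_borel_measure_less_top[OF mass_boundD(1)[OF \<mu>0]]] by (rule less_imp_neq)
  have pos: "positive (sets borel) ?\<rho>"
    unfolding positive_def using le[OF \<mu>0, of "{}"] by simp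
  have add: "additive (sets borel) ?\<rho>"
    unfolding additive_def
  proof (intro ballI impI)
    fix A B :: "'a set" assume A: "A \<in> sets borel" and B: "B \<in> sets borel" and AB: "A \<inter> B = {}"
    have Un: "emeasure \<mu> (A \<union> B) = emeasure \<mu> A + emeasure \<mu> B" if "mass_bound T \<mu>" for \<mu>
      using plus_emeasure[of A \<mu> B] A B AB mass_boundD(2)[OF that] by simp
    show "?\<rho> (A \<union> B) = ?\<rho> A + ?\<rho> B"
    proof (rule antisym)
      show "?\<rho> A + ?\<rho> B \<le> ?\<rho> (A \<union> B)"
        by (rule INF_greatest) (simp add: Un add_mono le)
      show "?\<rho> (A \<union> B) \<le> ?\<rho> A + ?\<rho> B"
      proof (rule ennreal_le_epsilon)
        fix e :: real assume "e > 0"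
        then obtain \<nu> where \<nu>: "mass_bound T \<nu>"
          "\<And>A \<mu>. A \<in> sets borel \<Longrightarrow> mass_bound T \<mu> \<Longrightarrow> emeasure \<nu> A \<le> emeasure \<mu> A + ennreal (e/2)"
          using near_minimal_mass_bound[OF T \<mu>0, of "e/2"] by auto
        have *: "emeasure \<nu> A \<le> ennreal (e/2) + ?\<rho> A" if "A \<in> sets borel" for A
        proof -
          have "emeasure \<nu> A - ennreal (e/2) \<le> ?\<rho> A"
            using \<nu>(2)[OF that] by (intro INF_greatest) (auto simp: ennreal_minus_le_iff add.commute)
          then show ?thesis by (simp add: ennreal_minus_le_iff)
        qed
        have "?\<rho> (A \<union> B) \<le> emeasure \<nu> A + emeasure \<nu> B"
          using le[OF \<nu>(1)] Un[OF \<nu>(1)] by metis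
        also have "\<dots> \<le> (ennreal (e/2) + ?\<rho> A) + (ennreal (e/2) + ?\<rho> B)"
          by (intro add_mono * A B)
        also have "\<dots> = ?\<rho> A + ?\<rho> B + (ennreal (e/2) + ennreal (e/2))" by (simp add: ac_simps)
        also have "ennreal (e/2) + ennreal (e/2) = ennreal e"
          using \<open>e > 0\<close> by (subst ennreal_plus[symmetric]) auto
        finally show "?\<rho> (A \<union> B) \<le> ?\<rho> A + ?\<rho> B + ennreal e" .
      qed
    qed
  qed
  have "countably_additive (sets borel) ?\<rho>"
  proof (rule borel.empty_continuous_imp_countably_additive[OF pos add])
    show "\<forall>A\<in>sets borel. ?\<rho> A \<noteq> \<infinity>" using fin by blast
    fix A :: "nat \<Rightarrow> 'a set" assume A: "range A \<subseteq> sets borel" "decseq A" "\<Inter> (range A) = {}"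
    have "(\<lambda>i. emeasure \<mu>0 (A i)) \<longlonglongrightarrow> emeasure \<mu>0 (\<Inter> (range A))"
      using A finite_borel_measure_less_top[OF mass_boundD(1)[OF \<mu>0]] mass_boundD(2)[OF \<mu>0]
      by (intro Lim_emeasure_decseq) (auto simp: less_top)
    then have lim: "(\<lambda>i. emeasure \<mu>0 (A i)) \<longlonglongrightarrow> 0" unfolding A(3) by simp
    show "(\<lambda>i. ?\<rho> (A i)) \<longlonglongrightarrow> 0"
      by (rule tendsto_sandwich[OF _ _ tendsto_const lim])
        (simp, rule always_eventually, rule allI, rule le[OF \<mu>0])
  qed
  then show "A \<in> sets borel \<Longrightarrow> emeasure (min_measure T) A = ?\<rho> A"
    using pos sets
    by (intro emeasure_measure_of[OF min_measure_def]) auto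
qed

text \<open>The integral of \<open>\<bar>f\<bar>\<close> must be compared in the direction opposite
  to setwise minimality. The comparison is therefore applied to the nonnegative function
  \<open>B - \<bar>f\<bar>\<close>, and the total masses, which differ by at most \<open>e\<close>,
  turn it around.\<close>

lemma mass_bound_min_measure:
  fixes T :: "'a::metric_space functional"
  assumes T: "bilinear_functional T" and \<mu>0: "mass_bound T \<mu>0"
  shows "mass_bound T (min_measure T)"
  unfolding mass_bound_iff
proof (intro conjI ballI)
  let ?\<rho> = "min_measure T"
  note sets = sets_min_measure[OF assms] and em = emeasure_min_measure[OF assms]
  have le: "emeasure ?\<rho> A \<le> emeasure \<mu> A" if "mass_bound T \<mu>" "A \<in> sets borel" for A \<mu>
    unfolding em[OF that(2)] using that(1) by (intro INF_lower) simp
  have "emeasure ?\<rho> UNIV < \<infinity>"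
    using le[OF \<mu>0, of UNIV] finite_borel_measure_less_top[OF mass_boundD(1)[OF \<mu>0], of UNIV] by simp
  with sets show fin: "finite_borel_measure ?\<rho>" by (rule finite_borel_measureI)
  fix f p :: "'a \<Rightarrow> real" assume f: "f \<in> Lip_b" and p: "p \<in> Lip"
  obtain B where B: "B > 0" "\<And>x. \<bar>f x\<bar> \<le> B" using Lip_bD(2)[OF f] by blast
  define L where "L = lip_const p"
  have L: "L \<ge> 0" using p by (simp add: L_def lip_const_nonneg)
  have fm: "(\<lambda>x. ennreal \<bar>f x\<bar>) \<in> borel_measurable borel" by (rule abs_Lip_b_borel[OF f])
  have gm: "(\<lambda>x. ennreal (B - \<bar>f x\<bar>)) \<in> borel_measurable borel"
    using Lip_borel[OF Lip_bD(1)[OF f] refl] by measurable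
  have split: "(\<integral>\<^sup>+x. ennreal \<bar>f x\<bar> \<partial>M) + (\<integral>\<^sup>+x. ennreal (B - \<bar>f x\<bar>) \<partial>M) = ennreal B * emeasure M UNIV"
    if "finite_borel_measure M" for M
  proof -
    note M = finite_borel_measureD[OF that]
    have "(\<integral>\<^sup>+x. ennreal \<bar>f x\<bar> \<partial>M) + (\<integral>\<^sup>+x. ennreal (B - \<bar>f x\<bar>) \<partial>M) = (\<integral>\<^sup>+x. ennreal \<bar>f x\<bar> + ennreal (B - \<bar>f x\<bar>) \<partial>M)"
      using M fm gm by (intro nn_integral_add[symmetric]) (auto intro: borel_measurable_sets_borel)
    also have "\<dots> = (\<integral>\<^sup>+x. ennreal B \<partial>M)"
      using B(2) by (intro nn_integral_cong) (simp add: ennreal_plus[symmetric] del: ennreal_plus)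
    finally show ?thesis using M by simp
  qed
  have "ennreal \<bar>T f p\<bar> \<le> ennreal L * (\<integral>\<^sup>+x. ennreal \<bar>f x\<bar> \<partial>?\<rho>) + ennreal \<delta>" if \<delta>: "\<delta> > 0" for \<delta>
  proof -
    define e where "e = \<delta> / (B * (L + 1))"
    have e: "e > 0" using \<delta> B L by (simp add: e_def)
    obtain \<nu> where \<nu>: "mass_bound T \<nu>"
      "\<And>A \<mu>. A \<in> sets borel \<Longrightarrow> mass_bound T \<mu> \<Longrightarrow> emeasure \<nu> A \<le> emeasure \<mu> A + ennreal e"
      using near_minimal_mass_bound[OF T \<mu>0 e] by auto
    note f\<nu> = mass_boundD(1)[OF \<nu>(1)] and s\<nu> = mass_boundD(2)[OF \<nu>(1)]
    have "emeasure \<nu> UNIV - ennreal e \<le> emeasure ?\<rho> UNIV"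
      unfolding em[of UNIV, simplified] using \<nu>(2)[of UNIV]
      by (intro INF_greatest) (simp add: ennreal_minus_le_iff add.commute)
    then have tot: "emeasure \<nu> UNIV \<le> ennreal e + emeasure ?\<rho> UNIV"
      by (simp add: ennreal_minus_le_iff)
    let ?g = "\<lambda>M. \<integral>\<^sup>+x. ennreal (B - \<bar>f x\<bar>) \<partial>M"
    have "?g \<nu> + (\<integral>\<^sup>+x. ennreal \<bar>f x\<bar> \<partial>\<nu>) = ennreal B * emeasure \<nu> UNIV"
      using split[OF f\<nu>] by (simp add: add.commute)
    also have "\<dots> \<le> ennreal B * (ennreal e + emeasure ?\<rho> UNIV)"
      by (intro mult_left_mono tot) simp
    also have "\<dots> = ennreal B * ennreal e + ((\<integral>\<^sup>+x. ennreal \<bar>f x\<bar> \<partial>?\<rho>) + ?g ?\<rho>)"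
      by (simp add: distrib_left split[OF fin])
    also have "?g ?\<rho> \<le> ?g \<nu>"
      using le[OF \<nu>(1)] sets s\<nu> by (intro nn_integral_mono_measure) (simp_all add: le_measure)
    finally have "?g \<nu> + (\<integral>\<^sup>+x. ennreal \<bar>f x\<bar> \<partial>\<nu>) \<le> ?g \<nu> + ((\<integral>\<^sup>+x. ennreal \<bar>f x\<bar> \<partial>?\<rho>) + ennreal B * ennreal e)"
      by (simp add: ac_simps add_left_mono)
    moreover have "?g \<nu> \<noteq> \<infinity>"
    proof -
      have "?g \<nu> \<le> ennreal B * emeasure \<nu> UNIV" unfolding split[OF f\<nu>, symmetric] by simp
      also have "\<dots> < \<infinity>" using finite_borel_measure_less_top[OF f\<nu>, of UNIV] by (simp add: ennreal_mult_less_top)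
      finally show ?thesis by simp
    qed
    ultimately have fl: "(\<integral>\<^sup>+x. ennreal \<bar>f x\<bar> \<partial>\<nu>) \<le> (\<integral>\<^sup>+x. ennreal \<bar>f x\<bar> \<partial>?\<rho>) + ennreal B * ennreal e"
      by (simp add: ennreal_add_left_cancel_le)
    have "ennreal \<bar>T f p\<bar> \<le> ennreal L * (\<integral>\<^sup>+x. ennreal \<bar>f x\<bar> \<partial>\<nu>)"
      unfolding L_def by (rule mass_boundD(3)[OF \<nu>(1) f p])
    also have "\<dots> \<le> ennreal L * ((\<integral>\<^sup>+x. ennreal \<bar>f x\<bar> \<partial>?\<rho>) + ennreal B * ennreal e)"
      by (intro mult_left_mono fl) simp
    also have "\<dots> = ennreal L * (\<integral>\<^sup>+x. ennreal \<bar>f x\<bar> \<partial>?\<rho>) + ennreal (L * B * e)"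
      using L B e by (simp add: distrib_left ennreal_mult mult.assoc)
    also have "ennreal (L * B * e) \<le> ennreal \<delta>"
    proof (rule ennreal_leI)
      have "L * B * e = \<delta> * (L / (L + 1))" using B by (simp add: e_def)
      also have "\<dots> \<le> \<delta> * 1" using L \<delta> by (intro mult_left_mono) auto
      finally show "L * B * e \<le> \<delta>" by simp
    qed
    finally show ?thesis by (simp add: add_left_mono)
  qed
  then show "ennreal \<bar>T f p\<bar> \<le> ennreal (lip_const p) * (\<integral>\<^sup>+x. ennreal \<bar>f x\<bar> \<partial>?\<rho>)"
    unfolding L_def by (rule ennreal_le_epsilon)
qed

text \<open>Two setwise least mass bounds agree on all Borel sets, so the definite description
  denotes the infimum constructed above.\<close>

lemma mass_measure_eq:
  fixes T :: "'a::metric_space functional"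
  assumes T: "bilinear_functional T" and \<mu>0: "mass_bound T \<mu>0"
  shows "mass_measure T = min_measure T"
  unfolding mass_measure_def
proof (rule the_equality)
  show min: "mass_bound T (min_measure T) \<and>
    (\<forall>\<nu>. mass_bound T \<nu> \<longrightarrow> (\<forall>A\<in>sets borel. emeasure (min_measure T) A \<le> emeasure \<nu> A))"
    using mass_bound_min_measure[OF assms] by (auto simp: emeasure_min_measure[OF assms] intro: INF_lower)
  fix \<mu> assume \<mu>: "mass_bound T \<mu> \<and> (\<forall>\<nu>. mass_bound T \<nu> \<longrightarrow> (\<forall>A\<in>sets borel. emeasure \<mu> A \<le> emeasure \<nu> A))"
  show "\<mu> = min_measure T"
    using \<mu> min mass_boundD(2)[of T] by (intro measure_eqI) (auto intro: antisym)
qed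

lemma
  fixes T :: "'a::metric_space functional"
  assumes T: "bilinear_functional T" and \<mu>: "mass_bound T \<mu>"
  shows mass_bound_mass_measure: "mass_bound T (mass_measure T)"
    and emeasure_mass_measure_le: "A \<in> sets borel \<Longrightarrow> emeasure (mass_measure T) A \<le> emeasure \<mu> A"
    and mass_le: "emeasure \<mu> UNIV \<le> ennreal m \<Longrightarrow> 0 \<le> m \<Longrightarrow> mass T \<le> m"
    and emeasure_mass_measure_UNIV: "emeasure (mass_measure T) UNIV = ennreal (mass T)"
proof -
  show 1: "mass_bound T (mass_measure T)"
    using mass_bound_min_measure[OF assms] mass_measure_eq[OF assms] by simp
  show 2: "A \<in> sets borel \<Longrightarrow> emeasure (mass_measure T) A \<le> emeasure \<mu> A" for A
    using \<mu> by (auto simp: mass_measure_eq[OF assms] emeasure_min_measure[OF assms] intro!: INF_lower)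
  interpret finite_measure "mass_measure T"
    using finite_borel_measureD(3)[OF mass_boundD(1)[OF 1]] .
  show 3: "emeasure (mass_measure T) UNIV = ennreal (mass T)"
    unfolding mass_def by (rule emeasure_eq_measure)
  show "mass T \<le> m" if "emeasure \<mu> UNIV \<le> ennreal m" "0 \<le> m"
    using order_trans[OF 2[of UNIV] that(1)] that(2) by (simp add: 3)
qed

lemma mass_nonneg: "0 \<le> mass T"
  by (simp add: mass_def)

section \<open>Countable sums of currents\<close>

lemma metric_1_currentsI:
  assumes "bilinear_functional T" "mass_bound T \<mu>"
    "\<And>f p q. f \<in> Lip_b \<Longrightarrow> p \<in> Lip \<Longrightarrow> (\<And>j. q j \<in> Lip) \<Longrightarrow> (\<And>x. (\<lambda>j. q j x) \<longlonglongrightarrow> p x) \<Longrightarrow>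
        bdd_above (range (\<lambda>j::nat. lip_const (q j))) \<Longrightarrow> (\<lambda>j. T f (q j)) \<longlonglongrightarrow> T f p"
    "\<And>f p U. f \<in> Lip_b \<Longrightarrow> p \<in> Lip \<Longrightarrow> open U \<Longrightarrow> closure {x. f x \<noteq> 0} \<subseteq> U \<Longrightarrow> p constant_on U \<Longrightarrow> T f p = 0"
  shows "T \<in> metric_1_currents"
  unfolding metric_1_currents_def
proof (intro CollectI conjI ballI allI impI)
  show "bilinear_functional T" "\<exists>\<mu>. mass_bound T \<mu>" using assms(1,2) by blast+
  show "(\<lambda>j. T f (q j)) \<longlonglongrightarrow> T f p" if "f \<in> Lip_b" "p \<in> Lip" "\<forall>j. q j \<in> Lip"
    "\<forall>x. (\<lambda>j. q j x) \<longlonglongrightarrow> p x" "bdd_above (range (\<lambda>j::nat. lip_const (q j)))" for f p q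
    using that by (intro assms(3)) auto
  show "T f p = 0" if "f \<in> Lip_b" "p \<in> Lip"
    "\<exists>U. open U \<and> closure {x. f x \<noteq> 0} \<subseteq> U \<and> p constant_on U" for f p
    using that assms(4)[of f p] by auto
qed

lemma metric_1_currentsD:
  assumes "T \<in> metric_1_currents"
  shows "bilinear_functional T" "\<exists>\<mu>. mass_bound T \<mu>"
    "f \<in> Lip_b \<Longrightarrow> p \<in> Lip \<Longrightarrow> (\<And>j. q j \<in> Lip) \<Longrightarrow> (\<And>x. (\<lambda>j. q j x) \<longlonglongrightarrow> p x) \<Longrightarrow>
        bdd_above (range (\<lambda>j::nat. lip_const (q j))) \<Longrightarrow> (\<lambda>j. T f (q j)) \<longlonglongrightarrow> T f p"
    "f \<in> Lip_b \<Longrightarrow> p \<in> Lip \<Longrightarrow> open U \<Longrightarrow> closure {x. f x \<noteq> 0} \<subseteq> U \<Longrightarrow> p constant_on U \<Longrightarrow> T f p = 0"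
proof -
  note T = assms[unfolded metric_1_currents_def, THEN CollectD]
  show "bilinear_functional T" "\<exists>\<mu>. mass_bound T \<mu>" using T by simp_all
  show "f \<in> Lip_b \<Longrightarrow> p \<in> Lip \<Longrightarrow> (\<And>j. q j \<in> Lip) \<Longrightarrow> (\<And>x. (\<lambda>j. q j x) \<longlonglongrightarrow> p x) \<Longrightarrow>
        bdd_above (range (\<lambda>j::nat. lip_const (q j))) \<Longrightarrow> (\<lambda>j. T f (q j)) \<longlonglongrightarrow> T f p"
    using T[THEN conjunct2, THEN conjunct2, THEN conjunct1] by simp
  show "f \<in> Lip_b \<Longrightarrow> p \<in> Lip \<Longrightarrow> open U \<Longrightarrow> closure {x. f x \<noteq> 0} \<subseteq> U \<Longrightarrow> p constant_on U \<Longrightarrow> T f p = 0"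
    using T[THEN conjunct2, THEN conjunct2, THEN conjunct2] by metis
qed

lemma current_mass_measure:
  assumes "T \<in> metric_1_currents"
  shows "mass_bound T (mass_measure T)" "emeasure (mass_measure T) UNIV = ennreal (mass T)"
  using mass_bound_mass_measure emeasure_mass_measure_UNIV metric_1_currentsD(1,2)[OF assms] by blast+

lemma mass_bound_abs_le:
  assumes \<mu>: "mass_bound T \<mu>" and f: "f \<in> Lip_b" and p: "p \<in> Lip" and B: "\<And>x. \<bar>f x\<bar> \<le> B"
  shows "\<bar>T f p\<bar> \<le> lip_const p * (B * measure \<mu> UNIV)"
proof -
  note fin = mass_boundD(1)[OF \<mu>]
  interpret finite_measure \<mu> using finite_borel_measureD(3)[OF fin] .
  have "\<bar>T f p\<bar> \<le> lip_const p * (LINT x|\<mu>. \<bar>f x\<bar>)"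
    using \<mu> f p unfolding mass_bound_def by blast
  also have "(LINT x|\<mu>. \<bar>f x\<bar>) \<le> (LINT x|\<mu>. B)"
    using Lip_b_integrable[OF f fin] B by (intro integral_mono) auto
  finally show ?thesis
    using finite_borel_measureD(2)[OF fin] lip_const_nonneg[OF p]
    by (auto simp: mult.commute[of B] intro: mult_left_mono)
qed

lemma boundary_abs_le:
  assumes "T \<in> metric_1_currents" "f \<in> Lip"
  shows "\<bar>boundary T f\<bar> \<le> lip_const f * mass T"
  using mass_bound_abs_le[OF current_mass_measure(1)[OF assms(1)] Lip_b_const assms(2), of 1 1]
  by (simp add: boundary_def mass_def)

text \<open>The total masses give one summable majorant for all \<open>p\<close> with a common
  Lipschitz bound. This yields convergence of the series and, through Tannery's theorem, the
  exchange of the sum with the limit in the continuity axiom; the other axioms hold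
  termwise.\<close>

lemma current_suminf:
  fixes R :: "nat \<Rightarrow> 'a::metric_space functional"
  assumes R: "\<And>k. R k \<in> metric_1_currents" and \<mu>: "\<And>k. mass_bound (R k) (\<mu> k)"
    and fin: "(\<Sum>k. emeasure (\<mu> k) UNIV) < \<infinity>"
  shows "f \<in> Lip_b \<Longrightarrow> p \<in> Lip \<Longrightarrow> summable (\<lambda>k. R k f p)"
    and "(\<lambda>f p. \<Sum>k. R k f p) \<in> metric_1_currents"
    and "mass_bound (\<lambda>f p. \<Sum>k. R k f p) (sum_measure \<mu>)"
proof -
  let ?R = "\<lambda>f p. \<Sum>k. R k f p"
  define m where "m = (\<lambda>k. measure (\<mu> k) UNIV)"
  have fm: "finite_borel_measure (\<mu> k)" for k using mass_boundD(1)[OF \<mu>] .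
  note sets = mass_boundD(2)[OF \<mu>]
  have em: "emeasure (\<mu> k) UNIV = ennreal (m k)" for k
    unfolding m_def using finite_borel_measureD(3)[OF fm] by (rule finite_measure.emeasure_eq_measure)
  have m0: "0 \<le> m k" for k by (simp add: m_def)
  have m: "summable m"
    using fin m0 unfolding em by (intro summable_suminf_not_top) auto
  have bd: "\<bar>R k f p\<bar> \<le> L * (B * m k)" if "f \<in> Lip_b" "p \<in> Lip" "\<And>x. \<bar>f x\<bar> \<le> B" "lip_const p \<le> L" for k f p B L
  proof -
    \<comment> \<open>Types are nonempty, so the bound at an arbitrary point makes \<open>B\<close>
      nonnegative.\<close>
    have "0 \<le> B" using that(3)[of undefined] by linarith
    have "\<bar>R k f p\<bar> \<le> lip_const p * (B * m k)"
      unfolding m_def by (rule mass_bound_abs_le[OF \<mu> that(1-3)])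
    also have "\<dots> \<le> L * (B * m k)" using that(4) m0 \<open>0 \<le> B\<close> by (intro mult_right_mono) auto
    finally show ?thesis .
  qed
  have sum: "summable (\<lambda>k. R k f p)" "summable (\<lambda>k. \<bar>R k f p\<bar>)" if fp: "f \<in> Lip_b" "p \<in> Lip" for f p
  proof -
    obtain B where B: "\<And>x. \<bar>f x\<bar> \<le> B" using Lip_bD(2)[OF fp(1)] by blast
    show *: "summable (\<lambda>k. \<bar>R k f p\<bar>)"
    proof (rule summable_comparison_test'[where N = 0])
      show "summable (\<lambda>k. lip_const p * (B * m k))" by (intro summable_mult m)
      show "norm \<bar>R k f p\<bar> \<le> lip_const p * (B * m k)" for k
        using bd[OF fp B order_refl, of k] by simp
    qed
    show "summable (\<lambda>k. R k f p)" by (rule summable_rabs_cancel[OF *])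
  qed
  then show "f \<in> Lip_b \<Longrightarrow> p \<in> Lip \<Longrightarrow> summable (\<lambda>k. R k f p)" by blast
  show mb: "mass_bound ?R (sum_measure \<mu>)"
    unfolding mass_bound_iff
  proof (intro conjI ballI)
    show "finite_borel_measure (sum_measure \<mu>)"
      using fin sets by (intro finite_borel_measureI) (auto simp: emeasure_sum_measure)
    fix f p :: "'a \<Rightarrow> real" assume f: "f \<in> Lip_b" and p: "p \<in> Lip"
    have "ennreal \<bar>?R f p\<bar> \<le> ennreal (\<Sum>k. \<bar>R k f p\<bar>)"
      by (intro ennreal_leI summable_rabs sum f p)
    also have "\<dots> = (\<Sum>k. ennreal \<bar>R k f p\<bar>)"
      by (intro suminf_ennreal2[symmetric] sum f p) simp
    also have "\<dots> \<le> (\<Sum>k. ennreal (lip_const p) * (\<integral>\<^sup>+x. ennreal \<bar>f x\<bar> \<partial>\<mu> k))"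
      by (intro suminf_le mass_boundD(3)[OF \<mu> f p]) auto
    also have "\<dots> = ennreal (lip_const p) * (\<integral>\<^sup>+x. ennreal \<bar>f x\<bar> \<partial>sum_measure \<mu>)"
      by (subst nn_integral_sum_measure[OF sets abs_Lip_b_borel[OF f]]) (simp add: ennreal_suminf_cmult)
    finally show "ennreal \<bar>?R f p\<bar> \<le> ennreal (lip_const p) * (\<integral>\<^sup>+x. ennreal \<bar>f x\<bar> \<partial>sum_measure \<mu>)" .
  qed
  show "?R \<in> metric_1_currents"
  proof (rule metric_1_currentsI[OF _ mb])
    have lin: "(\<Sum>k. a * u k + b * v k) = a * suminf u + b * suminf v" if "summable u" "summable v"
      for a b and u v :: "nat \<Rightarrow> real"
      using that by (simp add: suminf_add[symmetric] suminf_mult summable_mult)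
    show "bilinear_functional ?R"
      unfolding bilinear_functional_def
      using bilinear_functionalD[OF metric_1_currentsD(1)[OF R]] sum(1)
      by (auto simp: lin)
  next
    fix f p :: "'a \<Rightarrow> real" and q :: "nat \<Rightarrow> 'a \<Rightarrow> real"
    assume f: "f \<in> Lip_b" and p: "p \<in> Lip" and q: "\<And>j. q j \<in> Lip" "\<And>x. (\<lambda>j. q j x) \<longlonglongrightarrow> p x"
      "bdd_above (range (\<lambda>j. lip_const (q j)))"
    obtain B where B: "\<And>x. \<bar>f x\<bar> \<le> B" using Lip_bD(2)[OF f] by blast
    obtain L where L: "\<And>j. lip_const (q j) \<le> L" using q(3) by (auto simp: bdd_above_def)
    show "(\<lambda>j. ?R f (q j)) \<longlonglongrightarrow> ?R f p"
    proof (rule tannerys_theorem[THEN conjunct2, THEN conjunct2])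
      show "(\<lambda>j. R k f (q j)) \<longlonglongrightarrow> R k f p" for k
        by (rule metric_1_currentsD(3)[OF R f p q])
      show "\<forall>\<^sub>F (k, j) in sequentially \<times>\<^sub>F sequentially. norm (R k f (q j)) \<le> L * (B * m k)"
        using bd[OF f q(1) B L] by (intro always_eventually) auto
      show "summable (\<lambda>k. L * (B * m k))" by (intro summable_mult m)
    qed simp
  next
    fix f p :: "'a \<Rightarrow> real" and U :: "'a set"
    assume "f \<in> Lip_b" "p \<in> Lip" "open U" "closure {x. f x \<noteq> 0} \<subseteq> U" "p constant_on U"
    then have "R k f p = 0" for k by (rule metric_1_currentsD(4)[OF R])
    then show "?R f p = 0" by simp
  qed
qed

section \<open>Linear combinations of currents\<close>

lemma mass_bound_zero: "mass_bound (\<lambda>_ _. 0) (null_measure borel)"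
  unfolding mass_bound_iff by (auto intro!: finite_borel_measureI)

lemma current_zero: "(\<lambda>_ _. 0) \<in> metric_1_currents"
  by (rule metric_1_currentsI[OF _ mass_bound_zero]) (auto simp: bilinear_functional_def)

lemma
  assumes S: "S \<in> metric_1_currents" and T: "T \<in> metric_1_currents"
  shows current_add: "(\<lambda>f p. S f p + T f p) \<in> metric_1_currents"
    and mass_bound_add: "mass_bound (\<lambda>f p. S f p + T f p) (add_measure (mass_measure S) (mass_measure T))"
proof -
  define R where "R = case_nat S (case_nat T (\<lambda>_ _ _. 0))"
  define \<mu> where "\<mu> = case_nat (mass_measure S) (case_nat (mass_measure T) (\<lambda>_. null_measure borel))"
  have eq: "(\<lambda>f p. \<Sum>k. R k f p) = (\<lambda>f p. S f p + T f p)"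
  proof (intro ext)
    fix f p
    have "(\<Sum>k. R k f p) = (\<Sum>k\<in>{0,1}. R k f p)"
      by (rule suminf_finite) (auto simp: R_def split: nat.split)
    then show "(\<Sum>k. R k f p) = S f p + T f p" by (simp add: R_def)
  qed
  have R: "R k \<in> metric_1_currents" "mass_bound (R k) (\<mu> k)" for k
    using S T current_zero mass_bound_zero by (auto simp: R_def \<mu>_def current_mass_measure split: nat.split)
  have "(\<Sum>k. emeasure (\<mu> k) UNIV) = ennreal (mass S) + ennreal (mass T)"
    unfolding \<mu>_def using suminf_case_nat2[of "\<lambda>M. emeasure M UNIV" "null_measure borel" "mass_measure S" "mass_measure T"]
    by (simp add: current_mass_measure S T)
  then have fin: "(\<Sum>k. emeasure (\<mu> k) UNIV) < \<infinity>" by simp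
  show "(\<lambda>f p. S f p + T f p) \<in> metric_1_currents"
    using current_suminf(2)[of R \<mu>, OF R fin] unfolding eq .
  show "mass_bound (\<lambda>f p. S f p + T f p) (add_measure (mass_measure S) (mass_measure T))"
    using current_suminf(3)[of R \<mu>, OF R fin] unfolding eq \<mu>_def add_measure_def .
qed

lemma mass_add_le:
  assumes S: "S \<in> metric_1_currents" and T: "T \<in> metric_1_currents"
  shows "mass (\<lambda>f p. S f p + T f p) \<le> mass S + mass T"
  using S T current_add[OF S T, THEN metric_1_currentsD(1)] mass_bound_add[OF S T] mass_nonneg[of S] mass_nonneg[of T]
  by (intro mass_le) (auto simp: emeasure_add_measure current_mass_measure mass_boundD(2)[OF current_mass_measure(1)])

lemma
  fixes T :: "'a::metric_space functional"
  assumes T: "T \<in> metric_1_currents"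
  shows current_scale: "(\<lambda>f p. a * T f p) \<in> metric_1_currents"
    and mass_bound_scale: "mass_bound (\<lambda>f p. a * T f p) (scale_measure (ennreal \<bar>a\<bar>) (mass_measure T))"
    and mass_scale_le: "mass (\<lambda>f p. a * T f p) \<le> \<bar>a\<bar> * mass T"
proof -
  note mT = mass_boundD[OF current_mass_measure(1)[OF T]]
  have em: "emeasure (scale_measure (ennreal \<bar>a\<bar>) (mass_measure T)) UNIV = ennreal (\<bar>a\<bar> * mass T)"
    by (simp add: current_mass_measure(2)[OF T] ennreal_mult mass_nonneg)
  show mb: "mass_bound (\<lambda>f p. a * T f p) (scale_measure (ennreal \<bar>a\<bar>) (mass_measure T))"
    unfolding mass_bound_iff
  proof (intro conjI ballI)
    show "finite_borel_measure (scale_measure (ennreal \<bar>a\<bar>) (mass_measure T))"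
      using mT(2) em by (intro finite_borel_measureI) auto
    fix f p :: "'a \<Rightarrow> real" assume f: "f \<in> Lip_b" and p: "p \<in> Lip"
    have "ennreal \<bar>a * T f p\<bar> = ennreal \<bar>a\<bar> * ennreal \<bar>T f p\<bar>" by (simp add: abs_mult ennreal_mult)
    also have "\<dots> \<le> ennreal \<bar>a\<bar> * (ennreal (lip_const p) * (\<integral>\<^sup>+x. ennreal \<bar>f x\<bar> \<partial>mass_measure T))"
      by (intro mult_left_mono mT f p) simp
    also have "\<dots> = ennreal (lip_const p) * (\<integral>\<^sup>+x. ennreal \<bar>f x\<bar> \<partial>scale_measure (ennreal \<bar>a\<bar>) (mass_measure T))"
      using abs_Lip_b_borel[OF f] mT(2)
      by (subst nn_integral_scale_measure) (auto intro: borel_measurable_sets_borel simp: ac_simps)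
    finally show "ennreal \<bar>a * T f p\<bar> \<le> \<dots>" .
  qed
  show cur: "(\<lambda>f p. a * T f p) \<in> metric_1_currents"
  proof (rule metric_1_currentsI[OF _ mb])
    show "bilinear_functional (\<lambda>f p. a * T f p)"
      using bilinear_functionalD[OF metric_1_currentsD(1)[OF T]]
      by (auto simp: bilinear_functional_def algebra_simps)
  qed (auto intro!: tendsto_mult metric_1_currentsD(3,4)[OF T])
  show "mass (\<lambda>f p. a * T f p) \<le> \<bar>a\<bar> * mass T"
    by (rule mass_le[OF metric_1_currentsD(1)[OF cur] mb]) (auto simp: em mass_nonneg simp del: emeasure_scale_measure)
qed

section \<open>Rectifiable currents: closure under countable sums and scaling\<close>

definition rectifiable_set :: "'a::metric_space set \<Rightarrow> bool" where
  "rectifiable_set S \<longleftrightarrow> (\<exists>(B :: nat \<Rightarrow> real set) (\<gamma> :: nat \<Rightarrow> real \<Rightarrow> 'a).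
     (\<forall>n. bounded (B n) \<and> (\<exists>L. L-lipschitz_on (B n) (\<gamma> n))) \<and> S = (\<Union>n. \<gamma> n ` B n))"

lemma rectifiable_1_currents_iff:
  "R \<in> rectifiable_1_currents \<longleftrightarrow> R \<in> metric_1_currents \<and>
     (\<exists>S. rectifiable_set S \<and> (AE x in mass_measure R. x \<in> S)) \<and>
     (\<forall>A\<in>sets borel. hausdorff1 A = 0 \<longrightarrow> emeasure (mass_measure R) A = 0)"
  unfolding rectifiable_1_currents_def rectifiable_set_def by blast

lemma rectifiable_set_image:
  fixes \<gamma> :: "real \<Rightarrow> 'a::metric_space"
  assumes "bounded B" "L-lipschitz_on B \<gamma>" shows "rectifiable_set (\<gamma> ` B)"
  unfolding rectifiable_set_def using assms by (intro exI[of _ "\<lambda>_. B"] exI[of _ "\<lambda>_. \<gamma>"]) auto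

lemma rectifiable_set_UN:
  assumes "\<And>k::nat. rectifiable_set (S k)" shows "rectifiable_set (\<Union>k. S k)"
proof -
  obtain B :: "nat \<Rightarrow> nat \<Rightarrow> real set" and \<gamma> where B: "\<And>k n. bounded (B k n)"
    "\<And>k n. \<exists>L. L-lipschitz_on (B k n) (\<gamma> k n)" "\<And>k. S k = (\<Union>n. \<gamma> k n ` B k n)"
    using assms unfolding rectifiable_set_def by metis
  let ?f = "\<lambda>F m. case_prod F (prod_decode m)"
  have "(\<Union>k. S k) = (\<Union>m. ?f \<gamma> m ` ?f B m)"
  proof (intro set_eqI iffI)
    fix x assume "x \<in> (\<Union>k. S k)"
    then obtain k n where "x \<in> \<gamma> k n ` B k n" using B(3) by blast
    then show "x \<in> (\<Union>m. ?f \<gamma> m ` ?f B m)"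
      by (intro UN_I[of "prod_encode (k, n)"]) auto
  next
    fix x assume "x \<in> (\<Union>m. ?f \<gamma> m ` ?f B m)"
    then obtain m where "x \<in> ?f \<gamma> m ` ?f B m" by (rule UN_E)
    then show "x \<in> (\<Union>k. S k)" by (cases "prod_decode m") (auto simp: B(3))
  qed
  then show ?thesis
    unfolding rectifiable_set_def using B(1,2)
    by (intro exI[of _ "?f B"] exI[of _ "?f \<gamma>"]) (auto split: prod.split)
qed

text \<open>The mass measure lies below every mass bound and therefore has more null sets.
  Concentration can thus be checked on whichever mass bound is convenient.\<close>

lemma AE_mass_measure:
  assumes "bilinear_functional T" "mass_bound T \<mu>" "AE x in \<mu>. P x"
  shows "AE x in mass_measure T. P x"
proof -
  obtain N where N: "{x \<in> space \<mu>. \<not> P x} \<subseteq> N" "N \<in> null_sets \<mu>"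
    using assms(3) by (rule AE_E3) auto
  have sp: "space \<mu> = UNIV" "sets \<mu> = sets borel"
    using finite_borel_measureD mass_boundD(1)[OF assms(2)] by blast+
  have "emeasure (mass_measure T) N \<le> 0"
    using emeasure_mass_measure_le[OF assms(1,2), of N] null_setsD1[OF N(2)] null_setsD2[OF N(2)] sp by simp
  then have "N \<in> null_sets (mass_measure T)"
    using null_setsD2[OF N(2)] sp mass_boundD(2)[OF mass_bound_mass_measure[OF assms(1,2)]]
    by (intro null_setsI) auto
  then show ?thesis using N sp by (intro AE_I'[of N]) auto
qed

lemma rectifiable_suminf:
  fixes R :: "nat \<Rightarrow> 'a::metric_space functional"
  assumes R: "\<And>k. R k \<in> rectifiable_1_currents" and m: "summable (\<lambda>k. mass (R k))"
  shows "f \<in> Lip_b \<Longrightarrow> p \<in> Lip \<Longrightarrow> summable (\<lambda>k. R k f p)"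
    and "(\<lambda>f p. \<Sum>k. R k f p) \<in> rectifiable_1_currents"
    and "mass (\<lambda>f p. \<Sum>k. R k f p) \<le> (\<Sum>k. mass (R k))"
proof -
  let ?R = "\<lambda>f p. \<Sum>k. R k f p"
  define \<mu> where "\<mu> = (\<lambda>k. mass_measure (R k))"
  have cur: "R k \<in> metric_1_currents" for k using R rectifiable_1_currents_iff by blast
  have mb: "mass_bound (R k) (\<mu> k)" for k unfolding \<mu>_def using cur by (rule current_mass_measure)
  note sets = mass_boundD(2)[OF mb]
  have "(\<Sum>k. emeasure (\<mu> k) UNIV) = (\<Sum>k. ennreal (mass (R k)))"
    by (simp add: \<mu>_def current_mass_measure cur)
  also have "\<dots> = ennreal (\<Sum>k. mass (R k))"
    by (intro suminf_ennreal2 mass_nonneg m)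
  finally have tot: "(\<Sum>k. emeasure (\<mu> k) UNIV) = ennreal (\<Sum>k. mass (R k))" .
  then have fin: "(\<Sum>k. emeasure (\<mu> k) UNIV) < \<infinity>" by simp
  note sum = current_suminf[of R \<mu>, OF cur mb fin]
  show "f \<in> Lip_b \<Longrightarrow> p \<in> Lip \<Longrightarrow> summable (\<lambda>k. R k f p)" by (rule sum(1))
  note bil = metric_1_currentsD(1)[OF sum(2)]
  show "mass ?R \<le> (\<Sum>k. mass (R k))"
    using tot by (intro mass_le[OF bil sum(3)]) (auto simp: emeasure_sum_measure[OF sets] intro!: suminf_nonneg m mass_nonneg)
  obtain S where S: "\<And>k. rectifiable_set (S k)" "\<And>k. AE x in \<mu> k. x \<in> S k"
    using R unfolding rectifiable_1_currents_iff \<mu>_def by metis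
  have "\<exists>N. N \<in> null_sets (\<mu> k) \<and> - S k \<subseteq> N" for k
  proof -
    obtain N where "{x \<in> space (\<mu> k). \<not> x \<in> S k} \<subseteq> N" "N \<in> null_sets (\<mu> k)"
      using S(2)[of k] by (rule AE_E3) auto
    then show ?thesis using finite_borel_measureD(2)[OF mass_boundD(1)[OF mb], of k] by auto
  qed
  then obtain N where N: "\<And>k. N k \<in> null_sets (\<mu> k)" "\<And>k. - S k \<subseteq> N k" by metis
  \<comment> \<open>The complement of the union of all \<open>S k\<close> is contained in every
    \<open>N k\<close>. Their intersection is thus a Borel exceptional set that is null for each
    summand, although the sets \<open>S k\<close> themselves need not be measurable.\<close>
  have Nb: "(\<Inter>k. N k) \<in> sets borel"
  proof (intro sets.countable_INT'')
    show "N k \<in> sets borel" for k using null_setsD2[OF N(1)[of k]] sets[of k] by simp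
  qed auto
  have "emeasure (\<mu> k) (\<Inter>k. N k) = 0" for k
  proof -
    have "emeasure (\<mu> k) (\<Inter>k. N k) \<le> emeasure (\<mu> k) (N k)"
      using N(1) by (intro emeasure_mono) auto
    then show ?thesis using N(1)[of k] by auto
  qed
  then have "(\<Inter>k. N k) \<in> null_sets (sum_measure \<mu>)"
    using Nb by (intro null_setsI) (auto simp: emeasure_sum_measure[OF sets])
  then have "AE x in sum_measure \<mu>. x \<in> (\<Union>k. S k)"
    using N(2) by (intro AE_I'[of "\<Inter>k. N k"]) auto
  then have "AE x in mass_measure ?R. x \<in> (\<Union>k. S k)"
    by (rule AE_mass_measure[OF bil sum(3)])
  moreover have "emeasure (mass_measure ?R) A = 0" if A: "A \<in> sets borel" "hausdorff1 A = 0" for A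
  proof -
    have "emeasure (\<mu> k) A = 0" for k using R that by (auto simp: rectifiable_1_currents_iff \<mu>_def)
    then have "emeasure (sum_measure \<mu>) A = 0" by (simp add: emeasure_sum_measure[OF sets A(1)])
    then show ?thesis using emeasure_mass_measure_le[OF bil sum(3) A(1)] by simp
  qed
  ultimately show "?R \<in> rectifiable_1_currents"
    unfolding rectifiable_1_currents_iff
    by (intro conjI exI[of _ "\<Union>k. S k"] ballI impI sum(2) rectifiable_set_UN S(1))
qed

lemma mass_zero: "mass (\<lambda>_ _. 0) = 0"
  by (rule antisym[OF mass_le[OF metric_1_currentsD(1)[OF current_zero] mass_bound_zero] mass_nonneg]) auto

lemma rectifiable_zero: "(\<lambda>_ _. 0) \<in> rectifiable_1_currents"
proof -
  have *: "emeasure (mass_measure (\<lambda>_ _. 0)) A = 0" if "A \<in> sets borel" for A :: "'a set"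
    using emeasure_mass_measure_le[OF metric_1_currentsD(1)[OF current_zero] mass_bound_zero that] by simp
  have s: "sets (mass_measure (\<lambda>_ _. 0)) = sets (borel :: 'a measure)"
    by (rule mass_boundD(2)[OF current_mass_measure(1)[OF current_zero]])
  have "UNIV \<in> null_sets (mass_measure (\<lambda>_ _. 0) :: 'a measure)"
    using *[of UNIV] s by (intro null_setsI) auto
  then have "AE x in (mass_measure (\<lambda>_ _. 0) :: 'a measure). x \<in> (\<lambda>_::real. undefined) ` {}"
    by (intro AE_I'[of UNIV]) auto
  moreover have "rectifiable_set ((\<lambda>_::real. undefined) ` {} :: 'a set)"
    by (rule rectifiable_set_image[of _ 0]) auto
  ultimately show ?thesis unfolding rectifiable_1_currents_iff
    by (intro conjI exI[of _ "(\<lambda>_::real. undefined) ` {}"] ballI impI current_zero *)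
qed

lemma rectifiable_add:
  assumes S: "S \<in> rectifiable_1_currents" and T: "T \<in> rectifiable_1_currents"
  shows "(\<lambda>f p. S f p + T f p) \<in> rectifiable_1_currents"
proof -
  define R where "R = case_nat S (case_nat T (\<lambda>_ _ _. 0))"
  have eq: "(\<lambda>f p. \<Sum>k. R k f p) = (\<lambda>f p. S f p + T f p)"
  proof (intro ext)
    fix f p
    have "(\<Sum>k. R k f p) = (\<Sum>k\<in>{0,1}. R k f p)"
      by (rule suminf_finite) (auto simp: R_def split: nat.split)
    then show "(\<Sum>k. R k f p) = S f p + T f p" by (simp add: R_def)
  qed
  have R: "R k \<in> rectifiable_1_currents" for k
    using S T rectifiable_zero by (auto simp: R_def split: nat.split)
  have "summable (\<lambda>k. mass (R k))"
    by (rule summable_finite[of "{0,1}"]) (auto simp: R_def mass_zero split: nat.split)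
  from rectifiable_suminf(2)[of R, OF R this] show ?thesis unfolding eq .
qed

lemma
  assumes I: "finite I" and R: "\<And>i. i \<in> I \<Longrightarrow> R i \<in> rectifiable_1_currents"
  shows rectifiable_sum: "(\<lambda>f p. \<Sum>i\<in>I. R i f p) \<in> rectifiable_1_currents"
    and mass_sum_le: "mass (\<lambda>f p. \<Sum>i\<in>I. R i f p) \<le> (\<Sum>i\<in>I. mass (R i))"
proof -
  have "(\<lambda>f p. \<Sum>i\<in>I. R i f p) \<in> rectifiable_1_currents \<and>
      mass (\<lambda>f p. \<Sum>i\<in>I. R i f p) \<le> (\<Sum>i\<in>I. mass (R i))"
    using I R
  proof (induction I rule: finite_induct)
    case empty then show ?case by (simp add: rectifiable_zero mass_zero)
  next
    case (insert i I)
    then have IH: "(\<lambda>f p. \<Sum>i\<in>I. R i f p) \<in> rectifiable_1_currents"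
      "mass (\<lambda>f p. \<Sum>i\<in>I. R i f p) \<le> (\<Sum>i\<in>I. mass (R i))" "R i \<in> rectifiable_1_currents" by auto
    show ?case
      using insert(1,2) rectifiable_add[OF IH(3,1)] IH(2)
        mass_add_le[of "R i" "\<lambda>f p. \<Sum>i\<in>I. R i f p"] IH(1,3)
      by (auto simp: rectifiable_1_currents_iff)
  qed
  then show "(\<lambda>f p. \<Sum>i\<in>I. R i f p) \<in> rectifiable_1_currents"
    "mass (\<lambda>f p. \<Sum>i\<in>I. R i f p) \<le> (\<Sum>i\<in>I. mass (R i))" by auto
qed

lemma rectifiable_scale:
  assumes R: "R \<in> rectifiable_1_currents"
  shows "(\<lambda>f p. a * R f p) \<in> rectifiable_1_currents"
proof -
  have cur: "R \<in> metric_1_currents" using R rectifiable_1_currents_iff by blast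
  note bil = metric_1_currentsD(1)[OF current_scale[OF cur]] and mb = mass_bound_scale[OF cur]
  obtain S where S: "rectifiable_set S" "AE x in mass_measure R. x \<in> S"
    using R unfolding rectifiable_1_currents_iff by blast
  from S(2) obtain N where N: "{x \<in> space (mass_measure R). \<not> x \<in> S} \<subseteq> N" "N \<in> null_sets (mass_measure R)"
    by (rule AE_E3) auto
  then have "AE x in scale_measure (ennreal \<bar>a\<bar>) (mass_measure R). x \<in> S"
    by (intro AE_I'[of N]) (auto simp: null_sets_def space_scale_measure)
  then have "AE x in mass_measure (\<lambda>f p. a * R f p). x \<in> S"
    by (rule AE_mass_measure[OF bil mb])
  moreover have "emeasure (mass_measure (\<lambda>f p. a * R f p)) A = 0" if "A \<in> sets borel" "hausdorff1 A = 0" for A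
    using emeasure_mass_measure_le[OF bil mb that(1)] R that by (auto simp: rectifiable_1_currents_iff)
  ultimately show ?thesis
    unfolding rectifiable_1_currents_iff
    by (intro conjI exI[of _ S] ballI impI current_scale[OF cur] S(1))
qed

section \<open>Increments bounded by difference quotients\<close>

lemma nn_integral_Ioc_Icc:
  fixes s t :: real
  shows "(\<integral>\<^sup>+x\<in>{s<..t}. f x \<partial>lborel) = (\<integral>\<^sup>+x\<in>{s..t}. f x \<partial>lborel)"
proof (rule nn_integral_cong_AE)
  show "AE x in lborel. f x * indicator {s<..t} x = f x * indicator {s..t} x"
    using AE_lborel_singleton[of s] by eventually_elim (auto simp: indicator_def)
qed

text \<open>Shifting cancels the common part of the two integrals: what remains is the integral of
  \<open>u\<close> over \<open>{t..t+h}\<close> minus that over \<open>{s..s+h}\<close>, and on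
  these short intervals \<open>u\<close> stays within \<open>L * h\<close> of \<open>u t\<close> and
  \<open>u s\<close>.\<close>

lemma shifted_integral_ge:
  fixes u :: "real \<Rightarrow> real"
  assumes u: "L-lipschitz_on UNIV u" and st: "s \<le> t" and h: "0 < h"
  shows "ennreal (u t - u s - 2 * L * h) \<le> (\<integral>\<^sup>+r\<in>{s..t}. ennreal ((u (r + h) - u r) / h) \<partial>lborel)"
proof -
  have L: "0 \<le> L" using u by (rule lipschitz_on_nonneg)
  have cont: "continuous_on A u" for A
    using lipschitz_on_continuous_on[OF u] continuous_on_subset by blast
  have int: "u integrable_on {a..b}" for a b by (intro integrable_continuous_interval cont)
  have cont': "continuous_on A (\<lambda>r. u (r + h))" for A
    by (rule continuous_on_compose2[OF cont[of UNIV]]) (auto intro!: continuous_intros)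
  have lip: "\<bar>u x - u y\<bar> \<le> L * \<bar>x - y\<bar>" for x y
    using lipschitz_onD[OF u, of x y] by (simp add: dist_real_def)
  have "integral {s..t} (\<lambda>r. u (r + h) - u r) = integral {s..t} (u \<circ> ((+) h)) - integral {s..t} u"
    using cont' int by (subst Henstock_Kurzweil_Integration.integral_diff)
      (auto simp: o_def add.commute intro!: integrable_continuous_interval)
  also have "integral {s..t} (u \<circ> ((+) h)) = integral {s+h..t+h} u" by (rule integral_shift_Icc_real)
  also have "integral {s+h..t+h} u = integral {s..t+h} u - integral {s..s+h} u"
    using Henstock_Kurzweil_Integration.integral_combine[of s "s+h" "t+h" u] h st int by simp
  also have "integral {s..t+h} u = integral {s..t} u + integral {t..t+h} u"
    using Henstock_Kurzweil_Integration.integral_combine[of s t "t+h" u] h st int by simp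
  finally have D: "integral {s..t} (\<lambda>r. u (r + h) - u r) = integral {t..t+h} u - integral {s..s+h} u" by simp
  have "integral {t..t+h} (\<lambda>_. u t - L * h) \<le> integral {t..t+h} u"
  proof (intro integral_le int integrable_const_ivl)
    fix r assume "r \<in> {t..t+h}"
    then have "\<bar>u r - u t\<bar> \<le> L * h" using lip[of r t] L mult_left_mono[of "\<bar>r - t\<bar>" h L] by auto
    then show "u t - L * h \<le> u r" by linarith
  qed
  moreover have "integral {s..s+h} u \<le> integral {s..s+h} (\<lambda>_. u s + L * h)"
  proof (intro integral_le int integrable_const_ivl)
    fix r assume "r \<in> {s..s+h}"
    then have "\<bar>u r - u s\<bar> \<le> L * h" using lip[of r s] L mult_left_mono[of "\<bar>r - s\<bar>" h L] by auto
    then show "u r \<le> u s + L * h" by linarith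
  qed
  ultimately have "h * (u t - u s - 2 * L * h) \<le> integral {s..t} (\<lambda>r. u (r + h) - u r)"
    using h unfolding D by (simp add: algebra_simps)
  then have *: "u t - u s - 2 * L * h \<le> integral {s..t} (\<lambda>r. u (r + h) - u r) / h"
    using h by (simp add: field_simps)
  define \<phi> where "\<phi> = (\<lambda>r. (u (r + h) - u r) / h)"
  have c\<phi>: "continuous_on A \<phi>" for A
    unfolding \<phi>_def using h by (auto intro!: continuous_intros cont cont')
  \<comment> \<open>Since \<open>ennreal\<close> sends negative quotients to 0, the target
    integrates the positive part \<open>max 0 (\<phi> r)\<close>; replacing \<open>\<phi>\<close> by
    it can only increase the integral.\<close>
  have s1: "set_integrable lborel {s..t} \<phi>" and s2: "set_integrable lborel {s..t} (\<lambda>r. max 0 (\<phi> r))"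
    by (auto intro!: borel_integrable_atLeastAtMost' continuous_intros c\<phi>)
  have "integral {s..t} (\<lambda>r. u (r + h) - u r) / h = integral {s..t} \<phi>"
    unfolding \<phi>_def by simp
  also have "\<dots> = (LINT r:{s..t}|lborel. \<phi> r)"
    by (rule set_borel_integral_eq_integral(2)[OF s1, symmetric])
  also have "\<dots> \<le> (LINT r:{s..t}|lborel. max 0 (\<phi> r))"
    by (intro set_integral_mono s1 s2) auto
  finally have "ennreal (u t - u s - 2 * L * h) \<le> ennreal (LINT r:{s..t}|lborel. max 0 (\<phi> r))"
    using * by (intro ennreal_leI) simp
  also have "\<dots> = (\<integral>\<^sup>+r. ennreal (indicator {s..t} r *\<^sub>R max 0 (\<phi> r)) \<partial>lborel)"
    using s2 unfolding set_lebesgue_integral_def set_integrable_def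
    by (intro nn_integral_eq_integral[symmetric]) auto
  also have "\<dots> = (\<integral>\<^sup>+r\<in>{s..t}. ennreal (\<phi> r) \<partial>lborel)"
    by (intro nn_integral_cong) (auto simp: indicator_def max_def ennreal_neg)
  finally show ?thesis unfolding \<phi>_def .
qed

text \<open>The reverse Fatou lemma, with the constant \<open>L\<close> as majorant, applied to the
  preceding estimate along \<open>h = 1 / Suc n\<close>. It takes the place of differentiability
  almost everywhere: the limsup of the quotients need not be a limit.\<close>

lemma increment_le_nn_integral_limsup:
  fixes u :: "real \<Rightarrow> real"
  assumes u: "L-lipschitz_on UNIV u" and st: "s \<le> t"
  shows "ennreal (u t - u s) \<le>
    (\<integral>\<^sup>+r\<in>{s<..t}. limsup (\<lambda>n. ennreal ((u (r + 1 / Suc n) - u r) / (1 / Suc n))) \<partial>lborel)"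
proof -
  have L: "0 \<le> L" using u by (rule lipschitz_on_nonneg)
  have cont: "continuous_on A u" for A
    using lipschitz_on_continuous_on[OF u] continuous_on_subset by blast
  have cont': "continuous_on A (\<lambda>r. u (r + h))" for A h
    by (rule continuous_on_compose2[OF cont[of UNIV]]) (auto intro!: continuous_intros)
  define \<phi> where "\<phi> = (\<lambda>n r. (u (r + 1 / Suc n) - u r) / (1 / Suc n))"
  have c\<phi>: "continuous_on A (\<phi> n)" for A n
    unfolding \<phi>_def by (auto intro!: continuous_intros cont cont')
  have \<phi>L: "\<phi> n r \<le> L" for n r
  proof -
    have "\<bar>u (r + 1 / Suc n) - u r\<bar> \<le> L * \<bar>1 / Suc n\<bar>"
      using lipschitz_onD[OF u, of "r + 1 / Suc n" r] by (simp add: dist_real_def)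
    then have "u (r + 1 / Suc n) - u r \<le> L * (1 / Suc n)" by simp
    then show ?thesis unfolding \<phi>_def by (subst pos_divide_le_eq) auto
  qed
  have "(\<lambda>n. ennreal (u t - u s - 2 * L * (1 / Suc n))) \<longlonglongrightarrow> ennreal (u t - u s - 2 * L * 0)"
    by (intro tendsto_ennrealI tendsto_intros LIMSEQ_inverse_real_of_nat[unfolded inverse_eq_divide])
  then have "ennreal (u t - u s) = limsup (\<lambda>n. ennreal (u t - u s - 2 * L * (1 / Suc n)))"
    by (intro lim_imp_Limsup[symmetric]) auto
  also have "\<dots> \<le> limsup (\<lambda>n. \<integral>\<^sup>+r\<in>{s..t}. ennreal (\<phi> n r) \<partial>lborel)"
    unfolding \<phi>_def by (intro Limsup_mono always_eventually allI shifted_integral_ge u st) auto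
  also have "\<dots> \<le> (\<integral>\<^sup>+r. limsup (\<lambda>n. ennreal (\<phi> n r) * indicator {s..t} r) \<partial>lborel)"
  proof (rule nn_integral_limsup[where w="\<lambda>r. ennreal L * indicator {s..t} r"])
    show "(\<lambda>r. ennreal (\<phi> n r) * indicator {s..t} r) \<in> borel_measurable lborel" for n
      using borel_measurable_continuous_onI[OF c\<phi>[of UNIV n]] by simp
    show "AE r in lborel. ennreal (\<phi> n r) * indicator {s..t} r \<le> ennreal L * indicator {s..t} r" for n
      using \<phi>L by (auto simp: indicator_def intro!: ennreal_leI)
    show "(\<integral>\<^sup>+r. ennreal L * indicator {s..t} r \<partial>lborel) < \<infinity>"
      using st by (simp add: nn_integral_cmult ennreal_mult_less_top)
  qed auto
  also have "\<dots> = (\<integral>\<^sup>+r\<in>{s..t}. limsup (\<lambda>n. ennreal (\<phi> n r)) \<partial>lborel)"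
    by (intro nn_integral_cong) (auto simp: indicator_def Limsup_const)
  finally show ?thesis unfolding nn_integral_Ioc_Icc \<phi>_def .
qed

section \<open>Riemann-Stieltjes integrals of Lipschitz functions\<close>

text \<open>Left-endpoint sums over the dyadic partition of the unit interval. Each partition
  refines the previous one, so consecutive sums can be compared interval by interval.\<close>

definition rs_sum :: "nat \<Rightarrow> (real \<Rightarrow> real) \<Rightarrow> (real \<Rightarrow> real) \<Rightarrow> real" where
  "rs_sum n F P = (\<Sum>i<2^n. F (real i / 2^n) * (P (real (Suc i) / 2^n) - P (real i / 2^n)))"

definition rs_integral :: "(real \<Rightarrow> real) \<Rightarrow> (real \<Rightarrow> real) \<Rightarrow> real" where
  "rs_integral F P = lim (\<lambda>n. rs_sum n F P)"

text \<open>Halving \<open>[a, b]\<close> at \<open>m\<close> changes its term by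
  \<open>(F m - F a) * (P b - P m)\<close>, a product of two increments over half a mesh. There are
  only \<open>2^n\<close> such terms, so one factor of the mesh size survives.\<close>

lemma rs_sum_Suc_diff:
  assumes F: "A-lipschitz_on UNIV F" and P: "B-lipschitz_on UNIV P"
  shows "\<bar>rs_sum (Suc n) F P - rs_sum n F P\<bar> \<le> A * B / 2^n / 2"
proof -
  let ?g = "\<lambda>i::nat. F (real i / 2^Suc n) * (P (real (Suc i) / 2^Suc n) - P (real i / 2^Suc n))"
  let ?f = "\<lambda>i::nat. F (real i / 2^n) * (P (real (Suc i) / 2^n) - P (real i / 2^n))"
  have A: "0 \<le> A" and B: "0 \<le> B" using F P lipschitz_on_nonneg by blast+
  have "rs_sum (Suc n) F P = (\<Sum>i<2^n. sum ?g {i*2..<i*2+2})"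
    unfolding rs_sum_def by (subst sum.nat_group) (simp add: mult.commute)
  then have eq: "rs_sum (Suc n) F P - rs_sum n F P = (\<Sum>i<2^n. ?g (i*2) + ?g (Suc (i*2)) - ?f i)"
    unfolding rs_sum_def by (simp add: sum_subtractf eval_nat_numeral)
  have "\<bar>rs_sum (Suc n) F P - rs_sum n F P\<bar> \<le> (\<Sum>i<(2::nat)^n. A * B / (2^n * 2^n) / 4)"
    unfolding eq
  proof (rule order_trans[OF sum_abs], rule sum_mono)
    fix i :: nat
    define a where "a = real i / 2^n"
    define m where "m = a + 1 / 2^n / 2"
    define b where "b = a + 1 / 2^n"
    have e: "real (i*2) / 2^Suc n = a" "real (Suc (i*2)) / 2^Suc n = m" "real (Suc (Suc (i*2))) / 2^Suc n = b"
      "real (Suc i) / 2^n = b" by (simp_all add: a_def m_def b_def field_simps)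
    have "?g (i*2) + ?g (Suc (i*2)) - ?f i = (F m - F a) * (P b - P m)"
      unfolding e a_def[symmetric] by (simp add: algebra_simps)
    also have "\<bar>\<dots>\<bar> = \<bar>F m - F a\<bar> * \<bar>P b - P m\<bar>" by (rule abs_mult)
    also have "\<dots> \<le> (A * (1 / 2^n / 2)) * (B * (1 / 2^n / 2))"
      using lipschitz_onD[OF F, of m a] lipschitz_onD[OF P, of b m] A B
      by (intro mult_mono) (auto simp: dist_real_def m_def b_def)
    finally show "\<bar>?g (i*2) + ?g (Suc (i*2)) - ?f i\<bar> \<le> A * B / (2^n * 2^n) / 4" by simp
  qed
  also have "\<dots> = 2^n * (A * B / (2^n * 2^n) / 4)" by (simp only: sum_constant card_lessThan of_nat_power of_nat_numeral)
  also have "\<dots> = A * B / 2^n / 4" by (simp only: times_divide_eq_right divide_divide_eq_left) simp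
  \<comment> \<open>The weaker constant equals \<open>A * B / 2^n - A * B / 2^Suc n\<close>, so that
    the estimates telescope.\<close>
  also have "\<dots> \<le> A * B / 2^n / 2"
  proof -
    have "x / 4 \<le> x / 2" if "0 \<le> x" for x :: real using that by simp
    then show ?thesis by this (use A B in simp)
  qed
  finally show ?thesis .
qed

text \<open>The telescoping bound makes the sums Cauchy. The error depends on \<open>F\<close> and
  \<open>P\<close> only through their Lipschitz constants, and this uniformity permits limits in
  \<open>P\<close> under the integral.\<close>

lemma
  assumes F: "A-lipschitz_on UNIV F" and P: "B-lipschitz_on UNIV P"
  shows rs_sum_tendsto: "(\<lambda>n. rs_sum n F P) \<longlonglongrightarrow> rs_integral F P"
    and rs_integral_error: "\<bar>rs_integral F P - rs_sum n F P\<bar> \<le> A * B / 2^n"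
proof -
  let ?S = "\<lambda>n. rs_sum n F P"
  have AB: "0 \<le> A * B" using F P lipschitz_on_nonneg by (metis mult_nonneg_nonneg)
  have d: "\<bar>?S (n + k) - ?S n\<bar> \<le> A * B / 2^n - A * B / 2^(n + k)" for n k
  proof (induction k)
    case (Suc k)
    have "\<bar>?S (n + Suc k) - ?S (n + k)\<bar> \<le> A * B / 2^(n + k) / 2"
      using rs_sum_Suc_diff[OF F P, of "n + k"] by simp
    then show ?case using Suc by simp
  qed simp
  then have d': "\<bar>?S (n + k) - ?S n\<bar> \<le> A * B / 2^n" for n k
    by (rule order_trans) (use AB in simp)
  have lim0: "(\<lambda>n. A * B / 2^n) \<longlonglongrightarrow> 0"
    by (rule LIMSEQ_divide_realpow_zero) simp
  have "Cauchy ?S"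
  proof (rule CauchyI')
    fix e :: real assume "0 < e"
    then obtain N where N: "A * B / 2^N < e / 2"
      using order_tendstoD(2)[OF lim0, of "e/2"] by (auto dest: eventually_happens)
    show "\<exists>M. \<forall>m\<ge>M. \<forall>n>m. dist (?S m) (?S n) < e"
    proof (intro exI allI impI)
      fix m n assume "N \<le> m" "m < n"
      then have "\<bar>?S m - ?S N\<bar> < e / 2" "\<bar>?S n - ?S N\<bar> < e / 2"
        using le_less_trans[OF d' N, of "m - N"] le_less_trans[OF d' N, of "n - N"] by simp_all
      then show "dist (?S m) (?S n) < e" unfolding dist_real_def by linarith
    qed
  qed
  then have "convergent ?S" by (rule Cauchy_convergent)
  then show l: "?S \<longlonglongrightarrow> rs_integral F P" unfolding rs_integral_def by (simp add: convergent_LIMSEQ_iff)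
  have "(\<lambda>k. \<bar>?S (k + n) - ?S n\<bar>) \<longlonglongrightarrow> \<bar>rs_integral F P - ?S n\<bar>"
    by (intro tendsto_intros LIMSEQ_ignore_initial_segment l)
  then show "\<bar>rs_integral F P - ?S n\<bar> \<le> A * B / 2^n"
    using d'[of n] unfolding add.commute[of n] by (intro LIMSEQ_le_const2) blast+
qed

lemma
  assumes F: "A-lipschitz_on UNIV F" and G: "A'-lipschitz_on UNIV G"
    and P: "B-lipschitz_on UNIV P" and Q: "B'-lipschitz_on UNIV Q"
  shows rs_integral_linear1: "rs_integral (\<lambda>x. a * F x + b * G x) P = a * rs_integral F P + b * rs_integral G P"
    and rs_integral_linear2: "rs_integral F (\<lambda>x. a * P x + b * Q x) = a * rs_integral F P + b * rs_integral F Q"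
proof -
  have "(\<bar>a\<bar> * A + \<bar>b\<bar> * A')-lipschitz_on UNIV (\<lambda>x. a * F x + b * G x)"
    by (intro lipschitz_intros F G)
  note 1 = rs_sum_tendsto[OF this P]
  have "(\<bar>a\<bar> * B + \<bar>b\<bar> * B')-lipschitz_on UNIV (\<lambda>x. a * P x + b * Q x)"
    by (intro lipschitz_intros P Q)
  note 2 = rs_sum_tendsto[OF F this]
  have "rs_sum n (\<lambda>x. a * F x + b * G x) P = a * rs_sum n F P + b * rs_sum n G P" for n
    by (simp add: rs_sum_def sum_distrib_left sum.distrib[symmetric] algebra_simps)
  then show "rs_integral (\<lambda>x. a * F x + b * G x) P = a * rs_integral F P + b * rs_integral G P"
    using 1 by (intro LIMSEQ_unique[OF 1]) (auto intro!: tendsto_intros rs_sum_tendsto F G P)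
  have "rs_sum n F (\<lambda>x. a * P x + b * Q x) = a * rs_sum n F P + b * rs_sum n F Q" for n
    by (simp add: rs_sum_def sum_distrib_left sum.distrib[symmetric] algebra_simps)
  then show "rs_integral F (\<lambda>x. a * P x + b * Q x) = a * rs_integral F P + b * rs_integral F Q"
    by (intro LIMSEQ_unique[OF 2]) (auto intro!: tendsto_intros rs_sum_tendsto F P Q)
qed

lemma rs_integral_one: "rs_integral (\<lambda>_. 1) P = P 1 - P 0"
proof -
  have "rs_sum n (\<lambda>_. 1) P = P 1 - P 0" for n
    unfolding rs_sum_def using sum_lessThan_telescope[of "\<lambda>i. P (real i / 2^n)" "2^n"] by simp
  then show ?thesis unfolding rs_integral_def by simp
qed

lemma rs_integral_tendsto:
  assumes F: "A-lipschitz_on UNIV F" and P: "B-lipschitz_on UNIV P"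
    and Q: "\<And>j. B-lipschitz_on UNIV (Q j)" and lim: "\<And>x. (\<lambda>j. Q j x) \<longlonglongrightarrow> P x"
  shows "(\<lambda>j. rs_integral F (Q j)) \<longlonglongrightarrow> rs_integral F P"
proof (rule LIMSEQ_I)
  fix e :: real assume "0 < e"
  have lim0: "(\<lambda>n. A * B / 2^n) \<longlonglongrightarrow> 0"
    by (rule LIMSEQ_divide_realpow_zero) simp
  obtain n where n: "A * B / 2^n < e / 3"
    using order_tendstoD(2)[OF lim0, of "e/3"] \<open>0 < e\<close> by (auto dest: eventually_happens)
  have "(\<lambda>j. rs_sum n F (Q j)) \<longlonglongrightarrow> rs_sum n F P"
    unfolding rs_sum_def by (intro tendsto_intros lim)
  then obtain N where N: "\<And>j. j \<ge> N \<Longrightarrow> \<bar>rs_sum n F (Q j) - rs_sum n F P\<bar> < e / 3"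
    using LIMSEQ_D[of _ _ "e/3"] \<open>0 < e\<close> by fastforce
  show "\<exists>N. \<forall>j\<ge>N. norm (rs_integral F (Q j) - rs_integral F P) < e"
  proof (intro exI allI impI)
    fix j assume "N \<le> j"
    then show "norm (rs_integral F (Q j) - rs_integral F P) < e"
      using N[of j] n rs_integral_error[OF F P, of n] rs_integral_error[OF F Q[of j], of n]
      unfolding real_norm_def by linarith
  qed
qed

section \<open>The current of a Lipschitz curve\<close>

definition curve_current :: "(real \<Rightarrow> 'a::metric_space) \<Rightarrow> 'a functional" where
  "curve_current \<theta> f p = rs_integral (\<lambda>t. f (\<theta> t)) (\<lambda>t. p (\<theta> t))"

text \<open>The image under the curve of the measure with density \<open>g\<close> on the parameter
  interval. The weight is a parameter because the same current is bounded with different weights,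
  and the interval is half-open so that partition intervals tile it.\<close>

definition curve_measure :: "(real \<Rightarrow> 'a::metric_space) \<Rightarrow> (real \<Rightarrow> ennreal) \<Rightarrow> 'a measure" where
  "curve_measure \<theta> g = distr (density lborel (\<lambda>r. g r * indicator {0<..1} r)) borel \<theta>"

lemma Lip_compose:
  "f \<in> Lip \<Longrightarrow> L-lipschitz_on UNIV \<theta> \<Longrightarrow> (lip_const f * L)-lipschitz_on UNIV (\<lambda>t. f (\<theta> t))"
  using lipschitz_on_compose2[OF _ lipschitz_on_subset[OF lipschitz_on_lip_const]] by fastforce

lemma nn_integral_curve_measure:
  assumes "continuous_on UNIV \<theta>" "g \<in> borel_measurable borel" "h \<in> borel_measurable borel"
  shows "nn_integral (curve_measure \<theta> g) h = (\<integral>\<^sup>+r\<in>{0<..1}. g r * h (\<theta> r) \<partial>lborel)"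
proof -
  have [measurable]: "\<theta> \<in> borel_measurable borel" using assms(1) by (rule borel_measurable_continuous_onI)
  note assms(2,3)[measurable]
  show ?thesis unfolding curve_measure_def
    by (subst nn_integral_distr, simp, simp, subst nn_integral_density) (auto intro!: nn_integral_cong simp: ac_simps)
qed

lemma sets_curve_measure [simp]: "sets (curve_measure \<theta> g) = sets borel"
  by (simp add: curve_measure_def)

lemma emeasure_curve_measure:
  assumes "continuous_on UNIV \<theta>" "g \<in> borel_measurable borel" "A \<in> sets borel"
  shows "emeasure (curve_measure \<theta> g) A = (\<integral>\<^sup>+r\<in>{0<..1}. g r * indicator A (\<theta> r) \<partial>lborel)"
  using nn_integral_curve_measure[OF assms(1,2), of "indicator A"] assms(3) by simp

lemma nn_integral_Ioc_sum:
  fixes t :: "nat \<Rightarrow> real"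
  assumes "mono t" and h: "h \<in> borel_measurable borel"
  shows "(\<Sum>i<k. \<integral>\<^sup>+r\<in>{t i<..t (Suc i)}. h r \<partial>lborel) = (\<integral>\<^sup>+r\<in>{t 0<..t k}. h r \<partial>lborel)"
proof (induction k)
  case (Suc k)
  have le: "t 0 \<le> t k" "t k \<le> t (Suc k)" using \<open>mono t\<close> by (auto simp: mono_def)
  then have "{t 0<..t (Suc k)} = {t 0<..t k} \<union> {t k<..t (Suc k)}" by auto
  moreover have "{t 0<..t k} \<inter> {t k<..t (Suc k)} = {}" by auto
  ultimately show ?case
    using Suc nn_integral_disjoint_pair[of h lborel "{t 0<..t k}" "{t k<..t (Suc k)}"] h by simp
qed simp

text \<open>In each term of a Riemann sum the increment of \<open>P\<close> is at most
  \<open>M\<close> times the integral of \<open>g\<close> over that interval. Moving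
  \<open>\<bar>F\<bar>\<close> from the left node into the integral costs its oscillation
  \<open>A / 2^n\<close>, which disappears in the limit because the total weight is finite.\<close>

lemma mass_bound_curve_current:
  fixes \<theta> :: "real \<Rightarrow> 'a::metric_space"
  assumes \<theta>: "L-lipschitz_on UNIV \<theta>" and g: "g \<in> borel_measurable borel"
    and fin: "(\<integral>\<^sup>+r\<in>{0<..1}. g r \<partial>lborel) < \<infinity>"
    and d: "\<And>s t. 0 \<le> s \<Longrightarrow> s \<le> t \<Longrightarrow> t \<le> 1 \<Longrightarrow> ennreal (dist (\<theta> s) (\<theta> t)) \<le> (\<integral>\<^sup>+r\<in>{s<..t}. g r \<partial>lborel)"
  shows "mass_bound (curve_current \<theta>) (curve_measure \<theta> g)"
  unfolding mass_bound_iff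
proof (intro conjI ballI)
  have c\<theta>: "continuous_on UNIV \<theta>" using \<theta> by (rule lipschitz_on_continuous_on)
  have L: "0 \<le> L" using \<theta> by (rule lipschitz_on_nonneg)
  show "finite_borel_measure (curve_measure \<theta> g)"
    using fin by (intro finite_borel_measureI) (auto simp: emeasure_curve_measure[OF c\<theta> g])
  fix f p :: "'a \<Rightarrow> real" assume f: "f \<in> Lip_b" and p: "p \<in> Lip"
  define F where "F = (\<lambda>t. f (\<theta> t))"
  define P where "P = (\<lambda>t. p (\<theta> t))"
  define A where "A = lip_const f * L"
  define M where "M = lip_const p"
  have F: "A-lipschitz_on UNIV F" unfolding A_def F_def by (rule Lip_compose[OF Lip_bD(1)[OF f] \<theta>])
  have P: "(M * L)-lipschitz_on UNIV P" unfolding M_def P_def by (rule Lip_compose[OF p \<theta>])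
  have M: "0 \<le> M" using p by (simp add: M_def lip_const_nonneg)
  have A: "0 \<le> A" using F by (rule lipschitz_on_nonneg)
  have Fm: "F \<in> borel_measurable borel"
    using lipschitz_on_continuous_on[OF F] by (rule borel_measurable_continuous_onI)
  define G where "G = enn2real (\<integral>\<^sup>+r\<in>{0<..1}. g r \<partial>lborel)"
  have G: "(\<integral>\<^sup>+r\<in>{0<..1}. g r \<partial>lborel) = ennreal G" "0 \<le> G"
    using fin by (simp_all add: G_def)
  define I where "I = (\<integral>\<^sup>+r\<in>{0<..1}. g r * ennreal \<bar>F r\<bar> \<partial>lborel)"
  have sum: "ennreal \<bar>rs_sum n F P\<bar> \<le> ennreal M * (I + ennreal (A / 2^n * G))" for n
  proof -
    define t where "t = (\<lambda>i::nat. real i / 2^n)"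
    have t: "mono t" by (auto simp: mono_def t_def divide_right_mono)
    have t01: "0 \<le> t i" "t i \<le> t (Suc i)" "i < 2^n \<Longrightarrow> t (Suc i) \<le> 1" for i
    proof -
      show "t (Suc i) \<le> 1" if "i < 2^n"
      proof -
        have "real (Suc i) \<le> real (2^n)" using that by (subst of_nat_le_iff) simp
        then show ?thesis by (simp add: t_def)
      qed
    qed (auto simp: t_def divide_right_mono)
    have "ennreal \<bar>rs_sum n F P\<bar> \<le> ennreal (\<Sum>i<2^n. \<bar>F (t i) * (P (t (Suc i)) - P (t i))\<bar>)"
      unfolding rs_sum_def t_def by (intro ennreal_leI sum_abs)
    also have "\<dots> = (\<Sum>i<2^n. ennreal \<bar>F (t i) * (P (t (Suc i)) - P (t i))\<bar>)"
      by (rule sum_ennreal[symmetric]) simp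
    also have "\<dots> \<le> (\<Sum>i<2^n. ennreal M * (\<integral>\<^sup>+r\<in>{t i<..t (Suc i)}. g r * (ennreal \<bar>F r\<bar> + ennreal (A / 2^n)) \<partial>lborel))"
    proof (rule sum_mono)
      fix i :: nat assume "i \<in> {..<2^n}"
      then have i: "i < 2^n" by simp
      have "\<bar>F (t i) * (P (t (Suc i)) - P (t i))\<bar> \<le> \<bar>F (t i)\<bar> * (M * dist (\<theta> (t i)) (\<theta> (t (Suc i))))"
        using lip_const_dist[OF p, of "\<theta> (t (Suc i))" "\<theta> (t i)"]
        by (auto simp: abs_mult P_def M_def dist_commute intro!: mult_left_mono)
      then have "ennreal \<bar>F (t i) * (P (t (Suc i)) - P (t i))\<bar> \<le>
          ennreal (\<bar>F (t i)\<bar> * (M * dist (\<theta> (t i)) (\<theta> (t (Suc i)))))" by (rule ennreal_leI)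
      also have "\<dots> = ennreal M * (ennreal \<bar>F (t i)\<bar> * ennreal (dist (\<theta> (t i)) (\<theta> (t (Suc i)))))"
        using M by (simp add: ennreal_mult ac_simps)
      also have "\<dots> \<le> ennreal M * (ennreal \<bar>F (t i)\<bar> * (\<integral>\<^sup>+r\<in>{t i<..t (Suc i)}. g r \<partial>lborel))"
        by (intro mult_left_mono d t01 i) auto
      also have "ennreal \<bar>F (t i)\<bar> * (\<integral>\<^sup>+r\<in>{t i<..t (Suc i)}. g r \<partial>lborel) =
          (\<integral>\<^sup>+r. ennreal \<bar>F (t i)\<bar> * (g r * indicator {t i<..t (Suc i)} r) \<partial>lborel)"
        using g by (intro nn_integral_cmult[symmetric]) simp
      also have "\<dots> \<le> (\<integral>\<^sup>+r\<in>{t i<..t (Suc i)}. g r * (ennreal \<bar>F r\<bar> + ennreal (A / 2^n)) \<partial>lborel)"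
      proof (rule nn_integral_mono)
        fix r
        show "ennreal \<bar>F (t i)\<bar> * (g r * indicator {t i<..t (Suc i)} r) \<le>
            g r * (ennreal \<bar>F r\<bar> + ennreal (A / 2^n)) * indicator {t i<..t (Suc i)} r"
        proof (cases "r \<in> {t i<..t (Suc i)}")
          case True
          have "t (Suc i) - t i = 1 / 2^n" by (simp add: t_def diff_divide_distrib[symmetric])
          then have "\<bar>t i - r\<bar> \<le> 1 / 2^n" using True by auto
          then have "A * \<bar>t i - r\<bar> \<le> A * (1 / 2^n)" using A by (rule mult_left_mono)
          then have "\<bar>F (t i) - F r\<bar> \<le> A / 2^n"
            using lipschitz_onD[OF F, of "t i" r] by (simp add: dist_real_def)
          then have "\<bar>F (t i)\<bar> \<le> \<bar>F r\<bar> + A / 2^n" by linarith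
          then have "ennreal \<bar>F (t i)\<bar> \<le> ennreal \<bar>F r\<bar> + ennreal (A / 2^n)"
            using A by (simp add: ennreal_plus[symmetric] ennreal_leI del: ennreal_plus)
          then show ?thesis using True by (simp add: mult.commute[of _ "g r"] mult_left_mono)
        qed simp
      qed
      finally show "ennreal \<bar>F (t i) * (P (t (Suc i)) - P (t i))\<bar> \<le>
          ennreal M * (\<integral>\<^sup>+r\<in>{t i<..t (Suc i)}. g r * (ennreal \<bar>F r\<bar> + ennreal (A / 2^n)) \<partial>lborel)"
        by (simp add: mult_left_mono)
    qed
    also have "\<dots> = ennreal M * (\<integral>\<^sup>+r\<in>{t 0<..t (2^n)}. g r * (ennreal \<bar>F r\<bar> + ennreal (A / 2^n)) \<partial>lborel)"
      using g Fm by (subst sum_distrib_left[symmetric], subst nn_integral_Ioc_sum[OF t]) auto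
    also have "t 0 = 0" by (simp add: t_def)
    also have "t (2^n) = 1" by (simp add: t_def)
    also have "(\<integral>\<^sup>+r\<in>{0<..1}. g r * (ennreal \<bar>F r\<bar> + ennreal (A / 2^n)) \<partial>lborel) =
        (\<integral>\<^sup>+r. g r * ennreal \<bar>F r\<bar> * indicator {0<..1} r + ennreal (A / 2^n) * (g r * indicator {0<..1} r) \<partial>lborel)"
      by (intro nn_integral_cong) (auto simp: distrib_left distrib_right ac_simps)
    also have "\<dots> = I + ennreal (A / 2^n) * ennreal G"
      unfolding I_def G(1)[symmetric] using g Fm by (subst nn_integral_add) (auto simp: nn_integral_cmult)
    also have "ennreal (A / 2^n) * ennreal G = ennreal (A / 2^n * G)"
      using A G by (intro ennreal_mult[symmetric]) auto
    finally show ?thesis .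
  qed
  have "ennreal \<bar>rs_integral F P\<bar> \<le> ennreal M * I + ennreal \<delta>" if \<delta>: "0 < \<delta>" for \<delta>
  proof -
    \<comment> \<open>The sum of two errors of order \<open>1 / 2^n\<close>: the distance of the
      Riemann sum from the integral and the oscillation of \<open>F\<close> weighted by
      \<open>g\<close>.\<close>
    define K where "K = A * (M * L) + M * A * G"
    have lim0: "(\<lambda>n. K / 2^n) \<longlonglongrightarrow> 0"
      by (rule LIMSEQ_divide_realpow_zero) simp
    obtain n where n: "K / 2^n < \<delta>"
      using order_tendstoD(2)[OF lim0 \<delta>] by (auto dest: eventually_happens)
    have "\<bar>rs_integral F P\<bar> \<le> \<bar>rs_sum n F P\<bar> + A * (M * L) / 2^n"
      using rs_integral_error[OF F P, of n] by linarith
    then have "ennreal \<bar>rs_integral F P\<bar> \<le> ennreal \<bar>rs_sum n F P\<bar> + ennreal (A * (M * L) / 2^n)"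
      using A M L by (simp add: ennreal_plus[symmetric] ennreal_leI del: ennreal_plus)
    also have "\<dots> \<le> ennreal M * (I + ennreal (A / 2^n * G)) + ennreal (A * (M * L) / 2^n)"
      by (intro add_right_mono sum)
    also have "\<dots> = ennreal M * I + (ennreal (M * (A / 2^n * G)) + ennreal (A * (M * L) / 2^n))"
      using ennreal_mult[OF M, of "A / 2^n * G"] A G(2) by (simp only: distrib_left add.assoc) simp
    also have "ennreal (M * (A / 2^n * G)) + ennreal (A * (M * L) / 2^n) = ennreal (K / 2^n)"
      using A M L G(2) by (subst ennreal_plus[symmetric]) (auto simp: K_def add_divide_distrib ac_simps)
    also have "\<dots> \<le> ennreal \<delta>" using n by (intro ennreal_leI) simp
    finally show ?thesis by (simp add: add_left_mono)
  qed
  then have "ennreal \<bar>rs_integral F P\<bar> \<le> ennreal M * I" by (rule ennreal_le_epsilon)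
  then show "ennreal \<bar>curve_current \<theta> f p\<bar> \<le> ennreal (lip_const p) * (\<integral>\<^sup>+x. ennreal \<bar>f x\<bar> \<partial>curve_measure \<theta> g)"
    unfolding nn_integral_curve_measure[OF c\<theta> g abs_Lip_b_borel[OF f]]
    by (simp add: curve_current_def F_def P_def I_def M_def)
qed

lemma curve_current_metric_1_current:
  fixes \<theta> :: "real \<Rightarrow> 'a::metric_space"
  assumes \<theta>: "L-lipschitz_on UNIV \<theta>" and mb: "mass_bound (curve_current \<theta>) \<mu>"
  shows "curve_current \<theta> \<in> metric_1_currents"
proof (rule metric_1_currentsI[OF _ mb])
  have c\<theta>: "continuous_on UNIV \<theta>" using \<theta> by (rule lipschitz_on_continuous_on)
  have L: "0 \<le> L" using \<theta> by (rule lipschitz_on_nonneg)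
  note comp = Lip_compose[OF _ \<theta>]
  show "bilinear_functional (curve_current \<theta>)"
    unfolding bilinear_functional_def curve_current_def
    by (auto intro!: rs_integral_linear1 rs_integral_linear2 comp Lip_bD(1))
  show "(\<lambda>j. curve_current \<theta> f (q j)) \<longlonglongrightarrow> curve_current \<theta> f p"
    if f: "f \<in> Lip_b" and p: "p \<in> Lip" and q: "\<And>j. q j \<in> Lip" "\<And>x. (\<lambda>j. q j x) \<longlonglongrightarrow> p x"
      "bdd_above (range (\<lambda>j::nat. lip_const (q j)))" for f p q
  proof -
    obtain B0 where B0: "\<And>j. lip_const (q j) \<le> B0" using q(3) by (auto simp: bdd_above_def)
    \<comment> \<open>The limit \<open>p\<close> is included since
      \<open>rs_integral_tendsto\<close> asks for one constant shared by the sequence and its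
      limit.\<close>
    define B where "B = max B0 (lip_const p)"
    have B: "lip_const (q j) \<le> B" "lip_const p \<le> B" for j
      using B0[of j] by (auto simp: B_def)
    show ?thesis unfolding curve_current_def
      by (rule rs_integral_tendsto[OF comp[OF Lip_bD(1)[OF f]]
            lipschitz_on_mono[OF comp[OF p] subset_refl mult_right_mono[OF B(2) L]]
            lipschitz_on_mono[OF comp[OF q(1)] subset_refl mult_right_mono[OF B(1) L]] q(2)])
  qed
  show "curve_current \<theta> f p = 0"
    if f: "f \<in> Lip_b" and p: "p \<in> Lip" and U: "open U" "closure {x. f x \<noteq> 0} \<subseteq> U" "p constant_on U" for f p U
  proof -
    let ?C = "{0..1} \<inter> \<theta> -` closure {x. f x \<noteq> 0}"
    have "closed (\<theta> -` closure {x. f x \<noteq> 0})"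
      using c\<theta> by (intro closed_vimage) (auto simp: continuous_on_eq_continuous_at)
    then have "compact ?C" by (intro compact_Int_closed) auto
    moreover have "open (\<theta> -` U)" using U(1) c\<theta> by (rule open_vimage)
    moreover have "?C \<subseteq> \<theta> -` U" using U(2) by auto
    ultimately obtain e where e: "e > 0" "(\<Union>x\<in>?C. ball x e) \<subseteq> \<theta> -` U"
      by (rule compact_subset_open_imp_ball_epsilon_subset)
    have lim0: "(\<lambda>n. 1 / 2^n :: real) \<longlonglongrightarrow> 0"
      by (rule LIMSEQ_divide_realpow_zero) simp
    obtain k where k: "\<And>x. x \<in> U \<Longrightarrow> p x = k" using U(3) by (auto simp: constant_on_def)
    have "\<forall>\<^sub>F n in sequentially. 0 = rs_sum n (\<lambda>t. f (\<theta> t)) (\<lambda>t. p (\<theta> t))"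
      using order_tendstoD(2)[OF lim0 e(1)]
    proof eventually_elim
      case (elim n)
      have "f (\<theta> (real i / 2^n)) * (p (\<theta> (real (Suc i) / 2^n)) - p (\<theta> (real i / 2^n))) = 0" if i: "i < 2^n" for i
      proof (cases "f (\<theta> (real i / 2^n)) = 0")
        case False
        have "real i \<le> real (2^n)" using i by (subst of_nat_le_iff) simp
        then have C: "real i / 2^n \<in> ?C"
          using False closure_subset[of "{x. f x \<noteq> 0}"] by auto
        have "dist (real i / 2^n) (real (Suc i) / 2^n) < e"
          using elim by (simp add: dist_real_def diff_divide_distrib[symmetric])
        then have "real (Suc i) / 2^n \<in> (\<Union>x\<in>?C. ball x e)" by (intro UN_I[OF C]) simp
        then have "\<theta> (real (Suc i) / 2^n) \<in> U" using e(2) by blast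
        moreover have "\<theta> (real i / 2^n) \<in> U" using C U(2) by auto
        ultimately show ?thesis by (simp add: k)
      qed simp
      then show ?case unfolding rs_sum_def by (intro sum.neutral[symmetric]) blast
    qed
    then have "(\<lambda>n. rs_sum n (\<lambda>t. f (\<theta> t)) (\<lambda>t. p (\<theta> t))) \<longlonglongrightarrow> 0"
      by (rule Lim_transform_eventually[rotated]) simp
    then show ?thesis
      unfolding curve_current_def
      using rs_sum_tendsto[OF comp[OF Lip_bD(1)[OF f]] comp[OF p]] LIMSEQ_unique by blast
  qed
qed

lemma boundary_curve_current: "boundary (curve_current \<theta>) f = f (\<theta> 1) - f (\<theta> 0)"
  by (simp add: boundary_def curve_current_def rs_integral_one)

section \<open>Metric speed, length and sets of vanishing Hausdorff measure\<close>

lemma Limsup_compose_le: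
  fixes f :: "'b \<Rightarrow> 'c::complete_linorder"
  assumes "filterlim h F G"
  shows "Limsup G (\<lambda>x. f (h x)) \<le> Limsup F f"
  unfolding Limsup_le_iff
proof (intro allI impI)
  fix y assume "Limsup F f < y"
  then have "\<forall>\<^sub>F x in F. f x < y" using Limsup_le_iff[of F f "Limsup F f"] by blast
  then show "\<forall>\<^sub>F x in G. f (h x) < y" using assms by (rule eventually_compose_filterlim)
qed

text \<open>A limsup of a sequence of continuous functions is evidently Borel, and on the interior
  of the parameter interval it is at most the limsup over all \<open>h\<close>, which is the
  inequality needed to bound the mass by the length.\<close>

definition seq_speed :: "(real \<Rightarrow> 'a::metric_space) \<Rightarrow> real \<Rightarrow> ennreal" where
  "seq_speed \<theta> r = limsup (\<lambda>n. ennreal (dist (\<theta> (r + 1 / Suc n)) (\<theta> r) / (1 / Suc n)))"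

lemma
  fixes \<theta> :: "real \<Rightarrow> 'a::metric_space"
  assumes \<theta>: "L-lipschitz_on UNIV \<theta>"
  shows seq_speed_borel: "seq_speed \<theta> \<in> borel_measurable borel"
    and seq_speed_le: "seq_speed \<theta> r \<le> ennreal L"
    and dist_le_seq_speed: "s \<le> t \<Longrightarrow> ennreal (dist (\<theta> s) (\<theta> t)) \<le> (\<integral>\<^sup>+r\<in>{s<..t}. seq_speed \<theta> r \<partial>lborel)"
proof -
  have c\<theta>: "continuous_on UNIV \<theta>" using \<theta> by (rule lipschitz_on_continuous_on)
  have "continuous_on UNIV (\<lambda>r. dist (\<theta> (r + 1 / Suc n)) (\<theta> r) / (1 / Suc n))" for n
    by (intro continuous_intros continuous_on_compose2[OF c\<theta>]) auto
  then have [measurable]: "(\<lambda>r. dist (\<theta> (r + 1 / Suc n)) (\<theta> r) / (1 / Suc n)) \<in> borel_measurable borel" for n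
    by (rule borel_measurable_continuous_onI)
  show "seq_speed \<theta> \<in> borel_measurable borel" unfolding seq_speed_def[abs_def] by measurable
  have "dist (\<theta> (r + 1 / Suc n)) (\<theta> r) / (1 / Suc n) \<le> L" for n r
    using lipschitz_onD[OF \<theta>, of "r + 1 / Suc n" r] by (subst pos_divide_le_eq) (auto simp: dist_real_def)
  then show "seq_speed \<theta> r \<le> ennreal L"
    unfolding seq_speed_def by (intro Limsup_bounded always_eventually allI ennreal_leI)
  assume st: "s \<le> t"
  \<comment> \<open>The distance from the fixed point \<open>\<theta> s\<close> reduces the estimate
    to a real function: its increment from \<open>s\<close> to \<open>t\<close> is the whole
    distance, and its quotients are at most those of the curve.\<close>
  define u where "u = (\<lambda>r. dist (\<theta> s) (\<theta> r))"
  have "L-lipschitz_on UNIV u"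
  proof (rule lipschitz_onI)
    fix x y
    have "dist (u x) (u y) \<le> dist (\<theta> x) (\<theta> y)"
      unfolding u_def dist_real_def using dist_triangle[of "\<theta> s" "\<theta> x" "\<theta> y"] dist_triangle[of "\<theta> s" "\<theta> y" "\<theta> x"]
      by (auto simp: dist_commute abs_le_iff)
    then show "dist (u x) (u y) \<le> L * dist x y" using lipschitz_onD[OF \<theta>, of x y] by simp
  qed (rule lipschitz_on_nonneg[OF \<theta>])
  from increment_le_nn_integral_limsup[OF this st]
  have "ennreal (dist (\<theta> s) (\<theta> t)) \<le>
    (\<integral>\<^sup>+r\<in>{s<..t}. limsup (\<lambda>n. ennreal ((u (r + 1 / Suc n) - u r) / (1 / Suc n))) \<partial>lborel)"
    by (simp add: u_def)
  also have "\<dots> \<le> (\<integral>\<^sup>+r\<in>{s<..t}. seq_speed \<theta> r \<partial>lborel)"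
    unfolding seq_speed_def
  proof (intro nn_integral_mono mult_right_mono Limsup_mono always_eventually allI ennreal_leI divide_right_mono)
    fix r n
    show "u (r + 1 / Suc n) - u r \<le> dist (\<theta> (r + 1 / Suc n)) (\<theta> r)"
      unfolding u_def using dist_triangle[of "\<theta> s" "\<theta> (r + 1 / Suc n)" "\<theta> r"] by (simp add: dist_commute)
  qed auto
  finally show "ennreal (dist (\<theta> s) (\<theta> t)) \<le> (\<integral>\<^sup>+r\<in>{s<..t}. seq_speed \<theta> r \<partial>lborel)" .
qed

text \<open>A cover by sets of small total diameter is turned into a cover of the image by
  intervals. Covers at the single scale \<open>\<delta> = 1\<close> suffice, being bounded by the
  supremum over all scales.\<close>

lemma hausdorff1_null_image:
  fixes A :: "'a::metric_space set" and u :: "'a \<Rightarrow> real"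
  assumes A: "hausdorff1 A = 0" and u: "\<And>x y. \<bar>u x - u y\<bar> \<le> dist x y" and e: "0 < e"
  shows "\<exists>N. open N \<and> u ` A \<subseteq> N \<and> emeasure lborel N \<le> ennreal e"
proof -
  have "hausdorff1_pre 1 A \<le> hausdorff1 A"
    unfolding hausdorff1_def by (rule SUP_upper) simp
  then have "hausdorff1_pre 1 A < ennreal (e/4)" using A e by simp
  then obtain U where U: "A \<subseteq> (\<Union>i. U i)" "\<And>i::nat. bounded (U i)" and sum: "(\<Sum>i. ennreal (diameter (U i))) < ennreal (e/4)"
    unfolding hausdorff1_pre_def INF_less_iff by auto
  define x where "x = (\<lambda>i. SOME x. x \<in> U i)"
  \<comment> \<open>The radius exceeds the diameter even when the latter is 0, so open balls work.
    The additions sum to \<open>e/4\<close>; with the diameters and the factor 2 for the length of a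
    ball this gives \<open>e\<close>. If \<open>U i\<close> is empty, its centre is arbitrary and
    the extra ball does no harm.\<close>
  define w where "w = (\<lambda>i. diameter (U i) + e/4 * (1/2)^Suc i)"
  have w: "0 \<le> w i" "diameter (U i) < w i" for i
    using e diameter_ge_0[OF U(2)] by (auto simp: w_def intro!: add_nonneg_nonneg)
  define N where "N = (\<Union>i. ball (u (x i)) (w i))"
  have "u ` A \<subseteq> N"
  proof (rule image_subsetI)
    fix y assume "y \<in> A"
    then obtain i where i: "y \<in> U i" using U(1) by auto
    then have "x i \<in> U i" unfolding x_def by (rule someI)
    then have "dist (x i) y \<le> diameter (U i)" using i by (intro diameter_bounded_bound U)
    then have "\<bar>u (x i) - u y\<bar> < w i" using u[of "x i" y] w(2)[of i] by linarith
    then show "u y \<in> N" by (auto simp: N_def dist_real_def)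
  qed
  moreover have "emeasure lborel N \<le> ennreal e"
  proof -
    have b: "emeasure lborel (ball (u (x i)) (w i)) = ennreal 2 * (ennreal (diameter (U i)) + ennreal (e/4 * (1/2)^Suc i))" for i
    proof -
      have "emeasure lborel (ball (u (x i)) (w i)) = ennreal (2 * w i)"
        using w(1)[of i] by (simp add: ball_eq_greaterThanLessThan)
      also have "\<dots> = ennreal 2 * ennreal (w i)" using w(1)[of i] by (simp add: ennreal_mult)
      also have "ennreal (w i) = ennreal (diameter (U i)) + ennreal (e/4 * (1/2)^Suc i)"
        unfolding w_def using e diameter_ge_0[OF U(2)] by (intro ennreal_plus) auto
      finally show ?thesis .
    qed
    have geo: "(\<Sum>i. ennreal (e/4 * (1/2)^Suc i)) = ennreal (e/4)"
      using e sums_mult[OF power_half_series, of "e/4"] by (intro suminf_ennreal_eq) auto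
    have "emeasure lborel N \<le> (\<Sum>i. emeasure lborel (ball (u (x i)) (w i)))"
      unfolding N_def by (intro emeasure_subadditive_countably) auto
    also have "\<dots> = ennreal 2 * ((\<Sum>i. ennreal (diameter (U i))) + ennreal (e/4))"
      unfolding b ennreal_suminf_cmult geo[symmetric] by (subst suminf_add) auto
    also have "\<dots> \<le> ennreal 2 * (ennreal (e/4) + ennreal (e/4))"
      using sum by (intro mult_left_mono add_right_mono) auto
    also have "\<dots> = ennreal e"
    proof -
      have "ennreal (e/4) + ennreal (e/4) = ennreal (e/4 + e/4)"
        using e by (intro ennreal_plus[symmetric]) auto
      moreover have "ennreal 2 * ennreal (e/4 + e/4) = ennreal (2 * (e/4 + e/4))"
        using e by (intro ennreal_mult[symmetric]) auto
      ultimately show ?thesis by (simp only:) simp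
    qed
    finally show ?thesis .
  qed
  ultimately show ?thesis by (intro exI[of _ N]) (auto simp: N_def)
qed

text \<open>
  Collapsing a small open neighbourhood of the null set \<open>dist (\<theta> s) ` A\<close> of the line makes the
  distance function locally constant in time on \<open>\<theta> -` A\<close> and changes it by at most \<open>e\<close>.
\<close>

lemma dist_le_outside_null:
  fixes \<theta> :: "real \<Rightarrow> 'a::metric_space"
  assumes \<theta>: "L-lipschitz_on UNIV \<theta>" and A: "hausdorff1 A = 0" and st: "s \<le> t"
  shows "ennreal (dist (\<theta> s) (\<theta> t)) \<le> (\<integral>\<^sup>+r\<in>{s<..t}. ennreal L * indicator (- A) (\<theta> r) \<partial>lborel)"
proof (rule ennreal_le_epsilon)
  fix e :: real assume e: "0 < e"
  have L: "0 \<le> L" using \<theta> by (rule lipschitz_on_nonneg)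
  have c\<theta>: "continuous_on UNIV \<theta>" using \<theta> by (rule lipschitz_on_continuous_on)
  have d1: "\<bar>dist (\<theta> s) x - dist (\<theta> s) y\<bar> \<le> dist x y" for x y
    using dist_triangle[of "\<theta> s" x y] dist_triangle[of "\<theta> s" y x] by (auto simp: dist_commute abs_le_iff)
  obtain N where N: "open N" "dist (\<theta> s) ` A \<subseteq> N" "emeasure lborel N \<le> ennreal e"
    using hausdorff1_null_image[OF A d1 e] by blast
  have Nb: "N \<in> sets lborel" using N(1) by simp
  have Nfin: "emeasure lborel N \<noteq> \<infinity>" using N(3) by (auto simp: top_unique)
  define m where "m = (\<lambda>a b. measure lborel (N \<inter> {a<..b}))"
  have fin: "emeasure lborel (N \<inter> X) \<noteq> \<infinity>" for X
    using emeasure_mono[of "N \<inter> X" N lborel] Nb Nfin by (auto simp: top_unique)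
  have m0: "0 \<le> m a b" for a b by (simp add: m_def)
  have m_le: "m a b \<le> b - a" if "a \<le> b" for a b
  proof -
    have "m a b \<le> measure lborel {a<..b}"
      unfolding m_def using that Nb by (intro measure_mono_fmeasurable) (auto simp: fmeasurable_def)
    then show ?thesis using that by simp
  qed
  have m_e: "m a b \<le> e" for a b
  proof -
    have "m a b \<le> measure lborel N"
      unfolding m_def using Nb Nfin by (intro measure_mono_fmeasurable) (auto simp: fmeasurable_def less_top)
    also have "\<dots> \<le> e" using N(3) e by (simp add: measure_def enn2real_leI)
    finally show ?thesis .
  qed
  have m_add: "m a c = m a b + m b c" if "a \<le> b" "b \<le> c" for a b c
  proof -
    have "N \<inter> {a<..c} = (N \<inter> {a<..b}) \<union> (N \<inter> {b<..c})" using that by auto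
    moreover have "measure lborel ((N \<inter> {a<..b}) \<union> (N \<inter> {b<..c})) = m a b + m b c"
      unfolding m_def using Nb that by (intro measure_Union fin) auto
    ultimately show ?thesis by (simp add: m_def)
  qed
  \<comment> \<open>The collapsing map: it removes the length of \<open>N\<close> between 0 and
    \<open>y\<close>. On the half-line from 0, which contains all distances, it is 1-Lipschitz,
    constant across intervals inside \<open>N\<close>, and shortens increments by at most
    \<open>e\<close>.\<close>
  define F where "F = (\<lambda>y. y - m 0 y)"
  have F_diff: "F b - F a = b - a - m a b" if "0 \<le> a" "a \<le> b" for a b
    using m_add[OF that] by (simp add: F_def)
  have F_lip': "\<bar>F a - F b\<bar> \<le> \<bar>a - b\<bar>" if "0 \<le> a" "a \<le> b" for a b
    using F_diff[OF that] m0[of a b] m_le[OF that(2)] that by linarith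
  have F_lip: "\<bar>F a - F b\<bar> \<le> \<bar>a - b\<bar>" if "0 \<le> a" "0 \<le> b" for a b
    using F_lip'[of a b] F_lip'[of b a] that by (cases "a \<le> b") (auto simp: abs_minus_commute)
  have F_eq': "F a = F b" if "0 \<le> a" "a \<le> b" "{a<..b} \<subseteq> N" for a b
  proof -
    have "N \<inter> {a<..b} = {a<..b}" using that by auto
    then have "m a b = b - a" unfolding m_def using that by simp
    then show ?thesis using F_diff[OF that(1,2)] by simp
  qed
  define u where "u = (\<lambda>r. dist (\<theta> s) (\<theta> r))"
  have u0: "0 \<le> u r" for r by (simp add: u_def)
  define z where "z = (\<lambda>r. F (u r))"
  have ulip: "\<bar>u x - u y\<bar> \<le> L * \<bar>x - y\<bar>" for x y
    using d1[of "\<theta> x" "\<theta> y"] lipschitz_onD[OF \<theta>, of x y] by (simp add: u_def dist_real_def)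
  have zlip: "L-lipschitz_on UNIV z"
    using order_trans[OF F_lip[OF u0 u0] ulip] L unfolding z_def
    by (intro lipschitz_onI) (auto simp: dist_real_def)
  \<comment> \<open>Here \<open>u s = 0\<close>, so the increment of \<open>u\<close> is the
    distance itself, of which collapsing loses at most \<open>e\<close>.\<close>
  have "dist (\<theta> s) (\<theta> t) - e \<le> z t - z s"
    using F_diff[of "u s" "u t"] u0[of t] m_e[of "u s" "u t"] by (simp add: z_def u_def)
  then have "ennreal (dist (\<theta> s) (\<theta> t)) \<le> ennreal (z t - z s) + ennreal e"
    using e by (cases "0 \<le> z t - z s") (auto simp: ennreal_plus[symmetric] ennreal_neg intro!: ennreal_leI simp del: ennreal_plus)
  also have "ennreal (z t - z s) \<le>
    (\<integral>\<^sup>+r\<in>{s<..t}. limsup (\<lambda>n. ennreal ((z (r + 1 / Suc n) - z r) / (1 / Suc n))) \<partial>lborel)"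
    by (rule increment_le_nn_integral_limsup[OF zlip st])
  also have "\<dots> \<le> (\<integral>\<^sup>+r\<in>{s<..t}. ennreal L * indicator (- A) (\<theta> r) \<partial>lborel)"
  proof (intro nn_integral_mono mult_right_mono)
    fix r
    show "limsup (\<lambda>n. ennreal ((z (r + 1 / Suc n) - z r) / (1 / Suc n))) \<le> ennreal L * indicator (- A) (\<theta> r)"
    proof (cases "\<theta> r \<in> A")
      case False
      have "(z (r + 1 / Suc n) - z r) / (1 / Suc n) \<le> L" for n
        using lipschitz_onD[OF zlip, of "r + 1 / Suc n" r] by (subst pos_divide_le_eq) (auto simp: dist_real_def)
      then show ?thesis using False by (auto intro!: Limsup_bounded always_eventually ennreal_leI)
    next
      \<comment> \<open>The distance at time \<open>r\<close> lies in the open set \<open>N\<close>,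
        and by continuity so do the distances just after \<open>r\<close>. Hence \<open>z\<close>
        does not change there, and the quotients are eventually 0.\<close>
      case True
      then have "u r \<in> N" using N(2) by (auto simp: u_def)
      then obtain d where d: "d > 0" "ball (u r) d \<subseteq> N" using N(1) open_contains_ball by blast
      have cu: "isCont u r"
        unfolding u_def using c\<theta> by (intro continuous_intros) (simp add: continuous_on_eq_continuous_at)
      have "(\<lambda>n. r + 1 / real (Suc n)) \<longlonglongrightarrow> r + 0"
        by (intro tendsto_intros LIMSEQ_inverse_real_of_nat[unfolded inverse_eq_divide])
      then have "(\<lambda>n. u (r + 1 / real (Suc n))) \<longlonglongrightarrow> u r"
        using isCont_tendsto_compose[OF cu] by simp
      then have "\<forall>\<^sub>F n in sequentially. dist (u (r + 1 / Suc n)) (u r) < d" using d(1) by (rule tendstoD)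
      then have "\<forall>\<^sub>F n in sequentially. ennreal ((z (r + 1 / Suc n) - z r) / (1 / Suc n)) = 0"
      proof eventually_elim
        case (elim n)
        let ?v = "u (r + 1 / Suc n)"
        have "{u r<..?v} \<subseteq> ball (u r) d" "{?v<..u r} \<subseteq> ball (u r) d"
          using elim by (auto simp: dist_real_def)
        then have "{u r<..?v} \<subseteq> N" "{?v<..u r} \<subseteq> N" using d(2) by (blast intro: subset_trans)+
        then have "F (u r) = F ?v"
          using F_eq'[OF u0, of r ?v] F_eq'[OF u0, of _ "u r"] by (metis linear)
        then show ?case by (simp add: z_def)
      qed
      then show ?thesis using True by (subst Limsup_eq) (auto simp: Limsup_const)
    qed
  qed auto
  finally show "ennreal (dist (\<theta> s) (\<theta> t)) \<le>
      (\<integral>\<^sup>+r\<in>{s<..t}. ennreal L * indicator (- A) (\<theta> r) \<partial>lborel) + ennreal e"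
    by (simp add: add_right_mono)
qed

text \<open>For \<open>r < 1\<close> the points \<open>r + 1 / Suc n\<close> eventually lie in the
  unit interval, where both curves agree; the sequence \<open>1 / Suc n\<close> then picks out part
  of the limsup over \<open>h\<close>.\<close>

lemma seq_speed_le_metric_speed:
  assumes eq: "\<And>t. 0 \<le> t \<Longrightarrow> t \<le> 1 \<Longrightarrow> \<theta>' t = \<theta> t" and r: "0 \<le> r" "r < 1"
  shows "seq_speed \<theta>' r \<le> metric_speed \<theta> r"
proof -
  have "(\<lambda>n. 1 / real (Suc n)) \<longlonglongrightarrow> 0"
    by (rule LIMSEQ_inverse_real_of_nat[unfolded inverse_eq_divide])
  then have lim: "filterlim (\<lambda>n. 1 / real (Suc n)) (at_right 0) sequentially"
    by (subst filterlim_at) (auto intro!: always_eventually)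
  have "\<forall>\<^sub>F n in sequentially. 1 / real (Suc n) < 1 - r"
    using r by (intro order_tendstoD(2)[OF LIMSEQ_inverse_real_of_nat[unfolded inverse_eq_divide]]) simp
  then have "\<forall>\<^sub>F n in sequentially. ennreal (dist (\<theta>' (r + 1 / Suc n)) (\<theta>' r) / (1 / Suc n)) =
      ennreal (dist (\<theta> (r + 1 / Suc n)) (\<theta> r) / (1 / Suc n))"
    by eventually_elim (use r in \<open>simp add: eq\<close>)
  then have "seq_speed \<theta>' r = limsup (\<lambda>n. ennreal (dist (\<theta> (r + 1 / Suc n)) (\<theta> r) / (1 / Suc n)))"
    unfolding seq_speed_def by (rule Limsup_eq)
  also have "\<dots> \<le> metric_speed \<theta> r"
    unfolding metric_speed_def
    using Limsup_compose_le[OF lim, of "\<lambda>h. ennreal (dist (\<theta> (r + h)) (\<theta> r) / h)"] .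
  finally show ?thesis .
qed

lemma rectifiable_curve:
  fixes \<theta> :: "real \<Rightarrow> 'a::metric_space"
  assumes \<theta>: "L-lipschitz_on {0..1} \<theta>"
  shows "\<exists>R\<in>rectifiable_1_currents. (\<forall>f. boundary R f = f (\<theta> 1) - f (\<theta> 0)) \<and> ennreal (mass R) \<le> curve_length \<theta>"
proof -
  \<comment> \<open>Continuation by the end values keeps the Lipschitz constant and makes the curve
    available at all shifted times.\<close>
  define \<theta>' where "\<theta>' = (\<lambda>t. \<theta> (max 0 (min 1 t)))"
  have L: "0 \<le> L" using \<theta> by (rule lipschitz_on_nonneg)
  have \<theta>': "L-lipschitz_on UNIV \<theta>'"
  proof (rule lipschitz_onI)
    fix x y :: real
    have "dist (\<theta>' x) (\<theta>' y) \<le> L * dist (max 0 (min 1 x)) (max 0 (min 1 y))"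
      unfolding \<theta>'_def by (intro lipschitz_onD[OF \<theta>]) auto
    also have "\<dots> \<le> L * dist x y"
      using L by (intro mult_left_mono) (auto simp: dist_real_def)
    finally show "dist (\<theta>' x) (\<theta>' y) \<le> L * dist x y" .
  qed (rule L)
  have eq: "\<theta>' t = \<theta> t" if "0 \<le> t" "t \<le> 1" for t using that by (simp add: \<theta>'_def)
  have c\<theta>: "continuous_on UNIV \<theta>'" using \<theta>' by (rule lipschitz_on_continuous_on)
  let ?R = "curve_current \<theta>'"
  note speed = seq_speed_borel[OF \<theta>'] seq_speed_le[OF \<theta>'] dist_le_seq_speed[OF \<theta>']
  let ?\<mu> = "curve_measure \<theta>' (seq_speed \<theta>')"
  have "(\<integral>\<^sup>+r\<in>{0<..1}. seq_speed \<theta>' r \<partial>lborel) \<le> (\<integral>\<^sup>+r\<in>{0<..1::real}. ennreal L \<partial>lborel)"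
    by (intro nn_integral_mono) (auto simp: indicator_def speed(2))
  also have "\<dots> < \<infinity>" by (simp add: nn_integral_cmult)
  finally have mb: "mass_bound ?R ?\<mu>"
    by (intro mass_bound_curve_current[OF \<theta>' speed(1)] speed(3)) auto
  have cur: "?R \<in> metric_1_currents" by (rule curve_current_metric_1_current[OF \<theta>' mb])
  note bil = metric_1_currentsD(1)[OF cur]
  have "compact (\<theta>' ` {0..1})"
    using c\<theta> continuous_on_subset by (intro compact_continuous_image) blast+
  then have S: "- \<theta>' ` {0..1} \<in> sets borel"
    by (intro borel_comp borel_closed compact_imp_closed)
  have "emeasure ?\<mu> (- \<theta>' ` {0..1}) = (\<integral>\<^sup>+r. 0 \<partial>(lborel :: real measure))"
    unfolding emeasure_curve_measure[OF c\<theta> speed(1) S]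
    by (intro nn_integral_cong) (auto simp: indicator_def)
  then have "- \<theta>' ` {0..1} \<in> null_sets ?\<mu>" using S by (intro null_setsI) auto
  then have "AE x in ?\<mu>. x \<in> \<theta>' ` {0..1}" by (intro AE_I'[of "- \<theta>' ` {0..1}"]) auto
  then have conc: "AE x in mass_measure ?R. x \<in> \<theta>' ` {0..1}" by (rule AE_mass_measure[OF bil mb])
  have null: "emeasure (mass_measure ?R) A = 0" if A: "A \<in> sets borel" "hausdorff1 A = 0" for A
  proof -
    \<comment> \<open>Another weight for the same current: it vanishes at all times spent in
      \<open>A\<close>, so its image measure does not charge \<open>A\<close>, and the mass measure
      lies below that image measure.\<close>
    define g where "g = (\<lambda>r. ennreal L * indicator (- A) (\<theta>' r))"
    have [measurable]: "\<theta>' \<in> borel_measurable borel" using c\<theta> by (rule borel_measurable_continuous_onI)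
    have g: "g \<in> borel_measurable borel" unfolding g_def using A(1) by measurable
    have "(\<integral>\<^sup>+r\<in>{0<..1}. g r \<partial>lborel) \<le> (\<integral>\<^sup>+r\<in>{0<..1::real}. ennreal L \<partial>lborel)"
      unfolding g_def by (intro nn_integral_mono mult_right_mono) (auto simp: indicator_def)
    also have "\<dots> < \<infinity>" by (simp add: nn_integral_cmult)
    finally have "mass_bound ?R (curve_measure \<theta>' g)"
      unfolding g_def by (intro mass_bound_curve_current[OF \<theta>' g[unfolded g_def]] dist_le_outside_null[OF \<theta>' A(2)]) auto
    from emeasure_mass_measure_le[OF bil this A(1)]
    have "emeasure (mass_measure ?R) A \<le> (\<integral>\<^sup>+r\<in>{0<..1}. g r * indicator A (\<theta>' r) \<partial>lborel)"
      unfolding emeasure_curve_measure[OF c\<theta> g A(1)] .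
    also have "\<dots> = (\<integral>\<^sup>+r. 0 \<partial>(lborel :: real measure))"
      by (intro nn_integral_cong) (auto simp: g_def indicator_def)
    finally show ?thesis by simp
  qed
  have rect: "?R \<in> rectifiable_1_currents"
    unfolding rectifiable_1_currents_iff
    using rectifiable_set_image[OF _ lipschitz_on_subset[OF \<theta>' subset_UNIV], of "{0..1}"]
    by (intro conjI exI[of _ "\<theta>' ` {0..1}"] ballI impI cur conc null) auto
  have "ennreal (mass ?R) \<le> emeasure ?\<mu> UNIV"
    using emeasure_mass_measure_le[OF bil mb, of UNIV] by (simp add: current_mass_measure[OF cur])
  also have "\<dots> = (\<integral>\<^sup>+r\<in>{0<..1}. seq_speed \<theta>' r \<partial>lborel)"
    by (simp add: emeasure_curve_measure[OF c\<theta> speed(1)])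
  also have "\<dots> \<le> curve_length \<theta>"
    unfolding curve_length_def
  proof (rule nn_integral_mono_AE)
    \<comment> \<open>The time 1 is discarded, because \<open>metric_speed\<close> there sees values
      of \<open>\<theta>\<close> beyond the unit interval, which the continuation has
      replaced.\<close>
    show "AE r in lborel. seq_speed \<theta>' r * indicator {0<..1} r \<le> metric_speed \<theta> r * indicator {0..1} r"
      using AE_lborel_singleton[of 1]
      by eventually_elim (auto simp: indicator_def intro!: seq_speed_le_metric_speed eq)
  qed
  finally show ?thesis using rect by (intro bexI[of _ ?R]) (auto simp: boundary_curve_current eq)
qed

section \<open>Linear functionals below a maximum of sublinear ones\<close>

text \<open>
  One-parameter minimax: every \<open>f\<close> restricts \<open>\<lambda>\<close> to a subinterval of \<open>{0..1}\<close>, and two of these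
  intervals intersect because of the positive combination of \<open>f\<close> and \<open>g\<close> on which \<open>A\<close> and \<open>B\<close>
  are bounded by the same number.
\<close>

lemma le_max_imp_le_convex_comb:
  fixes V :: "('x \<Rightarrow> real) set" and \<phi> A B :: "('x \<Rightarrow> real) \<Rightarrow> real"
  assumes V: "\<And>f g s t. f \<in> V \<Longrightarrow> g \<in> V \<Longrightarrow> 0 \<le> s \<Longrightarrow> 0 \<le> t \<Longrightarrow> (\<lambda>x. s * f x + t * g x) \<in> V"
    and \<phi>: "\<And>f g s t. f \<in> V \<Longrightarrow> g \<in> V \<Longrightarrow> 0 \<le> s \<Longrightarrow> 0 \<le> t \<Longrightarrow> \<phi> (\<lambda>x. s * f x + t * g x) = s * \<phi> f + t * \<phi> g"
    and A: "\<And>f g s t. f \<in> V \<Longrightarrow> g \<in> V \<Longrightarrow> 0 \<le> s \<Longrightarrow> 0 \<le> t \<Longrightarrow> A (\<lambda>x. s * f x + t * g x) \<le> s * A f + t * A g"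
    and B: "\<And>f g s t. f \<in> V \<Longrightarrow> g \<in> V \<Longrightarrow> 0 \<le> s \<Longrightarrow> 0 \<le> t \<Longrightarrow> B (\<lambda>x. s * f x + t * g x) \<le> s * B f + t * B g"
    and le: "\<And>f. f \<in> V \<Longrightarrow> \<phi> f \<le> max (A f) (B f)"
  shows "\<exists>l. 0 \<le> l \<and> l \<le> 1 \<and> (\<forall>f\<in>V. \<phi> f \<le> l * A f + (1 - l) * B f)"
proof -
  define D where "D = (\<lambda>f. A f - B f)"
  \<comment> \<open>The requirement on \<open>l\<close> reads
    \<open>\<phi> f - B f \<le> l * D f\<close>. Thus \<open>q f\<close> is a lower bound for
    \<open>l\<close> when \<open>D f > 0\<close> and an upper bound when
    \<open>D f < 0\<close>.\<close>
  define q where "q = (\<lambda>f. (\<phi> f - B f) / D f)"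
  \<comment> \<open>The element 0 keeps the supremum nonnegative, also when no \<open>f\<close> has
    \<open>D f > 0\<close>.\<close>
  define Q where "Q = insert 0 (q ` {f \<in> V. D f > 0})"
  have q1: "q f \<le> 1" if "f \<in> V" "D f > 0" for f
    using le[OF that(1)] that(2) by (simp add: q_def D_def pos_divide_le_eq)
  have q0: "0 \<le> q g" if "g \<in> V" "D g < 0" for g
    using le[OF that(1)] that(2) by (simp add: q_def D_def neg_le_divide_eq)
  have qq: "q f \<le> q g" if f: "f \<in> V" "D f > 0" and g: "g \<in> V" "D g < 0" for f g
  proof -
    \<comment> \<open>With these weights \<open>s * D f + t * D g = 0\<close>, so the bounds by
      \<open>A\<close> and \<open>B\<close> on the combination coincide and the maximum
      disappears.\<close>
    define s where "s = - D g"
    define t where "t = D f"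
    have st: "0 < s" "0 < t" using f g by (auto simp: s_def t_def)
    let ?h = "\<lambda>x. s * f x + t * g x"
    have eq: "s * A f + t * A g = s * B f + t * B g" by (simp add: s_def t_def D_def algebra_simps)
    have "s * \<phi> f + t * \<phi> g = \<phi> ?h" using \<phi>[OF f(1) g(1)] st by simp
    also have "\<dots> \<le> max (A ?h) (B ?h)" using V[OF f(1) g(1)] st by (intro le) simp
    also have "\<dots> \<le> s * B f + t * B g"
      using A[OF f(1) g(1), of s t] B[OF f(1) g(1), of s t] st eq by simp
    finally have "s * (\<phi> f - B f) \<le> t * (B g - \<phi> g)" by (simp add: algebra_simps)
    then have "(\<phi> f - B f) / t \<le> (B g - \<phi> g) / s" using st by (simp add: field_simps)
    then show ?thesis by (simp add: q_def s_def t_def minus_divide_left)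
  qed
  have bdd: "bdd_above Q" unfolding Q_def using q1 by (intro bdd_aboveI[of _ 1]) auto
  define l where "l = Sup Q"
  have "0 \<le> l" unfolding l_def using bdd by (intro cSup_upper) (auto simp: Q_def)
  moreover have "l \<le> 1" unfolding l_def using q1 by (intro cSup_least) (auto simp: Q_def)
  moreover have "\<phi> f \<le> l * A f + (1 - l) * B f" if f: "f \<in> V" for f
  proof -
    have "\<phi> f - B f \<le> l * D f"
    proof (cases "D f" "0::real" rule: linorder_cases)
      case equal
      then show ?thesis using le[OF f] by (simp add: D_def)
    next
      case greater
      then have "q f \<le> l" unfolding l_def using bdd f by (intro cSup_upper) (auto simp: Q_def)
      then show ?thesis using greater by (simp add: q_def pos_divide_le_eq)
    next
      case less
      then have "l \<le> q f" unfolding l_def using f q0 qq by (intro cSup_least) (auto simp: Q_def)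
      then show ?thesis using less by (simp add: q_def neg_le_divide_eq)
    qed
    then show ?thesis by (simp add: D_def algebra_simps)
  qed
  ultimately show ?thesis by blast
qed

text \<open>By induction: the two-function case is applied to \<open>A j\<close> and to the maximum
  \<open>B\<close> over the remaining indices. The weight found there is then absorbed into the
  family \<open>l * A j f + (1 - l) * A i f\<close>, which is again sublinear and satisfies the
  hypothesis at an index where \<open>B\<close> is attained.\<close>

lemma le_Max_imp_le_convex_comb:
  fixes V :: "('x \<Rightarrow> real) set" and \<phi> :: "('x \<Rightarrow> real) \<Rightarrow> real" and A :: "'i \<Rightarrow> ('x \<Rightarrow> real) \<Rightarrow> real"
  assumes I: "finite I" "I \<noteq> {}"
    and V: "\<And>f g s t. f \<in> V \<Longrightarrow> g \<in> V \<Longrightarrow> 0 \<le> s \<Longrightarrow> 0 \<le> t \<Longrightarrow> (\<lambda>x. s * f x + t * g x) \<in> V"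
    and \<phi>: "\<And>f g s t. f \<in> V \<Longrightarrow> g \<in> V \<Longrightarrow> 0 \<le> s \<Longrightarrow> 0 \<le> t \<Longrightarrow> \<phi> (\<lambda>x. s * f x + t * g x) = s * \<phi> f + t * \<phi> g"
    and A: "\<And>i f g s t. i \<in> I \<Longrightarrow> f \<in> V \<Longrightarrow> g \<in> V \<Longrightarrow> 0 \<le> s \<Longrightarrow> 0 \<le> t \<Longrightarrow>
      A i (\<lambda>x. s * f x + t * g x) \<le> s * A i f + t * A i g"
    and le: "\<And>f. f \<in> V \<Longrightarrow> \<exists>i\<in>I. \<phi> f \<le> A i f"
  shows "\<exists>l. (\<forall>i\<in>I. 0 \<le> l i) \<and> sum l I = 1 \<and> (\<forall>f\<in>V. \<phi> f \<le> (\<Sum>i\<in>I. l i * A i f))"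
  using I A le
proof (induction I arbitrary: A rule: finite_ne_induct)
  case (singleton i)
  then show ?case by (intro exI[of _ "\<lambda>_. 1"]) auto
next
  case (insert j I)
  define B where "B = (\<lambda>f. Max ((\<lambda>i. A i f) ` I))"
  have B_ge: "A i f \<le> B f" if "i \<in> I" for i f
    unfolding B_def using that insert(1) by (intro Max_ge) auto
  have "\<exists>l. 0 \<le> l \<and> l \<le> 1 \<and> (\<forall>f\<in>V. \<phi> f \<le> l * A j f + (1 - l) * B f)"
  proof (rule le_max_imp_le_convex_comb[where V=V and \<phi>=\<phi> and A="A j" and B=B])
    fix f g s t assume *: "f \<in> V" "g \<in> V" "(0::real) \<le> s" "(0::real) \<le> t"
    have "A i (\<lambda>x. s * f x + t * g x) \<le> s * B f + t * B g" if "i \<in> I" for i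
      using insert.prems(1)[OF _ *, of i] that mult_left_mono[OF B_ge[OF that, of f] *(3)] mult_left_mono[OF B_ge[OF that, of g] *(4)]
      by force
    then show "B (\<lambda>x. s * f x + t * g x) \<le> s * B f + t * B g"
      using insert(1,2) by (subst (1) B_def, subst Max_le_iff) auto
  next
    fix f assume "f \<in> V"
    then show "\<phi> f \<le> max (A j f) (B f)"
      using insert.prems(2)[of f] by (auto simp: le_max_iff_disj intro: order_trans[OF _ B_ge])
  qed (use V \<phi> insert.prems(1) in auto)
  then obtain l where l: "0 \<le> l" "l \<le> 1" "\<And>f. f \<in> V \<Longrightarrow> \<phi> f \<le> l * A j f + (1 - l) * B f" by blast
  have "\<exists>k. (\<forall>i\<in>I. 0 \<le> k i) \<and> sum k I = 1 \<and> (\<forall>f\<in>V. \<phi> f \<le> (\<Sum>i\<in>I. k i * (l * A j f + (1 - l) * A i f)))"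
  proof (rule insert.IH)
    fix i f g s t assume i: "i \<in> I" and *: "f \<in> V" "g \<in> V" "(0::real) \<le> s" "(0::real) \<le> t"
    have "l * A j (\<lambda>x. s * f x + t * g x) \<le> l * (s * A j f + t * A j g)"
      using insert.prems(1)[OF _ *, of j] l by (intro mult_left_mono) auto
    moreover have "(1 - l) * A i (\<lambda>x. s * f x + t * g x) \<le> (1 - l) * (s * A i f + t * A i g)"
      using insert.prems(1)[OF _ *, of i] i l by (intro mult_left_mono) auto
    ultimately show "l * A j (\<lambda>x. s * f x + t * g x) + (1 - l) * A i (\<lambda>x. s * f x + t * g x) \<le>
        s * (l * A j f + (1 - l) * A i f) + t * (l * A j g + (1 - l) * A i g)"
      by (simp add: algebra_simps)
  next
    fix f assume f: "f \<in> V"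
    have "B f \<in> (\<lambda>i. A i f) ` I" unfolding B_def using insert(1,2) by (intro Max_in) auto
    then show "\<exists>i\<in>I. \<phi> f \<le> l * A j f + (1 - l) * A i f" using l(3)[OF f] by auto
  qed
  then obtain k where k: "\<And>i. i \<in> I \<Longrightarrow> 0 \<le> k i" "sum k I = 1"
    "\<And>f. f \<in> V \<Longrightarrow> \<phi> f \<le> (\<Sum>i\<in>I. k i * (l * A j f + (1 - l) * A i f))" by blast
  define m where "m = (\<lambda>i. if i = j then l else (1 - l) * k i)"
  have mI: "(\<Sum>i\<in>I. m i * h i) = (1 - l) * (\<Sum>i\<in>I. k i * h i)" for h
    unfolding sum_distrib_left using insert(3) by (intro sum.cong) (auto simp: m_def)
  have mj: "m j = l" by (simp add: m_def)
  have "sum m (insert j I) = 1"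
    using mI[of "\<lambda>_. 1"] insert(1,3) k(2) mj by simp
  moreover have "\<phi> f \<le> (\<Sum>i\<in>insert j I. m i * A i f)" if "f \<in> V" for f
  proof -
    have "(\<Sum>i\<in>I. k i * (l * A j f + (1 - l) * A i f)) = (\<Sum>i\<in>I. k i) * (l * A j f) + (1 - l) * (\<Sum>i\<in>I. k i * A i f)"
      unfolding sum_distrib_left sum_distrib_right sum.distrib[symmetric]
      by (intro sum.cong) (auto simp: algebra_simps)
    also have "\<dots> = (\<Sum>i\<in>insert j I. m i * A i f)"
      using insert(1,3) k(2) by (simp add: mI mj)
    finally show ?thesis using k(3)[OF that] by simp
  qed
  moreover have "\<forall>i\<in>insert j I. 0 \<le> m i" using k(1) l by (auto simp: m_def)
  ultimately show ?case by blast
qed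

section \<open>The boundary as a limit of molecules\<close>

lemma lipschitz_extension_finite:
  fixes f :: "'a::metric_space \<Rightarrow> real"
  assumes F: "finite F" "F \<noteq> {}" and L: "0 \<le> L"
    and f: "\<And>x y. x \<in> F \<Longrightarrow> y \<in> F \<Longrightarrow> f x - f y \<le> L * dist x y"
  shows "\<exists>g. L-lipschitz_on UNIV g \<and> (\<forall>x\<in>F. g x = f x)"
proof -
  \<comment> \<open>McShane's formula: the smallest of the cones of slope \<open>L\<close> over the
    given values.\<close>
  define g where "g = (\<lambda>z. Min ((\<lambda>x. f x + L * dist x z) ` F))"
  have g_le: "g z \<le> f x + L * dist x z" if "x \<in> F" for x z
    unfolding g_def using F that by (intro Min_le) auto
  have g_in: "\<exists>x\<in>F. g z = f x + L * dist x z" for z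
  proof -
    have "g z \<in> (\<lambda>x. f x + L * dist x z) ` F" unfolding g_def using F by (intro Min_in) auto
    then show ?thesis by blast
  qed
  have *: "g z \<le> g w + L * dist z w" for z w
  proof -
    obtain x where x: "x \<in> F" "g w = f x + L * dist x w" using g_in by blast
    have "L * dist x z \<le> L * (dist x w + dist z w)"
      using dist_triangle[of x z w] L by (intro mult_left_mono) (auto simp: dist_commute)
    then show ?thesis using g_le[OF x(1), of z] x(2) by (simp add: algebra_simps)
  qed
  have "L-lipschitz_on UNIV g"
  proof (rule lipschitz_onI)
    show "dist (g z) (g w) \<le> L * dist z w" for z w
      using *[of z w] *[of w z] by (simp add: dist_real_def dist_commute abs_le_iff)
  qed (rule L)
  moreover have "g x = f x" if "x \<in> F" for x
  proof (rule antisym)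
    show "g x \<le> f x" using g_le[OF that, of x] by simp
    obtain y where "y \<in> F" "g x = f y + L * dist y x" using g_in by blast
    then show "f x \<le> g x" using f[OF that, of y] by (simp add: dist_commute)
  qed
  ultimately show ?thesis by blast
qed

section \<open>The boundary functional and its dual norm\<close>

lemma boundary_lincomb:
  assumes "T \<in> metric_1_currents" "f \<in> Lip" "g \<in> Lip"
  shows "boundary T (\<lambda>x. a * f x + b * g x) = a * boundary T f + b * boundary T g"
  unfolding boundary_def
  by (rule bilinear_functionalD(2)[OF metric_1_currentsD(1)[OF assms(1)] Lip_b_const assms(2,3)])

lemma boundary_zero:
  assumes "T \<in> metric_1_currents" shows "boundary T (\<lambda>_. 0) = 0"
  using boundary_abs_le[OF assms Lip_const, of 0] by (simp add: lip_const_const)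

lemma Lip_1_zero: "(\<lambda>_. 0) \<in> Lip_1"
  by (simp add: Lip_1_def Lip_const lip_const_const)

text \<open>The vanishing second summand gives the function the shape of a linear combination, so
  that \<open>Lip_lincomb\<close> and \<open>boundary_lincomb\<close> apply literally.\<close>

lemma Lip_normalize:
  assumes "f \<in> Lip" "0 < lip_const f"
  shows "(\<lambda>x. (1 / lip_const f) * f x + 0 * f x) \<in> Lip_1"
  using Lip_lincomb[OF assms(1,1), of "1 / lip_const f" 0] assms(2) by (simp add: Lip_1_def)

lemma
  assumes T: "T \<in> metric_1_currents"
  shows KR_norm_nonneg: "0 \<le> KR_norm (boundary T)"
    and boundary_le_KR_norm: "f \<in> Lip \<Longrightarrow> boundary T f \<le> KR_norm (boundary T) * lip_const f"
proof -
  have bdd: "bdd_above (boundary T ` Lip_1)"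
  proof (rule bdd_aboveI2)
    fix f :: "'a \<Rightarrow> real" assume f: "f \<in> Lip_1"
    then have "boundary T f \<le> lip_const f * mass T" using boundary_abs_le[OF T, of f] by (simp add: Lip_1_def)
    also have "\<dots> \<le> 1 * mass T" using f by (intro mult_right_mono mass_nonneg) (simp add: Lip_1_def)
    finally show "boundary T f \<le> mass T" by simp
  qed
  have le: "boundary T f \<le> KR_norm (boundary T)" if "f \<in> Lip_1" for f
    unfolding KR_norm_def using that bdd by (rule cSUP_upper)
  show "0 \<le> KR_norm (boundary T)" using le[OF Lip_1_zero] boundary_zero[OF T] by simp
  assume f: "f \<in> Lip"
  show "boundary T f \<le> KR_norm (boundary T) * lip_const f"
  proof (cases "lip_const f = 0")
    case True
    then show ?thesis using boundary_abs_le[OF T f] by simp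
  next
    case False
    then have pos: "0 < lip_const f" using lip_const_nonneg[OF f] by simp
    have "(1 / lip_const f) * boundary T f \<le> KR_norm (boundary T)"
      using le[OF Lip_normalize[OF f pos]] boundary_lincomb[OF T f f, of "1 / lip_const f" 0] by simp
    then show ?thesis using pos by (simp add: field_simps)
  qed
qed

lemma KR_norm_le:
  assumes "\<And>f. f \<in> Lip \<Longrightarrow> B f \<le> e * lip_const f" "0 \<le> e"
  shows "KR_norm B \<le> e"
  unfolding KR_norm_def
proof (rule cSUP_least)
  fix f :: "'a \<Rightarrow> real" assume f: "f \<in> Lip_1"
  then have "B f \<le> e * lip_const f" using assms(1) by (simp add: Lip_1_def)
  also have "\<dots> \<le> e * 1" using f assms(2) by (intro mult_left_mono) (auto simp: Lip_1_def)
  finally show "B f \<le> e" by simp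
qed (use Lip_1_zero in blast)

text \<open>Otherwise, for each \<open>n\<close>, some function in \<open>Lip_1\<close> vanishes at
  the first \<open>n + 1\<close> points of a dense sequence while its boundary value exceeds
  \<open>e\<close>. Being uniformly Lipschitz, these functions tend to 0 pointwise, contrary to the
  continuity axiom.\<close>

lemma boundary_small_if_vanishing_on_finite:
  fixes T :: "'a::metric_space functional"
  assumes sep: "separable_space (euclidean :: 'a topology)" and T: "T \<in> metric_1_currents" and e: "0 < e"
  shows "\<exists>F. finite F \<and> F \<noteq> {} \<and> (\<forall>f\<in>Lip. (\<forall>x\<in>F. f x = 0) \<longrightarrow> boundary T f \<le> e * lip_const f)"
proof (rule ccontr)
  assume contra: "\<not> ?thesis"
  obtain C :: "'a set" where C: "countable C" "closure C = UNIV"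
    using sep unfolding separable_space_def by auto
  then have "C \<noteq> {}" by auto
  define X where "X = from_nat_into C"
  have X: "range X = C" unfolding X_def using C(1) \<open>C \<noteq> {}\<close> by (simp add: range_from_nat_into)
  have "\<exists>g\<in>Lip_1. (\<forall>m\<le>n. g (X m) = 0) \<and> e < boundary T g" for n
  proof -
    obtain f where f: "f \<in> Lip" "\<And>x. x \<in> X ` {..n} \<Longrightarrow> f x = 0" "e * lip_const f < boundary T f"
      using contra by (auto simp: not_le dest!: spec[of _ "X ` {..n}"])
    have "lip_const f \<noteq> 0" using boundary_abs_le[OF T f(1)] f(3) by auto
    then have pos: "0 < lip_const f" using lip_const_nonneg[OF f(1)] by simp
    have "e < (1 / lip_const f) * boundary T f" using f(3) pos by (simp add: field_simps)
    then show ?thesis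
      using Lip_normalize[OF f(1) pos] f(2) boundary_lincomb[OF T f(1,1), of "1 / lip_const f" 0]
      by (intro bexI[of _ "\<lambda>x. (1 / lip_const f) * f x + 0 * f x"]) auto
  qed
  then obtain g where g: "\<And>n. g n \<in> Lip_1" "\<And>n m. m \<le> n \<Longrightarrow> g n (X m) = 0" "\<And>n. e < boundary T (g n)"
    by metis
  have gL: "g n \<in> Lip" "lip_const (g n) \<le> 1" for n using g(1)[of n] by (auto simp: Lip_1_def)
  have lim: "(\<lambda>n. g n x) \<longlonglongrightarrow> 0" for x
  proof (rule LIMSEQ_I)
    fix r :: real assume "0 < r"
    then obtain m where m: "dist (X m) x < r"
      using C(2) X closure_approachable[of x C] by (metis UNIV_I rangeE)
    have "norm (g n x - 0) < r" if "m \<le> n" for n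
    proof -
      have "\<bar>g n x - g n (X m)\<bar> \<le> lip_const (g n) * dist x (X m)" by (rule lip_const_dist[OF gL(1)])
      also have "\<dots> \<le> 1 * dist x (X m)" by (intro mult_right_mono gL) auto
      finally show ?thesis using m g(2)[OF that] by (simp add: dist_commute)
    qed
    then show "\<exists>m. \<forall>n\<ge>m. norm (g n x - 0) < r" by blast
  qed
  have "(\<lambda>n. boundary T (g n)) \<longlonglongrightarrow> boundary T (\<lambda>_. 0)"
    unfolding boundary_def
    using gL by (intro metric_1_currentsD(3)[OF T Lip_b_const Lip_const] lim) (auto intro!: bdd_aboveI2[of _ _ 1])
  then have "e \<le> boundary T (\<lambda>_. 0)"
    using g(3) by (intro LIMSEQ_le_const) (auto intro: less_imp_le)
  then show False using e boundary_zero[OF T] by simp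
qed

text \<open>Write \<open>f = g + (f - g)\<close>, where \<open>g\<close> extends \<open>f\<close>
  from \<open>F\<close> with the largest quotient \<open>L\<close> as constant. The norm bounds the
  first part by \<open>K * L\<close>. The second vanishes on \<open>F\<close> and has constant at
  most \<open>lip_const f + L\<close>, hence the factor \<open>K + e\<close> and the remaining
  error.\<close>

lemma boundary_approx_molecules:
  fixes T :: "'a::metric_space functional"
  assumes sep: "separable_space (euclidean :: 'a topology)" and T: "T \<in> metric_1_currents" and e: "0 < e"
  shows "\<exists>P l. finite P \<and> (\<forall>i\<in>P. 0 \<le> l i) \<and> sum l P = 1 \<and>
    (\<forall>f\<in>Lip. boundary T f \<le>
      (KR_norm (boundary T) + e) * (\<Sum>(x, y)\<in>P. l (x, y) * ((f y - f x) / dist x y)) + e * lip_const f)"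
proof -
  define K where "K = KR_norm (boundary T)"
  have K: "0 \<le> K" unfolding K_def by (rule KR_norm_nonneg[OF T])
  obtain F where F: "finite F" "F \<noteq> {}"
    "\<And>f. f \<in> Lip \<Longrightarrow> (\<And>x. x \<in> F \<Longrightarrow> f x = 0) \<Longrightarrow> boundary T f \<le> e * lip_const f"
    using boundary_small_if_vanishing_on_finite[OF sep T e] by metis
  \<comment> \<open>The error term is kept inside each functional; it makes \<open>A i\<close>
    sublinear rather than linear in \<open>f\<close>.\<close>
  define A where "A = (\<lambda>(i :: 'a \<times> 'a) f. (K + e) * ((f (snd i) - f (fst i)) / dist (fst i) (snd i)) + e * lip_const f)"
  have "\<exists>l. (\<forall>i\<in>F \<times> F. 0 \<le> l i) \<and> sum l (F \<times> F) = 1 \<and>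
      (\<forall>f\<in>Lip. boundary T f \<le> (\<Sum>i\<in>F \<times> F. l i * A i f))"
  proof (rule le_Max_imp_le_convex_comb)
    fix i s t and f g :: "'a \<Rightarrow> real" assume *: "f \<in> Lip" "g \<in> Lip" "(0::real) \<le> s" "(0::real) \<le> t"
    have "e * lip_const (\<lambda>x. s * f x + t * g x) \<le> e * (s * lip_const f + t * lip_const g)"
      using Lip_lincomb(2)[OF *(1,2), of s t] * e by (intro mult_left_mono) auto
    then show "A i (\<lambda>x. s * f x + t * g x) \<le> s * A i f + t * A i g"
      by (simp add: A_def algebra_simps add_divide_distrib diff_divide_distrib)
  next
    fix f :: "'a \<Rightarrow> real" assume f: "f \<in> Lip"
    define q where "q = (\<lambda>i. (f (snd i) - f (fst i)) / dist (fst i) (snd i))"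
    define L where "L = Max (q ` (F \<times> F))"
    have qL: "q i \<le> L" if "i \<in> F \<times> F" for i
      unfolding L_def using F(1) that by (intro Max_ge) auto
    have "L \<in> q ` (F \<times> F)" unfolding L_def using F by (intro Max_in) auto
    then obtain i where i: "i \<in> F \<times> F" "L = q i" by blast
    \<comment> \<open>A diagonal pair has quotient 0, as division by zero gives 0, so the maximum is
      nonnegative and can serve as a Lipschitz constant.\<close>
    obtain x0 where "x0 \<in> F" using F(2) by blast
    then have L0: "0 \<le> L" using qL[of "(x0, x0)"] by (simp add: q_def)
    have "f x - f y \<le> L * dist x y" if "x \<in> F" "y \<in> F" for x y
    proof (cases "x = y")
      case False
      then show ?thesis using qL[of "(y, x)"] that by (simp add: q_def pos_divide_le_eq dist_commute)
    qed simp
    then obtain g where g: "L-lipschitz_on UNIV g" "\<And>x. x \<in> F \<Longrightarrow> g x = f x"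
      using lipschitz_extension_finite[OF F(1,2) L0] by blast
    have gL: "g \<in> Lip" "lip_const g \<le> L" using g(1) by (auto intro: Lip_I lip_const_le)
    let ?h = "\<lambda>x. 1 * f x + (- 1) * g x"
    have Aif: "A i f = (K + e) * L + e * lip_const f" by (simp add: A_def i(2) q_def)
    have "boundary T f = boundary T g + boundary T ?h"
      using boundary_lincomb[OF T f gL(1), of 1 "-1"] by simp
    also have "boundary T g \<le> K * L"
      using boundary_le_KR_norm[OF T gL(1)] mult_left_mono[OF gL(2) K] unfolding K_def by linarith
    also have "boundary T ?h \<le> e * lip_const ?h"
      using g(2) by (intro F(3) Lip_lincomb f gL) auto
    also have "\<dots> \<le> e * (lip_const f + L)"
      using Lip_lincomb(2)[OF f gL(1), of 1 "-1"] gL(2) e by (intro mult_left_mono) auto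
    finally have "boundary T f \<le> A i f"
      by (simp add: Aif algebra_simps)
    then show "\<exists>i\<in>F \<times> F. boundary T f \<le> A i f" using i(1) by blast
  next
    show "(\<lambda>x. s * f x + t * g x) \<in> Lip" if "f \<in> Lip" "g \<in> Lip" for f g :: "'a \<Rightarrow> real" and s t
      by (rule Lip_lincomb(1)[OF that])
    show "boundary T (\<lambda>x. s * f x + t * g x) = s * boundary T f + t * boundary T g"
      if "f \<in> Lip" "g \<in> Lip" for f g s t
      by (rule boundary_lincomb[OF T that])
  qed (use F in auto)
  then obtain l where l': "(\<forall>i\<in>F \<times> F. 0 \<le> l i) \<and> sum l (F \<times> F) = 1 \<and>
      (\<forall>f\<in>Lip. boundary T f \<le> (\<Sum>i\<in>F \<times> F. l i * A i f))" by (rule exE)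
  note l = l'[THEN conjunct1] l'[THEN conjunct2, THEN conjunct1] l'[THEN conjunct2, THEN conjunct2]
  have "(\<Sum>i\<in>F \<times> F. l i * A i f) =
      (K + e) * (\<Sum>(x, y)\<in>F \<times> F. l (x, y) * ((f y - f x) / dist x y)) + e * lip_const f" for f
  proof -
    have "(\<Sum>i\<in>F \<times> F. l i * A i f) = (\<Sum>i\<in>F \<times> F. (K + e) * (l i * ((f (snd i) - f (fst i)) / dist (fst i) (snd i)))
        + l i * (e * lip_const f))"
      by (intro sum.cong) (auto simp: A_def distrib_left)
    also have "\<dots> = (K + e) * (\<Sum>i\<in>F \<times> F. l i * ((f (snd i) - f (fst i)) / dist (fst i) (snd i))) + e * lip_const f"
      by (simp only: sum.distrib sum_distrib_left[symmetric] sum_distrib_right[symmetric] l(2) mult_1)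
    finally show ?thesis by (simp add: case_prod_unfold)
  qed
  with l show ?thesis using F(1) unfolding K_def
    by (intro exI[of _ "F \<times> F"] exI[of _ l] conjI) simp_all
qed

section \<open>Filling by curves\<close>

lemma sum_chain:
  fixes a b :: "nat \<Rightarrow> real"
  assumes "1 \<le> m"
  shows "(\<Sum>i\<in>{1..m}. b i - a i) = b m - a 1 - (\<Sum>i\<in>{1..<m}. a (i + 1) - b i)"
  using assms
proof (induction m rule: nat_induct_at_least)
  case (Suc m)
  then show ?case by (simp add: sum.atLeastLessThan_Suc)
qed simp

text \<open>The chain of curves has total length at most \<open>c * dist x y\<close>, so division by
  the distance leaves mass at most \<open>c\<close>. Its boundary differs from the molecule only by
  the jumps between consecutive curves and at the two ends.\<close>

lemma molecule_filling:
  fixes x y :: "'a::metric_space"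
  assumes pq: "piecewise_quasiconvex c (UNIV :: 'a set)" and e: "0 < e"
  shows "\<exists>R\<in>rectifiable_1_currents. mass R \<le> c \<and>
    (\<forall>f\<in>Lip. (f y - f x) / dist x y - boundary R f \<le> e * lip_const f)"
proof (cases "x = y")
  case True
  have "0 \<le> c" using pq by (simp add: piecewise_quasiconvex_def)
  then show ?thesis using True e
    by (intro bexI[of _ "\<lambda>_ _. 0"] rectifiable_zero) (auto simp: mass_zero boundary_def lip_const_nonneg)
next
  case False
  define d where "d = dist x y"
  have d: "0 < d" using False by (simp add: d_def)
  have c: "1 \<le> c" using pq by (simp add: piecewise_quasiconvex_def)
  \<comment> \<open>The jumps may have total size \<open>e * d\<close>, so that after division by
    \<open>d\<close> they contribute at most \<open>e * lip_const f\<close>.\<close>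
  have "0 < e * d" using d e by simp
  note chain = pq[unfolded piecewise_quasiconvex_def, THEN conjunct2, THEN bspec, OF UNIV_I, THEN bspec,
      OF UNIV_I, THEN spec, THEN mp, OF this, of x y, folded d_def]
  obtain m p q and \<theta> :: "nat \<Rightarrow> real \<Rightarrow> 'a" where m: "1 \<le> m"
    and gap: "dist x (p 1) + dist (q m) y + (\<Sum>i\<in>{1..<m}. dist (p (i + 1)) (q i)) < e * d"
    and \<theta>: "\<forall>i\<in>{1..m}. (\<exists>L. L-lipschitz_on {0..1} (\<theta> i)) \<and> \<theta> i ` {0..1} \<subseteq> UNIV \<and> \<theta> i 0 = p i \<and> \<theta> i 1 = q i"
    and len: "(\<Sum>i\<in>{1..m}. curve_length (\<theta> i)) \<le> ennreal (c * d)"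
    using chain by (elim exE conjE) (rule that; assumption)
  have "\<exists>R. R \<in> rectifiable_1_currents \<and> (\<forall>f. boundary R f = f (q i) - f (p i)) \<and> ennreal (mass R) \<le> curve_length (\<theta> i)"
    if i: "i \<in> {1..m}" for i
  proof -
    obtain L where "L-lipschitz_on {0..1} (\<theta> i)" using \<theta> i by blast
    from rectifiable_curve[OF this] show ?thesis using \<theta> i by auto
  qed
  then obtain R where R: "\<And>i. i \<in> {1..m} \<Longrightarrow> R i \<in> rectifiable_1_currents"
    "\<And>i f. i \<in> {1..m} \<Longrightarrow> boundary (R i) f = f (q i) - f (p i)"
    "\<And>i. i \<in> {1..m} \<Longrightarrow> ennreal (mass (R i)) \<le> curve_length (\<theta> i)" by metis
  define S where "S = (\<lambda>f p. \<Sum>i\<in>{1..m}. R i f p)"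
  have S: "S \<in> rectifiable_1_currents" and mS: "mass S \<le> (\<Sum>i\<in>{1..m}. mass (R i))"
    unfolding S_def by (rule rectifiable_sum mass_sum_le; use R(1) in simp)+
  have "ennreal (\<Sum>i\<in>{1..m}. mass (R i)) = (\<Sum>i\<in>{1..m}. ennreal (mass (R i)))"
    by (rule sum_ennreal[symmetric]) (rule mass_nonneg)
  also have "\<dots> \<le> (\<Sum>i\<in>{1..m}. curve_length (\<theta> i))" by (intro sum_mono R)
  finally have "ennreal (\<Sum>i\<in>{1..m}. mass (R i)) \<le> ennreal (c * d)" using len by simp
  then have mS': "mass S \<le> c * d" using mS c d by simp
  have gap_S: "f y - f x - boundary S f \<le> e * d * lip_const f" if f: "f \<in> Lip" for f
  proof -
    have lip: "f u - f v \<le> lip_const f * dist u v" for u v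
      using lip_const_dist[OF f, of u v] by simp
    have "boundary S f = (\<Sum>i\<in>{1..m}. f (q i) - f (p i))"
      unfolding S_def boundary_def using R(2) by (simp add: boundary_def)
    also have "\<dots> = f (q m) - f (p 1) - (\<Sum>i\<in>{1..<m}. f (p (i + 1)) - f (q i))"
      by (rule sum_chain[OF m])
    finally have "f y - f x - boundary S f =
        (f (p 1) - f x) + (f y - f (q m)) + (\<Sum>i\<in>{1..<m}. f (p (i + 1)) - f (q i))" by simp
    also have "\<dots> \<le> lip_const f * dist (p 1) x + lip_const f * dist y (q m) +
        (\<Sum>i\<in>{1..<m}. lip_const f * dist (p (i + 1)) (q i))"
      by (intro add_mono sum_mono lip)
    also have "\<dots> = lip_const f * (dist x (p 1) + dist (q m) y + (\<Sum>i\<in>{1..<m}. dist (p (i + 1)) (q i)))"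
      by (simp add: sum_distrib_left distrib_left dist_commute)
    also have "\<dots> \<le> lip_const f * (e * d)"
      using gap lip_const_nonneg[OF f] by (intro mult_left_mono) auto
    finally show ?thesis by (simp add: mult.commute)
  qed
  have "(f y - f x) / d - boundary (\<lambda>f p. (1 / d) * S f p) f \<le> e * lip_const f" if "f \<in> Lip" for f
  proof -
    have "(f y - f x - boundary S f) / d \<le> e * lip_const f"
      using gap_S[OF that] d
      by (simp add: pos_divide_le_eq ac_simps)
    then show ?thesis by (simp add: boundary_def diff_divide_distrib)
  qed
  moreover have "mass (\<lambda>f p. (1 / d) * S f p) \<le> c"
  proof -
    have "mass (\<lambda>f p. (1 / d) * S f p) \<le> \<bar>1 / d\<bar> * mass S"
      using S by (intro mass_scale_le) (simp add: rectifiable_1_currents_iff)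
    also have "\<dots> \<le> c" using mS' d by (simp add: field_simps)
    finally show ?thesis .
  qed
  ultimately show ?thesis
    using rectifiable_scale[OF S, of "1 / d"] unfolding d_def by (intro bexI[of _ "\<lambda>f p. (1 / dist x y) * S f p"]) auto
qed

lemma approximate_filling:
  fixes T :: "'a::metric_space functional"
  assumes sep: "separable_space (euclidean :: 'a topology)" and pq: "piecewise_quasiconvex c (UNIV :: 'a set)"
    and T: "T \<in> metric_1_currents" and e: "0 < e"
  shows "\<exists>R\<in>rectifiable_1_currents. mass R \<le> c * KR_norm (boundary T) + e \<and>
    KR_norm (boundary (\<lambda>f p. T f p + (- 1) * R f p)) \<le> e"
proof -
  define K where "K = KR_norm (boundary T)"
  have K: "0 \<le> K" unfolding K_def by (rule KR_norm_nonneg[OF T])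
  have c: "1 \<le> c" using pq by (simp add: piecewise_quasiconvex_def)
  \<comment> \<open>The excess mass will be \<open>c * e' = e / 2\<close>, and the boundary error
    \<open>2 * e' = e / c\<close>, which is at most \<open>e\<close> because
    \<open>1 \<le> c\<close>.\<close>
  define e' where "e' = e / (2 * c)"
  have e': "0 < e'" using c e by (simp add: e'_def)
  obtain P l where P: "finite P" and l: "\<And>i. i \<in> P \<Longrightarrow> 0 \<le> l i" "sum l P = 1"
    and TP: "\<And>f. f \<in> Lip \<Longrightarrow> boundary T f \<le>
      (K + e') * (\<Sum>(x, y)\<in>P. l (x, y) * ((f y - f x) / dist x y)) + e' * lip_const f"
    using boundary_approx_molecules[OF sep T e'] unfolding K_def by blast
  \<comment> \<open>The molecules carry total weight \<open>K + e'\<close>, so their filling errors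
    add up to exactly \<open>e'\<close>.\<close>
  define h where "h = e' / (K + e')"
  have h: "0 < h" using K e' by (simp add: h_def)
  obtain M where M: "\<And>i :: 'a \<times> 'a. M i \<in> rectifiable_1_currents" "\<And>i. mass (M i) \<le> c"
    "\<And>i f. f \<in> Lip \<Longrightarrow> (f (snd i) - f (fst i)) / dist (fst i) (snd i) - boundary (M i) f \<le> h * lip_const f"
  proof -
    have "\<forall>i :: 'a \<times> 'a. \<exists>R. R \<in> rectifiable_1_currents \<and> mass R \<le> c \<and>
        (\<forall>f\<in>Lip. (f (snd i) - f (fst i)) / dist (fst i) (snd i) - boundary R f \<le> h * lip_const f)"
      using molecule_filling[OF pq h] by (intro allI) (rule bexE, assumption, blast)
    from choice[OF this] obtain M where "\<forall>i :: 'a \<times> 'a. M i \<in> rectifiable_1_currents \<and> mass (M i) \<le> c \<and>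
        (\<forall>f\<in>Lip. (f (snd i) - f (fst i)) / dist (fst i) (snd i) - boundary (M i) f \<le> h * lip_const f)"
      by (rule exE)
    then show ?thesis by (intro that[of M]) blast+
  qed
  define R where "R = (\<lambda>f p. \<Sum>i\<in>P. ((K + e') * l i) * M i f p)"
  have s: "(\<lambda>f p. ((K + e') * l i) * M i f p) \<in> rectifiable_1_currents" for i
    by (rule rectifiable_scale[OF M(1)])
  have R: "R \<in> rectifiable_1_currents"
    unfolding R_def by (rule rectifiable_sum[OF P s])
  have "mass R \<le> (\<Sum>i\<in>P. mass (\<lambda>f p. ((K + e') * l i) * M i f p))"
    unfolding R_def by (rule mass_sum_le[OF P s])
  also have "\<dots> \<le> (\<Sum>i\<in>P. ((K + e') * l i) * c)"
  proof (rule sum_mono)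
    fix i assume i: "i \<in> P"
    have nn: "0 \<le> (K + e') * l i" using K e' l(1)[OF i] by simp
    have "mass (\<lambda>f p. ((K + e') * l i) * M i f p) \<le> \<bar>(K + e') * l i\<bar> * mass (M i)"
      using M(1) by (intro mass_scale_le) (simp add: rectifiable_1_currents_iff)
    also have "\<dots> \<le> ((K + e') * l i) * c" using nn M(2) by (simp add: mult_left_mono)
    finally show "mass (\<lambda>f p. ((K + e') * l i) * M i f p) \<le> ((K + e') * l i) * c" .
  qed
  also have "\<dots> = c * K + c * e'"
    by (simp only: sum_distrib_right[symmetric] sum_distrib_left[symmetric] l(2)) (simp add: algebra_simps)
  also have "\<dots> \<le> c * K + e" using c e by (simp add: e'_def)
  finally have mR: "mass R \<le> c * K + e" .
  have "boundary (\<lambda>f p. T f p + (- 1) * R f p) f \<le> e * lip_const f" if f: "f \<in> Lip" for f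
  proof -
    let ?q = "\<lambda>i. (f (snd i) - f (fst i)) / dist (fst i) (snd i)"
    have "boundary (\<lambda>f p. T f p + (- 1) * R f p) f = boundary T f - (\<Sum>i\<in>P. ((K + e') * l i) * boundary (M i) f)"
      by (simp add: boundary_def R_def)
    also have "\<dots> \<le> (K + e') * (\<Sum>i\<in>P. l i * ?q i) + e' * lip_const f - (\<Sum>i\<in>P. ((K + e') * l i) * boundary (M i) f)"
      using TP[OF f] by (simp add: case_prod_unfold)
    also have "\<dots> = (\<Sum>i\<in>P. ((K + e') * l i) * (?q i - boundary (M i) f)) + e' * lip_const f"
      by (simp add: right_diff_distrib sum_subtractf sum_distrib_left mult.assoc)
    also have "\<dots> \<le> (\<Sum>i\<in>P. ((K + e') * l i) * (h * lip_const f)) + e' * lip_const f"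
      using K e' l(1) M(3)[OF f] by (intro add_right_mono sum_mono mult_left_mono) auto
    also have "(\<Sum>i\<in>P. ((K + e') * l i) * (h * lip_const f)) = (K + e') * (h * lip_const f)"
      by (simp only: sum_distrib_right[symmetric] sum_distrib_left[symmetric] l(2) mult_1_right)
    also have "(K + e') * (h * lip_const f) + e' * lip_const f = (2 * e') * lip_const f"
    proof -
      have "(K + e') * h = e'" using K e' by (simp add: h_def)
      then show ?thesis by (simp flip: mult.assoc)
    qed
    also have "\<dots> \<le> e * lip_const f"
      using c e by (intro mult_right_mono lip_const_nonneg f) (simp add: e'_def pos_divide_le_eq)
    finally show ?thesis .
  qed
  then have "KR_norm (boundary (\<lambda>f p. T f p + (- 1) * R f p)) \<le> e"
    using e by (intro KR_norm_le) auto
  then show ?thesis using R mR unfolding K_def by blast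
qed

section \<open>Iterated filling of the remaining boundary\<close>

theorem corollary2p16:
  fixes T :: "'a::metric_space functional" and c \<epsilon> :: real
  assumes "separable_space (euclidean :: 'a topology)"
    and "piecewise_quasiconvex c (UNIV :: 'a set)"
    and "T \<in> metric_1_currents"
    and "\<epsilon> > 0"
  shows "\<exists>C\<in>metric_1_currents. \<exists>R\<in>rectifiable_1_currents.
           (\<forall>f\<in>Lip. boundary C f = 0) \<and>
           (\<forall>f\<in>Lip_b. \<forall>\<pi>\<in>Lip. T f \<pi> = C f \<pi> + R f \<pi>) \<and>
           mass C \<le> mass T + c * KR_norm (boundary T) + \<epsilon> \<and>
           mass R \<le> c * KR_norm (boundary T) + \<epsilon>"
proof -
  note T = assms(3)
  define K where "K = KR_norm (boundary T)"
  have c: "1 \<le> c" using assms(2) by (simp add: piecewise_quasiconvex_def)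
  define good where "good = (\<lambda>(U :: 'a functional) e R. R \<in> rectifiable_1_currents \<and>
    mass R \<le> c * KR_norm (boundary U) + e \<and> KR_norm (boundary (\<lambda>f p. U f p + (- 1) * R f p)) \<le> e)"
  \<comment> \<open>A filling is chosen as a function of the current and the tolerance, so the
    remainders can be defined by primitive recursion.\<close>
  define St where "St = (\<lambda>U e. SOME R. good U e R)"
  have "good U e (St U e)" if "U \<in> metric_1_currents" "0 < e" for U e
  proof -
    have "\<exists>R. good U e R"
      using approximate_filling[OF assms(1,2) that] unfolding good_def Bex_def .
    then show ?thesis unfolding St_def by (rule someI_ex)
  qed
  then have St: "St U e \<in> rectifiable_1_currents"
    "mass (St U e) \<le> c * KR_norm (boundary U) + e"
    "KR_norm (boundary (\<lambda>f p. U f p + (- 1) * St U e f p)) \<le> e"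
    if "U \<in> metric_1_currents" "0 < e" for U e
    using that unfolding good_def by simp_all
  \<comment> \<open>Each \<open>e k\<close> is paid for twice: as the excess mass of step
    \<open>k\<close>, and multiplied by \<open>c\<close> as the boundary norm that step
    \<open>k + 1\<close> has to fill.\<close>
  define e where "e = (\<lambda>k::nat. \<epsilon> / (1 + c) * (1 / 2) ^ Suc k)"
  have e: "0 < e k" for k using c assms(4) by (simp add: e_def)
  have e_sums: "e sums (\<epsilon> / (1 + c))"
    unfolding e_def using sums_mult[OF power_half_series, of "\<epsilon> / (1 + c)"] by simp
  define U where "U = rec_nat T (\<lambda>k V f p. V f p + (- 1) * St V (e k) f p)"
  have U0: "U 0 = T" and US: "U (Suc k) = (\<lambda>f p. U k f p + (- 1) * St (U k) (e k) f p)" for k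
    by (simp_all add: U_def)
  define Q where "Q = (\<lambda>k. St (U k) (e k))"
  have U: "U k \<in> metric_1_currents" for k
  proof (induction k)
    case (Suc k)
    then have "St (U k) (e k) \<in> metric_1_currents" using St(1)[OF _ e] by (simp add: rectifiable_1_currents_iff)
    then show ?case unfolding US by (intro current_add current_scale Suc)
  qed (simp add: U0 T)
  have Q: "Q k \<in> rectifiable_1_currents" for k unfolding Q_def by (rule St(1)[OF U e])
  have KR: "KR_norm (boundary (U (Suc k))) \<le> e k" for k
    unfolding US by (rule St(3)[OF U e])
  define b where "b = (\<lambda>k. (if k = 0 then c * K else c * e (k - 1)) + e k)"
  have mQ: "mass (Q k) \<le> b k" for k
  proof (cases k)
    case 0
    then show ?thesis using St(2)[OF U e, of 0 0] by (simp add: Q_def b_def U0 K_def)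
  next
    case (Suc j)
    have "mass (Q k) \<le> c * KR_norm (boundary (U k)) + e k" unfolding Q_def by (rule St(2)[OF U e])
    also have "c * KR_norm (boundary (U k)) \<le> c * e j" using KR[of j] c Suc by (simp add: mult_left_mono)
    finally show ?thesis using Suc by (simp add: b_def)
  qed
  have "(\<lambda>k. if k = 0 then c * K else c * e (k - 1)) sums (c * (\<epsilon> / (1 + c)) + c * K)"
    using sums_Suc[of "\<lambda>k. if k = 0 then c * K else c * e (k - 1)"] sums_mult[OF e_sums, of c] by simp
  from sums_add[OF this e_sums] have "b sums (c * (\<epsilon> / (1 + c)) + c * K + \<epsilon> / (1 + c))"
    unfolding b_def .
  also have "c * (\<epsilon> / (1 + c)) + c * K + \<epsilon> / (1 + c) = c * K + \<epsilon>"
  proof -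
    have "c * (\<epsilon> / (1 + c)) + \<epsilon> / (1 + c) = (1 + c) * (\<epsilon> / (1 + c))" by (simp only: distrib_right mult_1 add.commute)
    also have "\<dots> = \<epsilon>" using c by simp
    finally show ?thesis by linarith
  qed
  finally have b: "b sums (c * K + \<epsilon>)" .
  have sm: "summable (\<lambda>k. mass (Q k))"
    by (rule summable_comparison_test'[OF sums_summable[OF b], of 0])
      (use mQ in \<open>simp add: abs_of_nonneg[OF mass_nonneg]\<close>)
  define R where "R = (\<lambda>f p. \<Sum>k. Q k f p)"
  have R: "R \<in> rectifiable_1_currents" unfolding R_def by (rule rectifiable_suminf(2)[OF Q sm])
  have "mass R \<le> (\<Sum>k. mass (Q k))" unfolding R_def by (rule rectifiable_suminf(3)[OF Q sm])
  also have "\<dots> \<le> suminf b" by (intro suminf_le mQ sm sums_summable[OF b])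
  finally have mR: "mass R \<le> c * K + \<epsilon>" using sums_unique[OF b] by simp
  define C where "C = (\<lambda>f p. T f p + (- 1) * R f p)"
  have Rc: "R \<in> metric_1_currents" using R by (simp add: rectifiable_1_currents_iff)
  have C: "C \<in> metric_1_currents" unfolding C_def by (intro current_add current_scale T Rc)
  have "mass C \<le> mass T + mass (\<lambda>f p. (- 1) * R f p)"
    unfolding C_def by (intro mass_add_le T current_scale Rc)
  also have "mass (\<lambda>f p. (- 1) * R f p) \<le> mass R"
    using mass_scale_le[OF Rc, of "- 1"] by simp
  finally have mC: "mass C \<le> mass T + mass R" by simp
  have "boundary C f = 0" if f: "f \<in> Lip" for f
  proof -
    \<comment> \<open>The remainders are \<open>T\<close> minus the partial sums of
      \<open>R\<close>. Their boundaries therefore converge to that of \<open>C\<close>, while the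
      norm estimate drives them to 0.\<close>
    have "U n g p = T g p - (\<Sum>k<n. Q k g p)" for n g p
      by (induction n) (simp_all add: U0 US Q_def)
    moreover have "(\<lambda>n. \<Sum>k<n. Q k (\<lambda>_. 1) f) \<longlonglongrightarrow> R (\<lambda>_. 1) f"
      unfolding R_def by (intro summable_LIMSEQ rectifiable_suminf(1)[OF Q sm] Lip_b_const f)
    ultimately have "(\<lambda>n. boundary (U n) f) \<longlonglongrightarrow> boundary C f"
      unfolding boundary_def C_def by (auto intro!: tendsto_eq_intros)
    then have lim: "(\<lambda>n. boundary (U (Suc n)) f) \<longlonglongrightarrow> boundary C f" by (rule LIMSEQ_Suc)
    have "\<bar>boundary (U (Suc n)) f\<bar> \<le> e n * lip_const f" for n
    proof -
      have le: "boundary (U (Suc n)) g \<le> e n * lip_const g" if "g \<in> Lip" for g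
        using boundary_le_KR_norm[OF U that, of "Suc n"] mult_right_mono[OF KR lip_const_nonneg[OF that], of n]
        by linarith
      \<comment> \<open>\<open>KR_norm\<close> takes the supremum of signed values; the lower bound
        follows by testing with \<open>- f\<close>.\<close>
      let ?g = "\<lambda>x. (- 1) * f x + 0 * f x"
      have g: "?g \<in> Lip" "lip_const ?g \<le> lip_const f" using Lip_lincomb[OF f f, of "- 1" 0] by auto
      have "- boundary (U (Suc n)) f = boundary (U (Suc n)) ?g"
        using boundary_lincomb[OF U f f, of "Suc n" "- 1" 0] by simp
      also have "\<dots> \<le> e n * lip_const f"
        using le[OF g(1)] mult_left_mono[OF g(2), of "e n"] e[of n] by linarith
      finally show ?thesis using le[OF f] by linarith
    qed
    then have "\<forall>\<^sub>F n in sequentially. norm (boundary (U (Suc n)) f) \<le> e n * lip_const f"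
      by (simp add: always_eventually)
    moreover have "(\<lambda>n. e n * lip_const f) \<longlonglongrightarrow> 0"
      using tendsto_mult_left_zero[OF summable_LIMSEQ_zero[OF sums_summable[OF e_sums]]] .
    ultimately have "(\<lambda>n. boundary (U (Suc n)) f) \<longlonglongrightarrow> 0"
      by (rule Lim_null_comparison)
    with lim show ?thesis by (rule LIMSEQ_unique)
  qed
  then show ?thesis
    using C R mC mR unfolding K_def by (intro bexI[of _ C] bexI[of _ R]) (auto simp: C_def)
qed

end
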